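(* Let $g$ be a totally positive function of finite type $m\ge 2$ and let $a,K,M\in\mathbb{N}$ with $K/a\in\mathbb{N}$ and $K/M\in\mathbb{N}$. Let $P_Kg(x)=\sum_{k\in\mathbb{Z}}g(x-kK)$, $x\in[0,K]$. If $a/M<1$, then the Gabor family $\mathcal{G}(P_Kg,a,1/M)=\{M_{l/M}T_{ka}P_Kg: k=0,\ldots,K/a-1,\ l\in\mathbb{Z}\}$ is a frame for $L^2(\mathbb{T}_K)$. Furthermore, if $\gamma$ is the dual window of $\mathcal{G}(g,a,1/M)$ in $L^2(\mathbb{R})$ produced by the algorithm described below (with $\alpha=a$, $\beta=1/M$ and any $L\in\mathbb{N}_0$), then $P_K\gamma$ is a dual window of $\mathcal{G}(P_Kg,a,1/M)$. By duality, if $a/M>1$, then $\mathcal{G}(P_Kg,a,1/M)$ is a Riesz sequence in $L^2(\mathbb{T}_K)$.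
   Context: $j$ is the imaginary unit, $\hat g(\xi)=\int g(x)e^{-2\pi jx\xi}dx$. $g\in L^1(\mathbb{R})$ is totally positive of finite type $m$ if $\hat g(\xi)=C\prod_{k=1}^m(1+2\pi j\delta_k\xi)^{-1}$ with $C>0$ and nonzero real $\delta_k$; let $p$ (resp. $q$) be the number of positive (resp. negative) $\delta_k$. $\mathbb{T}_K=[0,K]$ with periodic structure; on $L^2(\mathbb{T}_K)$, $M_\xi T_xf(t)=f((t-x)\bmod K)e^{2\pi j\xi t}$ for $\xi\in\frac1K\mathbb{Z}$. On $L^2(\mathbb{R})$, $M_\xi T_xf(t)=f(t-x)e^{2\pi j\xi t}$. Frame: $A\|f\|^2\le\sum|\langle f,e_i\rangle|^2\le B\|f\|^2$ for all $f$ with $A,B>0$; Riesz sequence: $A'\|c\|^2\le\|\sum c_ie_i\|^2\le B'\|c\|^2$. A dual window of a Gabor frame $\mathcal{G}(\phi,\alpha,\beta)$ is $\psi$ with $\mathcal{G}(\psi,\alpha,\beta)$ a frame and $f=\sum\langle f,M_{l\beta}T_{k\alpha}\phi\rangle M_{l\beta}T_{k\alpha}\psi$ for all $f$ (sum over the index set of the family). Algorithm (input $g$, $\alpha,\beta>0$ with $\alpha\beta<1$, $L\in\mathbb{N}_0$): for each $x\in[0,\alpha)$ set $r=\lfloor 1/(1-\alpha\beta)\rfloor$, $k_1=-(r+1)p-L$, $k_2=(r+1)q+L$, $i_1=\lfloor (k_1+p-1)/(\alpha\beta)-x/\alpha\rfloor+1$, $i_2=\lceil (k_2-q+1)/(\alpha\beta)-x/\alpha\rceil-1$;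 form the matrix $P=(g(x+\alpha i-k/\beta))_{i_1\le i\le i_2,\,k_1\le k\le k_2}$, let $P^\dagger=(q_{k,i})_{k_1\le k\le k_2,\,i_1\le i\le i_2}$ be its Moore–Penrose pseudoinverse, and set $\gamma(x+\alpha i)=\beta q_{0,i}$ for $i_1\le i\le i_2$ and $\gamma(x+\alpha i)=0$ otherwise. *)

theory Defs
  imports "HOL-Analysis.Analysis"
begin

definition fourier :: "(real \<Rightarrow> real) \<Rightarrow> real \<Rightarrow> complex" where
  "fourier g \<xi> = (LINT x|lborel. complex_of_real (g x) * cis (- 2 * pi * x * \<xi>))"

definition tp_finite_type :: "(real \<Rightarrow> real) \<Rightarrow> nat \<Rightarrow> real \<Rightarrow> (nat \<Rightarrow> real) \<Rightarrow> bool" where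
  "tp_finite_type g m C \<delta> \<longleftrightarrow>
     integrable lborel g \<and> C > 0 \<and> (\<forall>k<m. \<delta> k \<noteq> 0) \<and>
     (\<forall>\<xi>. fourier g \<xi> =
        complex_of_real C * (\<Prod>k<m. inverse (1 + 2 * pi * \<i> * complex_of_real (\<delta> k * \<xi>))))"

definition tp_p :: "nat \<Rightarrow> (nat \<Rightarrow> real) \<Rightarrow> nat" where
  "tp_p m \<delta> = card {k. k < m \<and> \<delta> k > 0}"

definition tp_q :: "nat \<Rightarrow> (nat \<Rightarrow> real) \<Rightarrow> nat" where
  "tp_q m \<delta> = card {k. k < m \<and> \<delta> k < 0}"

section \<open>L2 on a set S (S = {0..K} models the torus T_K, S = UNIV the real line)\<close>

definition L2 :: "real set \<Rightarrow> (real \<Rightarrow> complex) \<Rightarrow> bool" where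
  "L2 S f \<longleftrightarrow> f \<in> borel_measurable lborel \<and>
     integrable lborel (\<lambda>x. indicator S x * (cmod (f x))\<^sup>2)"

definition ip :: "real set \<Rightarrow> (real \<Rightarrow> complex) \<Rightarrow> (real \<Rightarrow> complex) \<Rightarrow> complex" where
  "ip S f h = (LINT x:S|lborel. f x * cnj (h x))"

definition nrm2 :: "real set \<Rightarrow> (real \<Rightarrow> complex) \<Rightarrow> real" where
  "nrm2 S f = (LINT x:S|lborel. (cmod (f x))\<^sup>2)"

definition is_frame :: "real set \<Rightarrow> 'i set \<Rightarrow> ('i \<Rightarrow> real \<Rightarrow> complex) \<Rightarrow> bool" where
  "is_frame S I e \<longleftrightarrow> (\<forall>i\<in>I. L2 S (e i)) \<and>
     (\<exists>A B. A > 0 \<and> B > 0 \<and>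
       (\<forall>f. L2 S f \<longrightarrow>
          (\<lambda>i. (cmod (ip S f (e i)))\<^sup>2) summable_on I \<and>
          A * nrm2 S f \<le> (\<Sum>\<^sub>\<infinity>i\<in>I. (cmod (ip S f (e i)))\<^sup>2) \<and>
          (\<Sum>\<^sub>\<infinity>i\<in>I. (cmod (ip S f (e i)))\<^sup>2) \<le> B * nrm2 S f))"

text \<open>Riesz sequence: the Riesz inequalities for all finitely supported
  coefficient sequences (which extend by density to all of l2(I)).\<close>
definition is_riesz_seq :: "real set \<Rightarrow> 'i set \<Rightarrow> ('i \<Rightarrow> real \<Rightarrow> complex) \<Rightarrow> bool" where
  "is_riesz_seq S I e \<longleftrightarrow> (\<forall>i\<in>I. L2 S (e i)) \<and>
     (\<exists>A B. A > 0 \<and> B > 0 \<and>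
       (\<forall>F c. finite F \<longrightarrow> F \<subseteq> I \<longrightarrow>
          A * (\<Sum>i\<in>F. (cmod (c i))\<^sup>2) \<le> nrm2 S (\<lambda>t. \<Sum>i\<in>F. c i * e i t) \<and>
          nrm2 S (\<lambda>t. \<Sum>i\<in>F. c i * e i t) \<le> B * (\<Sum>i\<in>F. (cmod (c i))\<^sup>2)))"

definition is_dual :: "real set \<Rightarrow> 'i set \<Rightarrow> ('i \<Rightarrow> real \<Rightarrow> complex) \<Rightarrow> ('i \<Rightarrow> real \<Rightarrow> complex) \<Rightarrow> bool" where
  "is_dual S I \<phi> \<psi> \<longleftrightarrow> is_frame S I \<psi> \<and>
     (\<forall>f. L2 S f \<longrightarrow>
        ((\<lambda>F. nrm2 S (\<lambda>t. f t - (\<Sum>i\<in>F. ip S f (\<phi> i) * \<psi> i t))) \<longlongrightarrow> 0)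
          (finite_subsets_at_top I))"

definition rmod :: "real \<Rightarrow> real \<Rightarrow> real" where
  "rmod t K = t - K * of_int \<lfloor>t / K\<rfloor>"

definition periodize :: "real \<Rightarrow> (real \<Rightarrow> real) \<Rightarrow> real \<Rightarrow> real" where
  "periodize K h x = (\<Sum>\<^sub>\<infinity>k\<in>(UNIV::int set). h (x - of_int k * K))"

definition gaborT_index :: "nat \<Rightarrow> nat \<Rightarrow> (nat \<times> int) set" where
  "gaborT_index K a = {0..<K div a} \<times> UNIV"

definition gaborT :: "real \<Rightarrow> real \<Rightarrow> real \<Rightarrow> (real \<Rightarrow> complex) \<Rightarrow> nat \<times> int \<Rightarrow> real \<Rightarrow> complex" where
  "gaborT K a b \<phi> kl t =
     \<phi> (rmod (t - real (fst kl) * a) K) * cis (2 * pi * (of_int (snd kl) * b) * t)"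

text \<open>Moore--Penrose pseudoinverse of a real matrix P with rows indexed by the finite
  set I and columns by the finite set J (entries outside are ignored); the result Q
  has rows indexed by J and columns by I and is zero outside J x I.\<close>
definition pinv :: "int set \<Rightarrow> int set \<Rightarrow> (int \<Rightarrow> int \<Rightarrow> real) \<Rightarrow> int \<Rightarrow> int \<Rightarrow> real" where
  "pinv I J P = (THE Q.
     (\<forall>k i. (k \<notin> J \<or> i \<notin> I) \<longrightarrow> Q k i = 0) \<and>
     (\<forall>i\<in>I. \<forall>k\<in>J. (\<Sum>k'\<in>J. P i k' * (\<Sum>i'\<in>I. Q k' i' * P i' k)) = P i k) \<and>
     (\<forall>k\<in>J. \<forall>i\<in>I. (\<Sum>i'\<in>I. Q k i' * (\<Sum>k'\<in>J. P i' k' * Q k' i)) = Q k i) \<and>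
     (\<forall>i\<in>I. \<forall>i'\<in>I. (\<Sum>k\<in>J. P i k * Q k i') = (\<Sum>k\<in>J. P i' k * Q k i)) \<and>
     (\<forall>k\<in>J. \<forall>k'\<in>J. (\<Sum>i\<in>I. Q k i * P i k') = (\<Sum>i\<in>I. Q k' i * P i k)))"

definition alg_r :: "real \<Rightarrow> real \<Rightarrow> int" where
  "alg_r \<alpha> \<beta> = \<lfloor>1 / (1 - \<alpha> * \<beta>)\<rfloor>"

definition alg_k1 :: "nat \<Rightarrow> real \<Rightarrow> real \<Rightarrow> nat \<Rightarrow> int" where
  "alg_k1 p \<alpha> \<beta> L = - (alg_r \<alpha> \<beta> + 1) * int p - int L"

definition alg_k2 :: "nat \<Rightarrow> real \<Rightarrow> real \<Rightarrow> nat \<Rightarrow> int" where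
  "alg_k2 q \<alpha> \<beta> L = (alg_r \<alpha> \<beta> + 1) * int q + int L"

definition alg_i1 :: "nat \<Rightarrow> real \<Rightarrow> real \<Rightarrow> nat \<Rightarrow> real \<Rightarrow> int" where
  "alg_i1 p \<alpha> \<beta> L x =
     \<lfloor>(of_int (alg_k1 p \<alpha> \<beta> L) + real p - 1) / (\<alpha> * \<beta>) - x / \<alpha>\<rfloor> + 1"

definition alg_i2 :: "nat \<Rightarrow> real \<Rightarrow> real \<Rightarrow> nat \<Rightarrow> real \<Rightarrow> int" where
  "alg_i2 q \<alpha> \<beta> L x =
     \<lceil>(of_int (alg_k2 q \<alpha> \<beta> L) - real q + 1) / (\<alpha> * \<beta>) - x / \<alpha>\<rceil> - 1"

definition alg_gamma_at :: "(real \<Rightarrow> real) \<Rightarrow> nat \<Rightarrow> nat \<Rightarrow> real \<Rightarrow> real \<Rightarrow> nat \<Rightarrow> real \<Rightarrow> int \<Rightarrow> real" where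
  "alg_gamma_at g p q \<alpha> \<beta> L x i =
     (let I = {alg_i1 p \<alpha> \<beta> L x .. alg_i2 q \<alpha> \<beta> L x};
          J = {alg_k1 p \<alpha> \<beta> L .. alg_k2 q \<alpha> \<beta> L};
          P = (\<lambda>i k. g (x + \<alpha> * of_int i - of_int k / \<beta>))
      in if i \<in> I then \<beta> * pinv I J P 0 i else 0)"

definition alg_gamma :: "(real \<Rightarrow> real) \<Rightarrow> nat \<Rightarrow> nat \<Rightarrow> real \<Rightarrow> real \<Rightarrow> nat \<Rightarrow> real \<Rightarrow> real" where
  "alg_gamma g p q \<alpha> \<beta> L t =
     alg_gamma_at g p q \<alpha> \<beta> L (t - \<alpha> * of_int \<lfloor>t / \<alpha>\<rfloor>) \<lfloor>t / \<alpha>\<rfloor>"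

end

theory Submission
  imports Defs "HOL-Probability.Probability"
begin

text \<open>
  Up to the factor \<open>C\<close>, a totally positive function of finite type is an iterated convolution of one-sided
  exponentials \<open>\<bar>d\<bar>\<inverse> exp (- x / d)\<close>, \<open>x / d > 0\<close> (uniqueness of the Fourier transform). A combination
  \<open>\<Sum>\<^sub>k c\<^sub>k g (x - k / \<beta>)\<close> is therefore an exponential spline. On a maximal run of knot intervals where it does
  not vanish, Rolle's theorem, applied once for every convolution factor, turns zeros into sign alternations
  of a combination of single exponentials, which is of constant sign between knots. Comparing numbers shows
  that the matrices \<open>P\<close> of the algorithm are injective, and uniformly so by compactness. Hence \<open>\<gamma>\<close> is bounded,
  measurable and compactly supported. The relation \<open>P\<^sup>\<dagger> P = 1\<close>, together with the difference equations
  that \<open>g\<close> satisfies on the two sides of the origin, gives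
  \<open>\<Sum>\<^sub>i \<gamma> (t + \<alpha> i) g (t + \<alpha> i - k / \<beta>) = \<beta> \<delta>\<^bsub>k,0\<^esub>\<close> for all integers \<open>k\<close>.
  Periodization carries this over to the torus, where Parseval's identity on \<open>[0, M]\<close> converts it into
  the frame bounds and the reconstruction formula. The same relation for the lattice with
  \<open>\<alpha> = M\<close>, \<open>\<beta> = 1 / a\<close> provides coefficient functionals that give the Riesz bounds when \<open>a > M\<close>.
\<close>

text \<open>The constants of the algorithm come from the zero count. Take a maximal run of cells on
  which the spline does not vanish. At a bounded end every convolution level vanishes, so stripping
  off a factor loses no alternation there. At an infinite end the weight \<open>exp (x / d)\<close>
  helps only factors of one sign, and the others lose the gain at that end. The loss is made good by
  starting the window \<open>p - 1\<close> cells after the first knot and ending it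
  \<open>q - 1\<close> cells before the last: one zero per cell of the window is then contradictory
  as long as the run has a bounded end inside the window. If no such end cuts the window, its
  samples must outnumber the coefficients. This is what r is for: it is the least integer with
  \<open>r * (1 - \<alpha> * \<beta>) > \<alpha> * \<beta>\<close>. Two more obstacles: the Fourier
  transform fixes g only almost everywhere, so continuity selects the representative; and base
  points range over the half-open interval from 0 to \<alpha> while the set of sample indices jumps
  with the base point, so compactness has to rest on the openness of the window and on injectivity
  at every real base point.\<close>

section \<open>Zeros and sign alternations\<close>

text \<open>\<open>osc f S n \<sigma> t\<close>: there are \<open>n\<close> points of \<open>S\<close> to the left of \<open>t\<close> at which \<open>f\<close> alternates in
  sign, with the sign of \<open>\<sigma>\<close> at the last one.\<close>
primrec osc :: "(real \<Rightarrow> real) \<Rightarrow> real set \<Rightarrow> nat \<Rightarrow> real \<Rightarrow> real \<Rightarrow> bool" where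
  "osc f S 0 \<sigma> t = True"
| "osc f S (Suc n) \<sigma> t = (\<exists>x\<in>S. x < t \<and> \<sigma> * f x > 0 \<and> osc f S n (- \<sigma>) x)"

definition alternates :: "(real \<Rightarrow> real) \<Rightarrow> real set \<Rightarrow> nat \<Rightarrow> bool" where
  "alternates f S n \<longleftrightarrow> (\<exists>\<sigma> t. osc f S n \<sigma> t)"

text \<open>The integrated form of the differential equation \<open>f + d f' = h\<close>, which also makes sense
  at the jumps of \<open>h\<close>.\<close>
definition exp_primitive :: "real \<Rightarrow> (real \<Rightarrow> real) \<Rightarrow> (real \<Rightarrow> real) \<Rightarrow> bool" where
  "exp_primitive d f h \<longleftrightarrow> d \<noteq> 0 \<and>
     (\<forall>x y. x \<le> y \<longrightarrow> ((\<lambda>s. exp (s / d) * h s / d) has_integral exp (y / d) * f y - exp (x / d) * f x) {x..y})"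

text \<open>If \<open>exp (x / d) * f x\<close> becomes small at an end of \<open>S\<close>, passing from \<open>f\<close> to \<open>f + d f'\<close> gains
  a sign alternation there; without this, one alternation is lost.\<close>
definition left_vanish :: "real \<Rightarrow> (real \<Rightarrow> real) \<Rightarrow> real set \<Rightarrow> bool" where
  "left_vanish d f S \<longleftrightarrow> (\<forall>x\<in>S. \<forall>\<epsilon>>0. \<exists>u<x. {u<..<x} \<subseteq> S \<and> \<bar>exp (u / d) * f u\<bar> < \<epsilon>)"

definition right_vanish :: "real \<Rightarrow> (real \<Rightarrow> real) \<Rightarrow> real set \<Rightarrow> bool" where
  "right_vanish d f S \<longleftrightarrow> (\<forall>x\<in>S. \<forall>\<epsilon>>0. \<exists>u>x. {x<..<u} \<subseteq> S \<and> \<bar>exp (u / d) * f u\<bar> < \<epsilon>)"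

definition nondegenerate :: "(real \<Rightarrow> real) \<Rightarrow> real set \<Rightarrow> bool" where
  "nondegenerate f S \<longleftrightarrow> (\<forall>u v. u < v \<longrightarrow> {u<..<v} \<subseteq> S \<longrightarrow> (\<exists>w\<in>{u<..<v}. f w \<noteq> 0))"

lemma osc_SucI:
  "x \<in> S \<Longrightarrow> x < t \<Longrightarrow> \<sigma> * f x > 0 \<Longrightarrow> osc f S n (- \<sigma>) x \<Longrightarrow> osc f S (Suc n) \<sigma> t"
  by auto

lemma alternatesI: "osc f S n \<sigma> t \<Longrightarrow> alternates f S n"
  by (auto simp: alternates_def)

lemma osc_mono: "osc f S n \<sigma> t \<Longrightarrow> t \<le> t' \<Longrightarrow> osc f S n \<sigma> t'"
  by (cases n) (auto intro: less_le_trans)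

lemma mult_exp_pos: "\<sigma> * (exp u * y) > 0" if "\<sigma> * y > 0" for \<sigma> u y :: real
  using mult_pos_pos[OF exp_gt_zero that, of u] by (simp add: mult.left_commute)

lemma mult_diff_pos: "\<tau> * (A - B) > 0" if "\<tau> * A > 0" "\<bar>B\<bar> < \<bar>A\<bar>" for \<tau> A B :: real
  using that by (auto simp: zero_less_mult_iff)

text \<open>This is the mean value theorem for \<open>exp (x / d) * f x\<close>, whose derivative is
  \<open>exp (x / d) * h x / d\<close>. In integral form it needs no continuity, so \<open>h\<close>
  may jump.\<close>

lemma exp_primitive_sign:
  assumes "exp_primitive d f h" "x < y" and pos: "\<sigma> * (exp (y / d) * f y - exp (x / d) * f x) > 0"
  shows "\<exists>z. x < z \<and> z < y \<and> \<sigma> / d * h z > 0"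
proof (rule ccontr)
  assume no: "\<not> ?thesis"
  have "((\<lambda>s. exp (s / d) * h s / d) has_integral exp (y / d) * f y - exp (x / d) * f x) {x..y}"
    using assms by (auto simp: exp_primitive_def)
  from has_integral_mult_right[OF this, of \<sigma>]
  have "((\<lambda>s. \<sigma> * (exp (s / d) * h s / d)) has_integral \<sigma> * (exp (y / d) * f y - exp (x / d) * f x)) {x<..<y}"
    by (simp add: has_integral_Icc_iff_Ioo)
  moreover have "\<sigma> * (exp (s / d) * h s / d) \<le> 0" if "s \<in> {x<..<y}" for s
  proof -
    have "\<sigma> / d * h s \<le> 0" using no that by (force simp: not_less)
    then have "exp (s / d) * (\<sigma> / d * h s) \<le> 0" by (rule mult_nonneg_nonpos[OF exp_ge_zero])
    also have "exp (s / d) * (\<sigma> / d * h s) = \<sigma> * (exp (s / d) * h s / d)" by simp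
    finally show ?thesis .
  qed
  ultimately have "\<sigma> * (exp (y / d) * f y - exp (x / d) * f x) \<le> 0"
    by (rule has_integral_le[OF _ has_integral_0]) auto
  with pos show False by simp
qed

text \<open>The weighted \<open>f\<close> is larger in modulus at \<open>w\<close> than at both
  outer points, so it moves away from zero before \<open>w\<close> and back after it. The two
  movements give \<open>h\<close> opposite signs, whatever the sign of \<open>f w\<close>.\<close>

lemma exp_primitive_both_signs:
  assumes "exp_primitive d f h" "u < w" "w < v"
    and "\<bar>exp (u / d) * f u\<bar> < \<bar>exp (w / d) * f w\<bar>" "\<bar>exp (v / d) * f v\<bar> < \<bar>exp (w / d) * f w\<bar>"
    and "\<sigma> \<noteq> 0"
  shows "\<exists>z. u < z \<and> z < v \<and> \<sigma> * h z > 0"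
proof -
  have d: "d \<noteq> 0" using assms(1) by (simp add: exp_primitive_def)
  have sgn: "\<sigma> * d * (exp (w / d) * f w) \<noteq> 0" using assms d by auto
  show ?thesis
  proof (cases "\<sigma> * d * (exp (w / d) * f w) > 0")
    case True
    from exp_primitive_sign[OF assms(1,2) mult_diff_pos[OF True assms(4)]] show ?thesis using d assms(3) by force
  next
    case False
    then have "(- \<sigma> * d) * (exp (w / d) * f w) > 0" using sgn by linarith
    from mult_diff_pos[OF this assms(5)] have "(\<sigma> * d) * (exp (v / d) * f v - exp (w / d) * f w) > 0"
      by (simp add: algebra_simps)
    from exp_primitive_sign[OF assms(1,3) this] obtain z where "w < z" "z < v" "\<sigma> * d / d * h z > 0" by auto
    then show ?thesis using d assms(2) by (intro exI[of _ z]) auto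
  qed
qed

text \<open>Rolle's step: between consecutive alternation points the weighted \<open>f\<close> moves
  by an amount of known sign, which \<open>h\<close> must follow up to the sign of \<open>d\<close>.
  All new points lie to the left of \<open>x\<close>, and \<open>left_vanish\<close> supplies one
  more before the first of the old ones.\<close>

lemma osc_exp_primitive:
  assumes "exp_primitive d f h" "is_interval S" "bL \<longrightarrow> left_vanish d f S"
    and "x \<in> S" "\<sigma> * f x > 0" "osc f S n (- \<sigma>) x"
  shows "osc h S (n + of_bool bL) (\<sigma> / d) x"
  using assms(4-6)
proof (induction n arbitrary: \<sigma> x)
  case 0
  show ?case
  proof (cases bL)
    case True
    have "0 < \<bar>exp (x / d) * f x\<bar>" using 0 by auto
    then obtain u where u: "u < x" "{u<..<x} \<subseteq> S" "\<bar>exp (u / d) * f u\<bar> < \<bar>exp (x / d) * f x\<bar>"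
      using assms(3) True 0(1) unfolding left_vanish_def by blast
    have "\<sigma> * (exp (x / d) * f x - exp (u / d) * f u) > 0"
      by (rule mult_diff_pos[OF mult_exp_pos[OF 0(2)] u(3)])
    from exp_primitive_sign[OF assms(1) u(1) this] u(2) True show ?thesis by auto
  qed simp
next
  case (Suc n)
  then obtain y where y: "y \<in> S" "y < x" "- \<sigma> * f y > 0" "osc f S n \<sigma> y" by auto
  from Suc.IH[OF y(1,3)] y(4) have o: "osc h S (n + of_bool bL) (- (\<sigma> / d)) y" by simp
  have "\<sigma> * (exp (x / d) * f x) > 0" "- \<sigma> * (exp (y / d) * f y) > 0"
    by (rule mult_exp_pos, use Suc.prems(2) y(3) in simp)+
  then have "\<sigma> * (exp (x / d) * f x - exp (y / d) * f y) > 0" by (simp add: algebra_simps)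
  from exp_primitive_sign[OF assms(1) y(2) this]
  obtain z where z: "y < z" "z < x" "\<sigma> / d * h z > 0" by auto
  have "z \<in> S" using assms(2) y(1) Suc.prems(1) z(1,2) unfolding is_interval_1 by (meson less_imp_le)
  then have "osc h S (Suc (n + of_bool bL)) (\<sigma> / d) x"
    by (rule osc_SucI[where x = z]) (use z osc_mono[OF o, of z] in auto)
  then show ?case by simp
qed

text \<open>\<open>n + 1\<close> alternation points have \<open>n\<close> gaps between them, and
  each vanishing end acts as one further gap.\<close>

lemma alternates_exp_primitive:
  assumes "exp_primitive d f h" "is_interval S" "bL \<longrightarrow> left_vanish d f S" "bR \<longrightarrow> right_vanish d f S"
    and "alternates f S (Suc n)"
  shows "alternates h S (n + of_bool bL + of_bool bR)"
proof -
  obtain \<sigma> t where "osc f S (Suc n) \<sigma> t" using assms(5) by (auto simp: alternates_def)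
  then obtain x where x: "x \<in> S" "\<sigma> * f x > 0" "osc f S n (- \<sigma>) x" by auto
  have o: "osc h S (n + of_bool bL) (\<sigma> / d) x"
    by (rule osc_exp_primitive) (use assms x in auto)
  show ?thesis
  proof (cases bR)
    case True
    have "0 < \<bar>exp (x / d) * f x\<bar>" using x by auto
    then obtain u where u: "x < u" "{x<..<u} \<subseteq> S" "\<bar>exp (u / d) * f u\<bar> < \<bar>exp (x / d) * f x\<bar>"
      using assms(4) True x(1) unfolding right_vanish_def by blast
    have "(- \<sigma>) * (exp (u / d) * f u - exp (x / d) * f x) > 0"
      using mult_diff_pos[OF mult_exp_pos[OF x(2)] u(3)] by (simp add: algebra_simps)
    from exp_primitive_sign[OF assms(1) u(1) this]
    obtain z where z: "x < z" "z < u" "- (\<sigma> / d) * h z > 0" by auto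
    have "osc h S (Suc (n + of_bool bL)) (- (\<sigma> / d)) u"
      by (rule osc_SucI[of z]) (use z u(2) osc_mono[OF o, of z] in \<open>auto simp del: osc.simps\<close>)
    then have "osc h S (n + of_bool bL + of_bool bR) (- (\<sigma> / d)) u" using True by (simp del: osc.simps)
    then show ?thesis by (rule alternatesI)
  qed (use alternatesI[OF o] in simp)
qed

text \<open>Zeros need not be sign changes; but in each gap between two zeros of \<open>f\<close> the
  function \<open>h\<close> takes both signs.\<close>
lemma osc_of_zeros:
  assumes fh: "exp_primitive d f h" and S: "is_interval S" "open S"
    and L: "bL \<longrightarrow> left_vanish d f S"
    and nd: "nondegenerate f S"
    and "finite Z" "Z \<noteq> {}" "Z \<subseteq> S" "\<forall>z\<in>Z. f z = 0"
  shows "\<exists>\<sigma>. \<sigma> \<noteq> 0 \<and> osc h S (card Z + of_bool bL) \<sigma> (Max Z)"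
  using assms(6-)
proof (induction Z rule: finite_linorder_max_induct)
  case (insert b A)
  have b: "b \<in> S" "f b = 0" using insert by auto
  have sub: "{x<..<b} \<subseteq> S" if "x \<in> S" for x
    using S(1) that b(1) unfolding is_interval_1 by (meson greaterThanLessThan_iff less_imp_le subsetI)
  have Mx: "Max (insert b A) = b" using insert(1,2) by (intro Max_eqI) auto
  have cd: "card (insert b A) = Suc (card A)" using insert(1,2) by auto
  show ?case
  proof (cases "A = {}")
    case True
    obtain e where e: "e > 0" "{b - e<..<b} \<subseteq> S"
    proof -
      obtain e where "e > 0" "ball b e \<subseteq> S" using S(2) b(1) open_contains_ball by blast
      then show thesis by (intro that[of e]) (auto simp: dist_real_def subset_eq)
    qed
    show ?thesis
    proof (cases bL)
      case False
      obtain w where w: "w \<in> {b - e<..<b}" "f w \<noteq> 0" using nd e unfolding nondegenerate_def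
        by (metis diff_less_eq less_add_same_cancel1)
      have "f w * f w > 0" using w by (auto simp: zero_less_mult_iff)
      then have "- f w * (exp (b / d) * f b - exp (w / d) * f w) > 0"
        using mult_exp_pos[of "f w" "f w" "w / d"] b by simp
      from exp_primitive_sign[OF fh _ this] w obtain z where z: "w < z" "z < b" "- f w / d * h z > 0" by auto
      have "osc h S (Suc 0) (- f w / d) b" by (rule osc_SucI[of z]) (use z w e in auto)
      moreover have "- f w / d \<noteq> 0" using z by auto
      ultimately show ?thesis using False True by (intro exI[of _ "- f w / d"]) (simp add: Mx del: osc.simps)
    next
      case bL: True
      obtain w where w: "w \<in> {b - e<..<b}" "f w \<noteq> 0" using nd e unfolding nondegenerate_def
        by (metis diff_less_eq less_add_same_cancel1)
      have wS: "w \<in> S" using w e by auto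
      have "\<bar>exp (w / d) * f w\<bar> > 0" using w by simp
      then obtain u where u: "u < w" "{u<..<w} \<subseteq> S" "\<bar>exp (u / d) * f u\<bar> < \<bar>exp (w / d) * f w\<bar>"
        using L bL wS unfolding left_vanish_def by blast
      have both: "\<exists>z. u < z \<and> z < b \<and> \<sigma> * h z > 0" if "\<sigma> \<noteq> 0" for \<sigma>
        using that by (intro exp_primitive_both_signs[OF fh u(1) _ u(3)]) (use w b in auto)
      obtain z1 z2 where z: "u < z1" "z1 < b" "1 * h z1 > 0" "u < z2" "z2 < b" "(-1) * h z2 > 0"
        using both[of 1] both[of "-1"] by auto
      have zS: "z \<in> S" if "u < z" "z < b" for z
        using that u(2) sub[OF wS] wS by (cases z w rule: linorder_cases) auto
      have "z1 \<noteq> z2" using z by auto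
      \<comment> \<open>The order of the two points is unknown, but either order yields two
        alternations, and the claim leaves the sign at the last one open.\<close>
      then consider "z1 < z2" | "z2 < z1" by linarith
      then show ?thesis
      proof cases
        case 1
        then have "osc h S (Suc (Suc 0)) (-1) b" using z zS[of z1] zS[of z2] by (intro osc_SucI[of z2] osc_SucI[of z1]) auto
        then show ?thesis using True bL by (intro exI[of _ "-1"]) (simp add: Mx del: osc.simps)
      next
        case 2
        then have "osc h S (Suc (Suc 0)) 1 b" using z zS[of z1] zS[of z2] by (intro osc_SucI[of z1] osc_SucI[of z2]) auto
        then show ?thesis using True bL by (intro exI[of _ 1]) (simp add: Mx del: osc.simps)
      qed
    qed
  next
    case False
    then obtain \<sigma> where \<sigma>: "\<sigma> \<noteq> 0" "osc h S (card A + of_bool bL) \<sigma> (Max A)" using insert by auto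
    have MA: "Max A \<in> A" using False insert(1) by simp
    have a: "Max A < b" "Max A \<in> S" "f (Max A) = 0" using MA insert by auto
    obtain w where w: "w \<in> {Max A<..<b}" "f w \<noteq> 0"
      using nd a(1) sub[OF a(2)] unfolding nondegenerate_def by meson
    obtain z where z: "Max A < z" "z < b" "- \<sigma> * h z > 0"
      using exp_primitive_both_signs[OF fh, of "Max A" w b "- \<sigma>"] w a b \<sigma> by auto
    have "osc h S (Suc (card A + of_bool bL)) (- \<sigma>) b"
      by (rule osc_SucI[of z]) (use z sub[OF a(2)] osc_mono[OF \<sigma>(2), of z] in \<open>auto simp del: osc.simps\<close>)
    then show ?thesis using \<sigma>(1) by (intro exI[of _ "- \<sigma>"]) (simp add: Mx cd del: osc.simps)
  qed
qed simp

text \<open>Compared with \<open>alternates_exp_primitive\<close>, \<open>card Z\<close> zeros count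
  like \<open>card Z + 1\<close> alternations, even where \<open>f\<close> touches zero without
  changing sign. Without zeros, nondegeneracy still provides one nonzero value, which is a single
  alternation.\<close>

lemma alternates_of_zeros:
  assumes fh: "exp_primitive d f h" and S: "is_interval S" "open S" "S \<noteq> {}"
    and L: "bL \<longrightarrow> left_vanish d f S" and R: "bR \<longrightarrow> right_vanish d f S"
    and nd: "nondegenerate f S"
    and Z: "finite Z" "Z \<subseteq> S" "\<forall>z\<in>Z. f z = 0"
  shows "alternates h S (card Z + of_bool bL + of_bool bR)"
proof (cases "Z = {}")
  case True
  obtain b where b: "b \<in> S" using S by auto
  obtain e where e: "e > 0" "{b - e<..<b} \<subseteq> S"
  proof -
    obtain e where "e > 0" "ball b e \<subseteq> S" using S(2) b(1) open_contains_ball by blast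
    then show thesis by (intro that[of e]) (auto simp: dist_real_def subset_eq)
  qed
  obtain w where w: "w \<in> {b - e<..<b}" "f w \<noteq> 0" using nd e unfolding nondegenerate_def
    by (metis diff_less_eq less_add_same_cancel1)
  have "f w * f w > 0" using w by (auto simp: zero_less_mult_iff)
  then have "osc f S (Suc 0) (f w) b" using e w by (intro osc_SucI[of w]) auto
  then have "alternates f S (Suc 0)" by (rule alternatesI)
  from alternates_exp_primitive[OF fh S(1) L R this] True show ?thesis by simp
next
  case False
  obtain \<sigma> where \<sigma>: "\<sigma> \<noteq> 0" "osc h S (card Z + of_bool bL) \<sigma> (Max Z)"
    using osc_of_zeros[OF fh S(1,2) L nd Z(1) False Z(2,3)] by auto
  show ?thesis
  proof (cases bR)
    case True
    define b where "b = Max Z"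
    have "b \<in> Z" using False Z(1) by (simp add: b_def)
    then have b: "b \<in> S" "f b = 0" using Z by auto
    obtain e where e: "e > 0" "{b<..<b + e} \<subseteq> S"
    proof -
      obtain e where "e > 0" "ball b e \<subseteq> S" using S(2) b(1) open_contains_ball by blast
      then show thesis by (intro that[of e]) (auto simp: dist_real_def subset_eq)
    qed
    obtain w where w: "w \<in> {b<..<b + e}" "f w \<noteq> 0" using nd e unfolding nondegenerate_def
      by (metis less_add_same_cancel1)
    have wS: "w \<in> S" using w e by auto
    have "\<bar>exp (w / d) * f w\<bar> > 0" using w by simp
    then obtain u where u: "w < u" "{w<..<u} \<subseteq> S" "\<bar>exp (u / d) * f u\<bar> < \<bar>exp (w / d) * f w\<bar>"
      using R True wS unfolding right_vanish_def by blast
    obtain z where z: "b < z" "z < u" "- \<sigma> * h z > 0"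
      using exp_primitive_both_signs[OF fh, of b w u "- \<sigma>"] w b \<sigma> u by auto
    have "z \<in> S"
      using z u(2) e(2) w(1) wS by (cases z w rule: linorder_cases) (auto simp: subset_eq)
    then have "osc h S (Suc (card Z + of_bool bL)) (- \<sigma>) u"
      by (rule osc_SucI[of z]) (use z osc_mono[OF \<sigma>(2), of z] in \<open>auto simp: b_def simp del: osc.simps\<close>)
    from alternatesI[OF this] show ?thesis using True by simp
  qed (use alternatesI[OF \<sigma>(2)] in simp)
qed

text \<open>Two consecutive alternation points cannot share a fibre of \<open>\<iota>\<close>, since
  \<open>f\<close> has constant sign on each. Hence the index grows by at least 1 from one to the
  next.\<close>

lemma alternates_bound:
  fixes \<iota> :: "real \<Rightarrow> int"
  assumes alt: "alternates f S N" and \<iota>: "mono \<iota>"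
    and rng: "\<And>x. x \<in> S \<Longrightarrow> f x \<noteq> 0 \<Longrightarrow> lo \<le> \<iota> x \<and> \<iota> x \<le> hi"
    and sgn: "\<And>x y. x \<in> S \<Longrightarrow> y \<in> S \<Longrightarrow> \<iota> x = \<iota> y \<Longrightarrow> f x * f y \<ge> 0"
    and N: "N \<ge> 1"
  shows "int N \<le> hi - lo + 1"
proof -
  have *: "\<exists>x\<in>S. x < t \<and> \<sigma> * f x > 0 \<and> lo + int n \<le> \<iota> x" if "osc f S (Suc n) \<sigma> t" for n \<sigma> t
    using that
  proof (induction n arbitrary: \<sigma> t)
    case 0
    then obtain x where x: "x \<in> S" "x < t" "\<sigma> * f x > 0" by auto
    then have "f x \<noteq> 0" by auto
    with x show ?case using rng[of x] by (intro bexI[of _ x]) auto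
  next
    case (Suc n)
    obtain x where x: "x \<in> S" "x < t" "\<sigma> * f x > 0" "osc f S (Suc n) (- \<sigma>) x"
      using Suc.prems unfolding osc.simps(2)[of f S "Suc n"] by blast
    obtain y where y: "y \<in> S" "y < x" "- \<sigma> * f y > 0" "lo + int n \<le> \<iota> y"
      using Suc.IH[OF x(4)] by auto
    have "\<iota> y \<le> \<iota> x" using \<iota> y(2) by (simp add: monoD)
    moreover have "\<iota> y \<noteq> \<iota> x"
    proof
      assume "\<iota> y = \<iota> x"
      then have "f y * f x \<ge> 0" using sgn x y by auto
      then show False using x(3) y(3) by (auto simp: zero_less_mult_iff zero_le_mult_iff mult_less_0_iff)
    qed
    ultimately show ?case using x y by (intro bexI[of _ x]) auto
  qed
  obtain \<sigma> t where "osc f S N \<sigma> t" using alt by (auto simp: alternates_def)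
  with N have "osc f S (Suc (N - 1)) \<sigma> t" by simp
  from *[OF this] obtain x where x: "x \<in> S" "\<sigma> * f x > 0" "lo + int (N - 1) \<le> \<iota> x" by auto
  then have "f x \<noteq> 0" by auto
  with rng[of x] x N show ?thesis by auto
qed

lemma card_less_Suc_filter: "card {i. i < Suc j \<and> P i} = card {i. i < j \<and> P i} + of_bool (P j)"
proof (cases "P j")
  case True
  then have "{i. i < Suc j \<and> P i} = insert j {i. i < j \<and> P i}" by (auto simp: less_Suc_eq)
  then show ?thesis using True by simp
next
  case False
  then have "{i. i < Suc j \<and> P i} = {i. i < j \<and> P i}" by (auto simp: less_Suc_eq)
  then show ?thesis using False by simp
qed

text \<open>Each level costs one alternation and regains one for each vanishing end. By the
  assumption \<open>LR\<close> no level makes a net loss, and the levels at which both ends vanish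
  gain one each.\<close>

lemma alternates_chain:
  assumes prim: "\<And>i. i < j \<Longrightarrow> exp_primitive (d (Suc i)) (f (Suc i)) (f i)"
    and S: "is_interval S"
    and L: "\<And>i. i < j \<Longrightarrow> bL (Suc i) \<Longrightarrow> left_vanish (d (Suc i)) (f (Suc i)) S"
    and R: "\<And>i. i < j \<Longrightarrow> bR (Suc i) \<Longrightarrow> right_vanish (d (Suc i)) (f (Suc i)) S"
    and LR: "\<And>i. i < j \<Longrightarrow> bL (Suc i) \<or> bR (Suc i)"
    and alt: "alternates (f j) S N" "N \<ge> 1"
  shows "alternates (f 0) S (N + card {i. i < j \<and> bL (Suc i) \<and> bR (Suc i)})"
  using assms
proof (induction j arbitrary: N)
  case (Suc j)
  obtain n where n: "N = Suc n" using Suc.prems(7) by (cases N) auto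
  have "alternates (f j) S (n + of_bool (bL (Suc j)) + of_bool (bR (Suc j)))"
    by (rule alternates_exp_primitive[OF Suc.prems(1)[OF lessI] S]) (use Suc.prems n in auto)
  moreover have "n + of_bool (bL (Suc j)) + of_bool (bR (Suc j)) = N + of_bool (bL (Suc j) \<and> bR (Suc j))"
    using Suc.prems(5)[of j] n by auto
  ultimately have "alternates (f j) S (N + of_bool (bL (Suc j) \<and> bR (Suc j)))" by simp
  then have "alternates (f 0) S (N + of_bool (bL (Suc j) \<and> bR (Suc j)) + card {i. i < j \<and> bL (Suc i) \<and> bR (Suc i)})"
    using Suc.prems by (intro Suc.IH) auto
  moreover have "card {i. i < Suc j \<and> bL (Suc i) \<and> bR (Suc i)} =
     card {i. i < j \<and> bL (Suc i) \<and> bR (Suc i)} + of_bool (bL (Suc j) \<and> bR (Suc j))"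
    by (rule card_less_Suc_filter)
  ultimately show ?case by (simp add: ac_simps)
qed simp

section \<open>One-sided exponentials and their convolutions\<close>

text \<open>The value at the jump is 0, the limit from the side where the kernel vanishes. This
  convention decides to which neighbouring cell a knot is assigned in
  \<open>f0_alternates_bound\<close>.\<close>

definition ekern :: "real \<Rightarrow> real \<Rightarrow> real" where
  "ekern d x = (if x * d > 0 then exp (- x / d) / \<bar>d\<bar> else 0)"

definition halfline :: "real \<Rightarrow> real \<Rightarrow> real set" where
  "halfline d x = (if d > 0 then {..x} else {x..})"

text \<open>The convolution \<open>ekern d * h\<close>.\<close>
definition econv :: "real \<Rightarrow> (real \<Rightarrow> real) \<Rightarrow> real \<Rightarrow> real" where
  "econv d h x = exp (- x / d) / \<bar>d\<bar> * (LINT s:halfline d x|lborel. exp (s / d) * h s)"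

text \<open>A pointwise exponential bound is preserved by \<open>econv\<close> and makes the
  periodization converge at every point with a uniform bound; integrability alone would give neither
  convergence at every point nor the bound.\<close>

definition exp_decay :: "(real \<Rightarrow> real) \<Rightarrow> bool" where
  "exp_decay h \<longleftrightarrow> h \<in> borel_measurable borel \<and> (\<exists>B c. c > 0 \<and> (\<forall>x. \<bar>h x\<bar> \<le> B * exp (- c * \<bar>x\<bar>)))"

section \<open>Exponential decay and its stability under convolution\<close>

lemma integrable_exp_abs:
  fixes c :: real assumes "c > 0"
  shows "integrable lborel (\<lambda>x. exp (- c * \<bar>x\<bar>))"
proof -
  have "(\<lambda>x. exp (- c * x)) absolutely_integrable_on {0..}"
    using integrable_on_exp_minus_to_infinity[OF assms, of 0]
    by (intro nonnegative_absolutely_integrable_1) auto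
  then have "set_integrable lborel {0..} (\<lambda>x. exp (- c * x))"
    unfolding set_integrable_def by (subst (asm) integrable_completion) auto
  then have 1: "integrable lborel (\<lambda>x. indicator {0..} x * exp (- c * x))"
    by (simp add: set_integrable_def)
  from lborel_integrable_real_affine[OF 1, of "-1" 0]
  have "integrable lborel (\<lambda>x. indicator {0..} (- x) * exp (c * x))" by simp
  from Bochner_Integration.integrable_add[OF 1 this]
  show ?thesis
    by (rule Bochner_Integration.integrable_bound) (auto simp: indicator_def abs_if)
qed

lemma exp_decay_measurable: "exp_decay h \<Longrightarrow> h \<in> borel_measurable borel"
  by (simp add: exp_decay_def)

lemma exp_decay_integrable: "exp_decay h \<Longrightarrow> integrable lborel h"
proof -
  assume h: "exp_decay h"
  then obtain B c where c: "c > 0" "\<And>x. \<bar>h x\<bar> \<le> B * exp (- c * \<bar>x\<bar>)" by (auto simp: exp_decay_def)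
  have "integrable lborel (\<lambda>x. B * exp (- c * \<bar>x\<bar>))" using integrable_exp_abs[OF c(1)] by simp
  then show ?thesis
    by (rule Bochner_Integration.integrable_bound)
      (use h c(2) in \<open>auto simp: exp_decay_def intro!: AE_I2 order_trans[OF c(2)]\<close>)
qed

lemma exp_decay_bounded: "exp_decay h \<Longrightarrow> \<exists>B. \<forall>x. \<bar>h x\<bar> \<le> B"
proof -
  assume "exp_decay h"
  then obtain B c where c: "c > 0" "\<And>x. \<bar>h x\<bar> \<le> B * exp (- c * \<bar>x\<bar>)" by (auto simp: exp_decay_def)
  have "\<bar>h x\<bar> \<le> \<bar>B\<bar>" for x
  proof -
    have "\<bar>h x\<bar> \<le> \<bar>B\<bar> * exp (- c * \<bar>x\<bar>)"
      by (rule order_trans[OF c(2)]) (auto intro!: mult_right_mono)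
    also have "\<dots> \<le> \<bar>B\<bar> * 1" using c(1) by (intro mult_left_mono) auto
    finally show ?thesis by simp
  qed
  then show ?thesis by blast
qed

lemma halfline_exp_le: "d \<noteq> 0 \<Longrightarrow> s \<in> halfline d x \<Longrightarrow> - x / d + s / d = - \<bar>x - s\<bar> / \<bar>d\<bar>"
  by (auto simp: halfline_def abs_if field_simps split: if_splits)

lemma halfline_measurable [measurable]: "halfline d x \<in> sets borel"
  by (auto simp: halfline_def)

lemma econv_integrable:
  assumes "exp_decay h" "d \<noteq> 0"
  shows "set_integrable lborel (halfline d x) (\<lambda>s. exp (s / d) * h s)"
proof -
  have [measurable]: "h \<in> borel_measurable borel" using assms by (simp add: exp_decay_def)
  have "integrable lborel (\<lambda>s. exp (x / d) * h s)"
    using exp_decay_integrable[OF assms(1)] by simp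
  then show ?thesis unfolding set_integrable_def
  proof (rule Bochner_Integration.integrable_bound)
    have "exp (s / d) \<le> exp (x / d)" if "s \<in> halfline d x" for s
      using that assms(2) by (auto simp: halfline_def divide_right_mono divide_right_mono_neg split: if_splits)
    then show "AE s in lborel. norm (indicator (halfline d x) s *\<^sub>R (exp (s / d) * h s)) \<le> norm (exp (x / d) * h s)"
      by (intro AE_I2) (auto simp: indicator_def abs_mult intro!: mult_right_mono)
  qed simp
qed

text \<open>Up to the factor \<open>1 / \<bar>d\<bar>\<close>, the weighted convolution at
  \<open>x\<close> is an integral over a half-line ending at \<open>x\<close>, so its increments are
  integrals over bounded intervals. For negative \<open>d\<close> the half-line extends to the
  right, and the reversed orientation is absorbed by \<open>\<bar>d\<bar> = - d\<close>.\<close>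

lemma econv_exp_primitive:
  assumes h: "exp_decay h" and d: "d \<noteq> 0"
  shows "exp_primitive d (econv d h) h"
  unfolding exp_primitive_def
proof (intro conjI allI impI d)
  fix x y :: real assume xy: "x \<le> y"
  let ?e = "\<lambda>s. exp (s / d) * h s"
  have [measurable]: "h \<in> borel_measurable borel" using assms by (simp add: exp_decay_def)
  have ex: "exp (z / d) * econv d h z = (LINT s:halfline d z|lborel. ?e s) / \<bar>d\<bar>" for z
  proof -
    have "exp (z / d) * exp (- z / d) = 1" by (simp add: exp_minus flip: exp_add)
    then show ?thesis by (simp add: econv_def)
  qed
  have int: "set_integrable lborel (halfline d z) ?e" for z by (rule econv_integrable[OF h d])
  have sub: "set_integrable lborel A ?e" if "A \<subseteq> halfline d z" "A \<in> sets borel" for A z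
    by (rule set_integrable_subset[OF int]) (use that in auto)
  have "(?e has_integral (LINT s:{x..y}|lborel. ?e s)) {x..y}"
  proof -
    have "set_integrable lborel {x..y} ?e"
      by (cases "d > 0"; rule sub[of _ y] sub[of _ x]) (auto simp: halfline_def)
    then show ?thesis
      using set_borel_integral_eq_integral[of "{x..y}" ?e] by (simp add: has_integral_integral)
  qed
  moreover have "(LINT s:{x..y}|lborel. ?e s) / d = exp (y / d) * econv d h y - exp (x / d) * econv d h x"
  proof (cases "d > 0")
    case True
    have "(LINT s:{..y}|lborel. ?e s) = (LINT s:{..x} \<union> {x<..y}|lborel. ?e s)"
      using xy by (intro arg_cong[where f = "\<lambda>A. LINT s:A|lborel. ?e s"]) auto
    also have "\<dots> = (LINT s:{..x}|lborel. ?e s) + (LINT s:{x<..y}|lborel. ?e s)"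
      by (intro set_integral_Un sub[of _ y]) (use True xy in \<open>auto simp: halfline_def\<close>)
    also have "(LINT s:{x<..y}|lborel. ?e s) = (LINT s:{x..y}|lborel. ?e s)"
      by (rule set_integral_cong_set) (use AE_lborel_singleton[of x] in \<open>auto simp: set_borel_measurable_def elim: eventually_mono\<close>)
    finally show ?thesis using True by (simp add: ex halfline_def diff_divide_distrib[symmetric])
  next
    case False
    have "(LINT s:{x..}|lborel. ?e s) = (LINT s:{x..<y} \<union> {y..}|lborel. ?e s)"
      using xy by (intro arg_cong[where f = "\<lambda>A. LINT s:A|lborel. ?e s"]) auto
    also have "\<dots> = (LINT s:{x..<y}|lborel. ?e s) + (LINT s:{y..}|lborel. ?e s)"
      by (intro set_integral_Un sub[of _ x]) (use False xy in \<open>auto simp: halfline_def\<close>)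
    also have "(LINT s:{x..<y}|lborel. ?e s) = (LINT s:{x..y}|lborel. ?e s)"
      by (rule set_integral_cong_set) (use AE_lborel_singleton[of y] in \<open>auto simp: set_borel_measurable_def elim: eventually_mono\<close>)
    finally have "(LINT s:{x..}|lborel. ?e s) = (LINT s:{x..y}|lborel. ?e s) + (LINT s:{y..}|lborel. ?e s)" .
    moreover have "\<bar>d\<bar> = - d" using False by simp
    ultimately show ?thesis using False unfolding ex by (simp add: halfline_def add_divide_distrib)
  qed
  ultimately show "((\<lambda>s. ?e s / d) has_integral exp (y / d) * econv d h y - exp (x / d) * econv d h x) {x..y}"
    using has_integral_divide[of ?e "LINT s:{x..y}|lborel. ?e s" "{x..y}" d] by simp
qed

lemma exp_primitive_continuous:
  assumes "exp_primitive d f h"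
  shows "continuous_on UNIV f"
proof -
  have d: "d \<noteq> 0" and I: "\<And>x y. x \<le> y \<Longrightarrow> ((\<lambda>s. exp (s / d) * h s / d) has_integral exp (y / d) * f y - exp (x / d) * f x) {x..y}"
    using assms by (auto simp: exp_primitive_def)
  have "continuous_on {a<..<b} f" for a b :: real
  proof (cases "a \<le> b")
    case True
    let ?F = "\<lambda>x. integral {a..x} (\<lambda>s. exp (s / d) * h s / d)"
    have "continuous_on {a..b} ?F"
      using I[OF True] by (intro indefinite_integral_continuous_1) (auto simp: integrable_on_def)
    then have "continuous_on {a..b} (\<lambda>x. exp (- x / d) * (?F x + exp (a / d) * f a))"
      using d by (intro continuous_intros) auto
    moreover have "exp (- x / d) * (?F x + exp (a / d) * f a) = f x" if "x \<in> {a..b}" for x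
    proof -
      have "?F x = exp (x / d) * f x - exp (a / d) * f a" using that I[of a x] by (intro integral_unique) auto
      moreover have "exp (- x / d) * exp (x / d) = 1" by (simp add: exp_minus)
      ultimately show ?thesis by (simp flip: mult.assoc)
    qed
    ultimately have "continuous_on {a..b} f" by (blast intro: continuous_on_eq)
    then show ?thesis by (rule continuous_on_subset) auto
  qed auto
  then have "isCont f x" for x
    using continuous_on_interior[of "{x - 1<..<x + 1}" f x] by simp
  then show ?thesis by (simp add: continuous_at_imp_continuous_on)
qed

lemma exp_decay_econv:
  assumes h: "exp_decay h" and d: "d \<noteq> 0"
  shows "exp_decay (econv d h)"
proof -
  have [measurable]: "h \<in> borel_measurable borel" using h by (simp add: exp_decay_def)
  obtain B c where c: "c > 0" "\<And>x. \<bar>h x\<bar> \<le> B * exp (- c * \<bar>x\<bar>)" using h by (auto simp: exp_decay_def)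
  have B: "B \<ge> 0" using c(2)[of 0] by simp
  \<comment> \<open>Half of the decay rate of the kernel. One half is combined with the decay of
    \<open>h\<close> through the triangle inequality and yields decay in \<open>x\<close>; the other
    half keeps the integral over \<open>s\<close> finite.\<close>
  define b where "b = 1 / (2 * \<bar>d\<bar>)"
  have b: "b > 0" using d by (simp add: b_def)
  define c' where "c' = min b c"
  define I where "I = (LINT s|lborel. exp (- b * \<bar>s\<bar>))"
  have intb: "integrable lborel (\<lambda>s. exp (- b * \<bar>x - s\<bar>))" for x
    using lborel_integrable_real_affine[OF integrable_exp_abs[OF b], of "-1" x] by simp
  have "\<bar>econv d h x\<bar> \<le> (B * I / \<bar>d\<bar>) * exp (- c' * \<bar>x\<bar>)" for x
  proof -
    have "\<bar>econv d h x\<bar> = \<bar>LINT s:halfline d x|lborel. exp (- x / d) * (exp (s / d) * h s)\<bar> / \<bar>d\<bar>"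
      by (simp add: econv_def abs_mult)
    also have "\<dots> \<le> (LINT s|lborel. B * exp (- c' * \<bar>x\<bar>) * exp (- b * \<bar>x - s\<bar>)) / \<bar>d\<bar>"
    proof (intro divide_right_mono)
      have le: "\<bar>indicator (halfline d x) s *\<^sub>R (exp (- x / d) * (exp (s / d) * h s))\<bar> \<le> B * exp (- c' * \<bar>x\<bar>) * exp (- b * \<bar>x - s\<bar>)" for s
      proof (cases "s \<in> halfline d x")
        case True
        have "\<bar>exp (- x / d) * (exp (s / d) * h s)\<bar> = exp (- x / d + s / d) * \<bar>h s\<bar>"
          unfolding exp_add by (simp add: abs_mult)
        also have "\<dots> \<le> exp (- \<bar>x - s\<bar> / \<bar>d\<bar>) * (B * exp (- c * \<bar>s\<bar>))"
          by (subst halfline_exp_le[OF d True]) (intro mult_left_mono c(2), simp)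
        also have "\<dots> = B * exp (- \<bar>x - s\<bar> / \<bar>d\<bar> - c * \<bar>s\<bar>)" by (simp flip: exp_add)
        also have "- \<bar>x - s\<bar> / \<bar>d\<bar> = - b * \<bar>x - s\<bar> - b * \<bar>x - s\<bar>" by (simp add: b_def field_simps)
        also have "B * exp (- b * \<bar>x - s\<bar> - b * \<bar>x - s\<bar> - c * \<bar>s\<bar>) \<le> B * exp (- c' * \<bar>x\<bar> - b * \<bar>x - s\<bar>)"
        proof -
          have "c' * \<bar>x\<bar> \<le> c' * (\<bar>x - s\<bar> + \<bar>s\<bar>)" using b c(1) by (intro mult_left_mono) (auto simp: c'_def)
          also have "\<dots> \<le> b * \<bar>x - s\<bar> + c * \<bar>s\<bar>"
            unfolding distrib_left by (intro add_mono mult_right_mono) (auto simp: c'_def)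
          finally show ?thesis using B by (intro mult_left_mono) auto
        qed
        finally show ?thesis using True by (simp add: exp_diff exp_minus field_simps)
      qed (use B in auto)
      have "norm (LINT s|lborel. indicator (halfline d x) s *\<^sub>R (exp (- x / d) * (exp (s / d) * h s)))
          \<le> (LINT s|lborel. B * exp (- c' * \<bar>x\<bar>) * exp (- b * \<bar>x - s\<bar>))"
        using set_integrable_mult_right[OF econv_integrable[OF h d, of x], of "exp (- x / d)"] intb[of x] le
        by (intro Bochner_Integration.integral_norm_bound_integral) (auto simp: set_integrable_def)
      then show "\<bar>LINT s:halfline d x|lborel. exp (- x / d) * (exp (s / d) * h s)\<bar>
          \<le> (LINT s|lborel. B * exp (- c' * \<bar>x\<bar>) * exp (- b * \<bar>x - s\<bar>))"
        by (simp only: set_lebesgue_integral_def real_norm_def)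
    qed simp
    also have "(LINT s|lborel. B * exp (- c' * \<bar>x\<bar>) * exp (- b * \<bar>x - s\<bar>)) = B * exp (- c' * \<bar>x\<bar>) * I"
      using lborel_integral_real_affine[of "-1" "\<lambda>s. exp (- b * \<bar>s\<bar>)" x] by (simp add: I_def)
    finally show ?thesis by (simp add: ac_simps)
  qed
  moreover have "c' > 0" using b c by (simp add: c'_def)
  moreover have "econv d h \<in> borel_measurable borel"
    using exp_primitive_continuous[OF econv_exp_primitive[OF h d]] by (rule borel_measurable_continuous_onI)
  ultimately show ?thesis unfolding exp_decay_def by blast
qed

section \<open>Fourier transforms of the kernels and uniqueness\<close>

lemma ekern_minus: "ekern d (- x) = ekern (- d) x"
  by (simp add: ekern_def)

lemma cis_measurable [measurable (raw)]:
  "f \<in> borel_measurable M \<Longrightarrow> (\<lambda>x. cis (f x)) \<in> borel_measurable M"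
  by (erule measurable_compose) (intro borel_measurable_continuous_onI continuous_intros)

lemma ekern_measurable [measurable]: "ekern d \<in> borel_measurable borel"
  unfolding ekern_def by measurable

lemma exp_decay_ekern: assumes "d \<noteq> 0" shows "exp_decay (ekern d)"
proof -
  have "\<bar>ekern d x\<bar> \<le> 1 / \<bar>d\<bar> * exp (- (1 / \<bar>d\<bar>) * \<bar>x\<bar>)" for x
  proof (cases "x * d > 0")
    case True
    then have "x / d = \<bar>x\<bar> / \<bar>d\<bar>" by (auto simp: zero_less_mult_iff)
    then show ?thesis using True by (simp add: ekern_def)
  qed (simp add: ekern_def)
  then show ?thesis unfolding exp_decay_def using assms by (intro conjI ekern_measurable exI[of _ "1 / \<bar>d\<bar>"]) auto
qed

lemma fourier_integrable:
  assumes "integrable lborel f"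
  shows "integrable lborel (\<lambda>x. complex_of_real (f x) * cis (- 2 * pi * x * \<xi>))"
proof -
  have [measurable]: "f \<in> borel_measurable borel" using assms by auto
  show ?thesis by (rule Bochner_Integration.integrable_bound[OF assms]) (auto simp: norm_mult)
qed

lemma fourier_ekern_pos:
  assumes d: "d > 0"
  shows "fourier (ekern d) \<xi> = inverse (1 + 2 * pi * \<i> * complex_of_real (d * \<xi>))"
proof -
  define w where "w = complex_of_real (1 / d) + 2 * pi * \<i> * complex_of_real \<xi>"
  have w0: "w \<noteq> 0" "Re w = 1 / d" using d by (auto simp: w_def complex_eq_iff)
  have dw: "d * w = 1 + 2 * pi * \<i> * complex_of_real (d * \<xi>)" using d by (simp add: w_def algebra_simps)
  let ?f = "\<lambda>x. exp (- w * complex_of_real x) / d"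
  let ?F = "\<lambda>x. - (exp (- w * complex_of_real x) / (d * w))"
  have f_eq: "complex_of_real (ekern d x) * cis (- 2 * pi * x * \<xi>) = indicator {0<..} x *\<^sub>R ?f x" for x
  proof (cases "x > 0")
    case True
    have "exp (- w * complex_of_real x) = complex_of_real (exp (- x / d)) * cis (- 2 * pi * x * \<xi>)"
      unfolding cis_conv_exp exp_of_real[symmetric] exp_add[symmetric]
      by (rule arg_cong[where f = exp]) (use d in \<open>simp add: w_def algebra_simps\<close>)
    then show ?thesis using True d by (simp add: ekern_def)
  next
    case False
    then show ?thesis using d by (simp add: ekern_def zero_less_mult_iff)
  qed
  have int: "integrable lborel (\<lambda>x. complex_of_real (ekern d x) * cis (- 2 * pi * x * \<xi>))"
    by (rule fourier_integrable[OF exp_decay_integrable[OF exp_decay_ekern]]) (use d in simp)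
  have "fourier (ekern d) \<xi> = (LBINT x=0..\<infinity>. ?f x)"
    unfolding fourier_def f_eq interval_lebesgue_integral_def set_lebesgue_integral_def
    by (simp add: einterval_def zero_ereal_def greaterThan_def)
  also have "\<dots> = 0 - (- (1 / (d * w)))"
  proof (rule interval_integral_FTC_integrable)
    show "(?F has_vector_derivative ?f x) (at x)" for x
    proof -
      have "((\<lambda>z. - (exp (- w * z) / (d * w))) has_field_derivative ?f x) (at (complex_of_real x))"
        using w0 d by (auto intro!: derivative_eq_intros simp: field_simps)
      from has_vector_derivative_real_field[OF this] show ?thesis by (simp add: o_def)
    qed
    show "set_integrable lborel (einterval 0 \<infinity>) ?f"
      using int unfolding set_integrable_def f_eq by (simp add: einterval_def zero_ereal_def greaterThan_def)
    have "((\<lambda>x. ?F x) \<longlongrightarrow> - (1 / (d * w))) (at_right 0)"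
      using w0 d by (auto intro!: tendsto_eq_intros)
    then show "((?F \<circ> real_of_ereal) \<longlongrightarrow> - (1 / (d * w))) (at_right 0)"
      unfolding zero_ereal_def ereal_tendsto_simps .
    have "((\<lambda>x. ?F x) \<longlongrightarrow> 0) at_top"
    proof (rule tendsto_norm_zero_cancel)
      have "((\<lambda>x. exp (- x / d) / (d * norm w)) \<longlongrightarrow> 0) at_top" using d w0 by real_asymp
      moreover have "norm (?F x) = exp (- x / d) / (d * norm w)" for x
        using d w0 by (simp add: norm_divide norm_mult)
      ultimately show "((\<lambda>x. norm (?F x)) \<longlongrightarrow> 0) at_top" by simp
    qed
    then show "((?F \<circ> real_of_ereal) \<longlongrightarrow> 0) (at_left \<infinity>)"
      unfolding ereal_tendsto_simps .
    show "isCont ?f x" for x using d by (intro continuous_intros) auto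
  qed simp
  finally show ?thesis by (simp add: dw inverse_eq_divide)
qed

lemma fourier_ekern:
  assumes d: "d \<noteq> 0"
  shows "fourier (ekern d) \<xi> = inverse (1 + 2 * pi * \<i> * complex_of_real (d * \<xi>))"
proof (cases "d > 0")
  case False
  have "fourier (ekern d) \<xi> = (LINT x|lborel. complex_of_real (ekern d (0 + (-1) * x)) * cis (- 2 * pi * (0 + (-1) * x) * \<xi>))"
    unfolding fourier_def
    using lborel_integral_real_affine[of "-1" "\<lambda>x. complex_of_real (ekern d x) * cis (- 2 * pi * x * \<xi>)" 0]
    by simp
  also have "\<dots> = fourier (ekern (- d)) (- \<xi>)"
    unfolding fourier_def by (simp add: ekern_minus)
  also have "\<dots> = inverse (1 + 2 * pi * \<i> * complex_of_real (d * \<xi>))"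
    using fourier_ekern_pos[of "- d" "- \<xi>"] False d by simp
  finally show ?thesis .
qed (rule fourier_ekern_pos)

text \<open>The defining form of \<open>econv\<close> suits the differential equation, this one
  suits Fubini. The integrands may differ at \<open>s = x\<close> only, where the closed half-line
  contains the point and \<open>ekern\<close> is 0.\<close>

lemma econv_eq_convolution:
  assumes h[measurable]: "h \<in> borel_measurable borel"  and d: "d \<noteq> 0"
  shows "econv d h x = (LINT s|lborel. ekern d (x - s) * h s)"
proof -
  have "econv d h x = (LINT s|lborel. exp (- x / d) / \<bar>d\<bar> * (indicator (halfline d x) s * (exp (s / d) * h s)))"
    by (simp add: econv_def set_lebesgue_integral_def)
  also have "\<dots> = (LINT s|lborel. ekern d (x - s) * h s)"
  proof (rule integral_cong_AE)
    show "AE s in lborel. exp (- x / d) / \<bar>d\<bar> * (indicator (halfline d x) s * (exp (s / d) * h s)) = ekern d (x - s) * h s"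
      using AE_lborel_singleton[of x]
    proof eventually_elim
      case (elim s)
      have "exp (- (x - s) / d) = exp (- x / d) * exp (s / d)"
        by (simp add: diff_divide_distrib flip: exp_add)
      then show ?case using elim d
        by (auto simp: ekern_def halfline_def indicator_def zero_less_mult_iff mult_less_0_iff)
    qed
    show "(\<lambda>s. exp (- x / d) / \<bar>d\<bar> * (indicator (halfline d x) s * (exp (s / d) * h s))) \<in> borel_measurable lborel" by measurable
    show "(\<lambda>s. ekern d (x - s) * h s) \<in> borel_measurable lborel" by measurable
  qed
  finally show ?thesis .
qed

lemma fourier_econv:
  assumes h: "exp_decay h" and d: "d \<noteq> 0"
  shows "fourier (econv d h) \<xi> = inverse (1 + 2 * pi * \<i> * complex_of_real (d * \<xi>)) * fourier h \<xi>"
proof -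
  have [measurable]: "h \<in> borel_measurable borel" using h by (simp add: exp_decay_def)
  have habs: "exp_decay (\<lambda>x. \<bar>h x\<bar>)" using h by (auto simp: exp_decay_def)
  let ?c = "\<lambda>x. cis (- 2 * pi * x * \<xi>)"
  let ?F = "\<lambda>x s. complex_of_real (ekern d (x - s) * h s) * ?c x"
  have bnd: "integrable lborel (\<lambda>s. ekern d (x - s) * h s)" for x
  proof -
    obtain B where B: "\<And>x. \<bar>ekern d x\<bar> \<le> B" using exp_decay_bounded[OF exp_decay_ekern[OF d]] by auto
    show ?thesis
      by (rule Bochner_Integration.integrable_bound[OF Bochner_Integration.integrable_mult_right[OF exp_decay_integrable[OF habs], of B]])
        (auto simp: abs_mult intro!: AE_I2 mult_right_mono order_trans[OF B])
  qed
  have "integrable (lborel \<Otimes>\<^sub>M lborel) (case_prod ?F)"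
  proof (rule lborel_pair.Fubini_integrable)
    have "(LINT s|lborel. norm (case (x, s) of (x, s) \<Rightarrow> ?F x s)) = econv d (\<lambda>x. \<bar>h x\<bar>) x" for x
      by (subst econv_eq_convolution) (auto simp: d norm_mult abs_mult ekern_def intro!: Bochner_Integration.integral_cong)
    then show "integrable lborel (\<lambda>x. LINT s|lborel. norm (case (x, s) of (x, s) \<Rightarrow> ?F x s))"
      using exp_decay_integrable[OF exp_decay_econv[OF habs d]] by simp
    show "AE x in lborel. integrable lborel (\<lambda>s. case (x, s) of (x, s) \<Rightarrow> ?F x s)"
      using bnd by (intro AE_I2) (simp del: of_real_mult)
    show "case_prod ?F \<in> borel_measurable (lborel \<Otimes>\<^sub>M lborel)" by measurable
  qed
  from lborel_pair.Fubini_integral[OF this]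
  have "(LINT x|lborel. (LINT s|lborel. ?F x s)) = (LINT s|lborel. (LINT x|lborel. ?F x s))" by simp
  moreover have "(LINT s|lborel. ?F x s) = complex_of_real (econv d h x) * ?c x" for x
    by (simp add: econv_eq_convolution d del: of_real_mult)
  moreover have "(LINT x|lborel. ?F x s) = fourier (ekern d) \<xi> * (complex_of_real (h s) * ?c s)" for s
  proof -
    have "(LINT x|lborel. ?F x s) = (LINT x|lborel. ?F (s + 1 * x) s)"
      using lborel_integral_real_affine[of 1 "\<lambda>x. ?F x s" s] by simp
    also have "\<dots> = (LINT x|lborel. (complex_of_real (ekern d x) * ?c x) * (complex_of_real (h s) * ?c s))"
      by (intro Bochner_Integration.integral_cong) (auto simp: algebra_simps cis_mult)
    finally show ?thesis by (simp add: fourier_def)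
  qed
  ultimately show ?thesis by (simp add: fourier_def[of "econv d h"] fourier_def[of h] fourier_ekern[OF d])
qed

lemma fourier_diff:
  assumes "integrable lborel f" "integrable lborel h"
  shows "fourier (\<lambda>x. f x - h x) \<xi> = fourier f \<xi> - fourier h \<xi>"
  using Bochner_Integration.integral_diff[OF assms[THEN fourier_integrable]]
  by (simp add: fourier_def left_diff_distrib)

text \<open>Levy uniqueness concerns probability measures. The positive and negative parts of
  \<open>u - v\<close> have equal Fourier transforms, in particular equal mass (the value at 0);
  divided by this mass they become densities with the same characteristic function. If the mass is
  0, both parts vanish almost everywhere.\<close>

lemma fourier_injective:
  assumes u: "integrable lborel u" and v: "integrable lborel v" and eq: "\<And>\<xi>. fourier u \<xi> = fourier v \<xi>"
  shows "AE x in lborel. u x = v x"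
proof -
  define w where "w x = u x - v x" for x
  have w: "integrable lborel w" using u v by (simp add: w_def[abs_def])
  then have [measurable]: "w \<in> borel_measurable borel" by auto
  let ?p = "\<lambda>x. max 0 (w x)" and ?n = "\<lambda>x. max 0 (- w x)"
  have p: "integrable lborel ?p" and n: "integrable lborel ?n" using w by auto
  have feq: "fourier ?p \<xi> = fourier ?n \<xi>" for \<xi>
  proof -
    have "fourier ?p \<xi> - fourier ?n \<xi> = fourier (\<lambda>x. ?p x - ?n x) \<xi>" by (rule fourier_diff[OF p n, symmetric])
    also have "(\<lambda>x. ?p x - ?n x) = (\<lambda>x. u x - v x)" by (auto simp: w_def max_def)
    finally have "fourier ?p \<xi> - fourier ?n \<xi> = fourier u \<xi> - fourier v \<xi>" by (simp add: fourier_diff[OF u v])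
    then show ?thesis using eq by simp
  qed
  define I where "I = (LINT x|lborel. ?p x)"
  have In: "(LINT x|lborel. ?n x) = I" using feq[of 0] by (simp add: fourier_def I_def)
  have "AE x in lborel. ?p x = ?n x"
  proof (cases "I = 0")
    case True
    have zero: "AE x in lborel. f x = 0" if "integrable lborel f" "(LINT x|lborel. f x) = 0" "\<And>x. f x \<ge> 0"
      for f :: "real \<Rightarrow> real"
      using integral_nonneg_eq_0_iff_AE[of lborel f] that by simp
    have "AE x in lborel. ?p x = 0" "AE x in lborel. ?n x = 0"
      using True In by (intro zero p n; simp add: I_def)+
    then show ?thesis by eventually_elim simp
  next
    case False
    moreover have "I \<ge> 0" unfolding I_def by (rule Bochner_Integration.integral_nonneg) auto
    ultimately have I: "I > 0" by simp
    define D where "D f = density lborel (\<lambda>x. ennreal (f x / I))" for f :: "real \<Rightarrow> real"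
    have dist: "real_distribution (D f)" and chD: "char (D f) t = fourier f (- t / (2 * pi)) / I"
      if f: "integrable lborel f" "(LINT x|lborel. f x) = I" "\<And>x. f x \<ge> 0" for f t
    proof -
      have [measurable]: "f \<in> borel_measurable borel" using f(1) by auto
      have "emeasure (D f) (space (D f)) = (\<integral>\<^sup>+x. ennreal (f x / I) \<partial>lborel)"
        by (simp add: D_def emeasure_density)
      also have "\<dots> = ennreal (LINT x|lborel. f x / I)"
        using f I by (intro nn_integral_eq_integral) auto
      finally have "emeasure (D f) (space (D f)) = 1" using f(2) I by simp
      then interpret prob_space "D f" by (rule prob_spaceI)
      show "real_distribution (D f)" by unfold_locales (auto simp: D_def)
      have "char (D f) t = (CLINT x|lborel. (f x / I) *\<^sub>R iexp (t * x))"
        unfolding char_def D_def using f(3) I by (subst integral_density) auto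
      also have "\<dots> = (CLINT x|lborel. complex_of_real (f x) * cis (- 2 * pi * x * (- t / (2 * pi))) / I)"
        by (intro Bochner_Integration.integral_cong) (auto simp: cis_conv_exp scaleR_conv_of_real ac_simps)
      finally show "char (D f) t = fourier f (- t / (2 * pi)) / I" by (simp add: fourier_def)
    qed
    have "D ?p = D ?n"
    proof (rule Levy_uniqueness)
      show "real_distribution (D ?p)" by (rule dist[OF p]) (auto simp: I_def)
      show "real_distribution (D ?n)" by (rule dist[OF n In]) auto
      have "char (D ?p) t = char (D ?n) t" for t
        using chD[OF p, of t] chD[OF n In, of t] feq by (simp add: I_def)
      then show "char (D ?p) = char (D ?n)" by blast
    qed
    then have "AE x in lborel. ennreal (?p x / I) = ennreal (?n x / I)"
      unfolding D_def by (subst (asm) sigma_finite_measure.density_unique_iff[OF sigma_finite_lborel]) auto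
    then show ?thesis
    proof eventually_elim
      case (elim x)
      have "?p x / I = ?n x / I" by (rule ennreal_inj[THEN iffD1, OF _ _ elim]) (use I in simp_all)
      then show ?case using I by simp
    qed
  qed
  then show ?thesis
  proof eventually_elim
    case (elim x)
    then show ?case by (cases "w x \<ge> 0") (simp_all add: w_def)
  qed
qed

section \<open>Totally positive functions of finite type as iterated convolutions\<close>

primrec gk :: "(nat \<Rightarrow> real) \<Rightarrow> nat \<Rightarrow> real \<Rightarrow> real" where
  "gk d 0 = ekern (d 0)"
| "gk d (Suc j) = econv (d (Suc j)) (gk d j)"

lemma gk_decay: "(\<And>k. k \<le> j \<Longrightarrow> d k \<noteq> 0) \<Longrightarrow> exp_decay (gk d j)"
  by (induction j) (auto intro: exp_decay_ekern exp_decay_econv)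

lemma gk_exp_primitive:
  "(\<And>k. k \<le> Suc j \<Longrightarrow> d k \<noteq> 0) \<Longrightarrow> exp_primitive (d (Suc j)) (gk d (Suc j)) (gk d j)"
  by (simp add: econv_exp_primitive gk_decay)

lemma fourier_gk:
  "(\<And>k. k \<le> j \<Longrightarrow> d k \<noteq> 0) \<Longrightarrow>
    fourier (gk d j) \<xi> = (\<Prod>k\<le>j. inverse (1 + 2 * pi * \<i> * complex_of_real (d k * \<xi>)))"
proof (induction j)
  case 0
  then show ?case by (simp add: fourier_ekern)
next
  case (Suc j)
  have "fourier (gk d (Suc j)) \<xi> = inverse (1 + 2 * pi * \<i> * complex_of_real (d (Suc j) * \<xi>)) * fourier (gk d j) \<xi>"
    using Suc.prems by (simp add: fourier_econv gk_decay)
  also have "fourier (gk d j) \<xi> = (\<Prod>k\<le>j. inverse (1 + 2 * pi * \<i> * complex_of_real (d k * \<xi>)))"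
    using Suc by simp
  finally show ?case by (simp add: mult.commute)
qed

lemma continuous_AE_eq:
  fixes f h :: "real \<Rightarrow> real"
  assumes "continuous_on UNIV f" "continuous_on UNIV h" "AE x in lborel. f x = h x"
  shows "f x = h x"
proof (rule ccontr)
  assume x: "f x \<noteq> h x"
  let ?S = "{x. f x \<noteq> h x}"
  have "open ?S" using assms by (intro open_Collect_neq)
  moreover from this have "?S \<in> null_sets lborel"
    using assms(3) by (subst (asm) AE_iff_null) auto
  then have "negligible ?S" by (auto simp: negligible_iff_null_sets intro: null_sets_completionI)
  ultimately show False using x open_not_negligible by blast
qed

text \<open>Equality of Fourier transforms gives equality almost everywhere, and continuity of both
  sides upgrades it to every point. The right-hand side is continuous because
  \<open>m \<ge> 2\<close> provides at least one convolution; a single \<open>ekern\<close> has a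
  jump.\<close>

theorem tp_finite_type_eq_gk:
  assumes tp: "tp_finite_type g m C \<delta>" and cont: "continuous_on UNIV g" and m: "m \<ge> 2"
  shows "g x = C * gk \<delta> (m - 1) x"
proof (rule continuous_AE_eq[OF cont])
  obtain j where j: "m = Suc (Suc j)" using le_Suc_ex[OF m] by auto
  have d: "\<delta> k \<noteq> 0" if "k \<le> m - 1" for k using tp that m by (auto simp: tp_finite_type_def)
  show "continuous_on UNIV (\<lambda>x. C * gk \<delta> (m - 1) x)"
    using exp_primitive_continuous[OF gk_exp_primitive[of j \<delta>]] d j by (auto intro!: continuous_intros)
  have int: "integrable lborel (\<lambda>x. C * gk \<delta> (m - 1) x)"
    using exp_decay_integrable[OF gk_decay[of "m - 1" \<delta>]] d by auto
  have "fourier (\<lambda>x. C * gk \<delta> (m - 1) x) \<xi> = C * fourier (gk \<delta> (m - 1)) \<xi>" for \<xi>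
    by (simp add: fourier_def mult.assoc)
  moreover have "{..m - 1} = {..<m}" using m by auto
  ultimately have "fourier g \<xi> = fourier (\<lambda>x. C * gk \<delta> (m - 1) x) \<xi>" for \<xi>
    using tp d by (simp add: fourier_gk tp_finite_type_def)
  then show "AE x in lborel. g x = C * gk \<delta> (m - 1) x"
    using tp int by (intro fourier_injective) (auto simp: tp_finite_type_def)
qed

section \<open>Difference equations away from the origin\<close>

lemma exp_primitive_sum:
  assumes fh: "exp_primitive d f h" and "finite A"
  shows "exp_primitive d (\<lambda>x. \<Sum>k\<in>A. c k * f (x - t k)) (\<lambda>x. \<Sum>k\<in>A. c k * h (x - t k))"
  unfolding exp_primitive_def
proof (intro conjI allI impI)
  show d: "d \<noteq> 0" using fh by (simp add: exp_primitive_def)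
  fix x y :: real assume xy: "x \<le> y"
  have "((\<lambda>s. c k * (exp (s / d) * h (s - t k) / d)) has_integral
      c k * (exp (y / d) * f (y - t k) - exp (x / d) * f (x - t k))) {x..y}" for k
  proof (rule has_integral_mult_right)
    have "((\<lambda>s. exp (s / d) * h s / d) has_integral exp ((y - t k) / d) * f (y - t k) - exp ((x - t k) / d) * f (x - t k)) (cbox (x - t k) (y - t k))"
      using fh xy by (auto simp: exp_primitive_def)
    from has_integral_affinity'[OF this, of 1 "- t k"]
    have "((\<lambda>s. exp ((s - t k) / d) * h (s - t k) / d) has_integral exp ((y - t k) / d) * f (y - t k) - exp ((x - t k) / d) * f (x - t k)) {x..y}"
      by simp
    from has_integral_mult_right[OF this, of "exp (t k / d)"]
    show "((\<lambda>s. exp (s / d) * h (s - t k) / d) has_integral exp (y / d) * f (y - t k) - exp (x / d) * f (x - t k)) {x..y}"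
      by (simp add: diff_divide_distrib exp_diff right_diff_distrib)
  qed
  from has_integral_sum[OF \<open>finite A\<close> this]
  show "((\<lambda>s. exp (s / d) * (\<Sum>k\<in>A. c k * h (s - t k)) / d) has_integral
      exp (y / d) * (\<Sum>k\<in>A. c k * f (y - t k)) - exp (x / d) * (\<Sum>k\<in>A. c k * f (x - t k))) {x..y}"
    by (simp add: sum_distrib_left sum_divide_distrib sum_subtractf right_diff_distrib mult.left_commute)
qed

lemma exp_primitive_const:
  assumes fh: "exp_primitive d f h" and I: "is_interval I" "x \<in> I" "y \<in> I" and h: "\<And>s. s \<in> I \<Longrightarrow> h s = 0"
  shows "exp (y / d) * f y = exp (x / d) * f x"
proof -
  have *: "exp (y / d) * f y = exp (x / d) * f x" if "x \<le> y" "x \<in> I" "y \<in> I" for x y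
  proof -
    have "h s = 0" if "s \<in> {x..y}" for s
      using that h I(1) \<open>x \<in> I\<close> \<open>y \<in> I\<close> unfolding is_interval_1 by (meson atLeastAtMost_iff)
    then have "((\<lambda>s. exp (s / d) * h s / d) has_integral 0) {x..y}"
      by (intro has_integral_is_0) auto
    moreover have "((\<lambda>s. exp (s / d) * h s / d) has_integral exp (y / d) * f y - exp (x / d) * f x) {x..y}"
      using fh that by (auto simp: exp_primitive_def)
    ultimately have "0 = exp (y / d) * f y - exp (x / d) * f x" by (rule has_integral_unique)
    then show ?thesis by simp
  qed
  show ?thesis using *[of x y] *[of y x] I by (cases "x \<le> y") auto
qed

text \<open>Left of the origin (\<open>\<sigma> = 1\<close>) only the factors with negative \<open>d k\<close> matter, and \<open>gk d j\<close> satisfies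
  there the difference equation of the corresponding exponentials; symmetrically for \<open>\<sigma> = -1\<close>.\<close>
lemma gk_recurrence:
  assumes d: "\<And>k. k \<le> j \<Longrightarrow> d k \<noteq> 0" and \<sigma>: "\<sigma> = 1 \<or> \<sigma> = -1" and \<kappa>: "\<kappa> > 0"
  shows "\<exists>c. c (card {k. k \<le> j \<and> \<sigma> * d k < 0}) \<noteq> 0 \<and>
    (\<forall>x. \<sigma> * x < 0 \<longrightarrow> (\<Sum>l\<le>card {k. k \<le> j \<and> \<sigma> * d k < 0}. c l * gk d j (x - \<sigma> * real l * \<kappa>)) = (0::real))"
  using d
proof (induction j)
  case 0
  show ?case
  proof (cases "\<sigma> * d 0 < 0")
    case True
    then have c: "card {k. k \<le> 0 \<and> \<sigma> * d k < 0} = Suc 0" by (simp cong: conj_cong add: Collect_conv_if)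
    have "ekern (d 0) (x - \<sigma> * \<kappa>) = exp (\<sigma> * \<kappa> / d 0) * ekern (d 0) x" if "\<sigma> * x < 0" for x
    proof -
      have "x * d 0 > 0" "(x - \<sigma> * \<kappa>) * d 0 > 0"
        using that True \<sigma> \<kappa> by (auto simp: zero_less_mult_iff mult_less_0_iff)
      then show ?thesis by (simp add: ekern_def diff_divide_distrib flip: exp_add)
    qed
    then show ?thesis unfolding c
      by (intro exI[of _ "\<lambda>l. if l = 0 then - exp (\<sigma> * \<kappa> / d 0) else 1"]) simp
  next
    case False
    then have c: "card {k. k \<le> 0 \<and> \<sigma> * d k < 0} = 0" by auto
    have "ekern (d 0) x = 0" if "\<sigma> * x < 0" for x
      using that False \<sigma> by (auto simp: ekern_def zero_less_mult_iff mult_less_0_iff)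
    then show ?thesis unfolding c by (intro exI[of _ "\<lambda>l. 1"]) simp
  qed
next
  case (Suc j)
  let ?n = "card {k. k \<le> j \<and> \<sigma> * d k < 0}"
  let ?d = "d (Suc j)"
  have "\<And>k. k \<le> j \<Longrightarrow> d k \<noteq> 0" using Suc.prems by simp
  from Suc.IH[OF this] obtain c where c: "c ?n \<noteq> 0"
    and rec: "\<And>x. \<sigma> * x < 0 \<Longrightarrow> (\<Sum>l\<le>?n. c l * gk d j (x - \<sigma> * real l * \<kappa>)) = 0"
    by blast
  \<comment> \<open>\<open>R\<close> applies the difference operator of the earlier factors to the
    new level. By the induction hypothesis it solves the homogeneous equation on the half-line, so
    there it is a multiple of \<open>exp (- x / ?d)\<close>.\<close>
  define R where "R x = (\<Sum>l\<le>?n. c l * gk d (Suc j) (x - \<sigma> * real l * \<kappa>))" for x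
  have prim: "exp_primitive ?d R (\<lambda>x. \<Sum>l\<le>?n. c l * gk d j (x - \<sigma> * real l * \<kappa>))"
    unfolding R_def[abs_def] by (rule exp_primitive_sum[OF gk_exp_primitive]) (use Suc.prems in auto)
  have I: "is_interval {x. \<sigma> * x < 0}"
    using \<sigma> by (auto simp: is_interval_1)
  have const: "exp (y / ?d) * R y = exp (x / ?d) * R x" if "\<sigma> * x < 0" "\<sigma> * y < 0" for x y
    by (rule exp_primitive_const[OF prim I]) (use that rec in auto)
  have shift: "R (x - \<sigma> * s) = exp (\<sigma> * s / ?d) * R x" if "\<sigma> * x < 0" "s \<ge> 0" for x s
  proof -
    have "\<sigma> * (x - \<sigma> * s) < 0" using that \<sigma> by auto
    from const[OF this that(1)] have "exp (x / ?d) * R x = exp (x / ?d) * (exp (- \<sigma> * s / ?d) * R (x - \<sigma> * s))"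
      by (simp add: diff_divide_distrib exp_diff exp_minus field_simps)
    then have "R x = exp (- \<sigma> * s / ?d) * R (x - \<sigma> * s)" by simp
    then show ?thesis by (simp add: exp_minus)
  qed
  have set: "{k. k \<le> Suc j \<and> \<sigma> * d k < 0} = (if \<sigma> * ?d < 0 then insert (Suc j) else id) {k. k \<le> j \<and> \<sigma> * d k < 0}"
    by (auto simp: le_Suc_eq)
  show ?case
  proof (cases "\<sigma> * ?d < 0")
    case True
    have cd: "card {k. k \<le> Suc j \<and> \<sigma> * d k < 0} = Suc ?n" using True set by simp
    \<comment> \<open>\<open>E\<close> is the factor by which the shift multiplies this exponential,
      so the operator shift minus \<open>E\<close> annihilates \<open>R\<close>. The coefficients
      \<open>c'\<close> belong to the product of the two difference operators.\<close>
    define E where "E = exp (\<sigma> * \<kappa> / ?d)"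
    define c' where "c' l = (if l = 0 then 0 else c (l - 1)) - (if l \<le> ?n then E * c l else 0)" for l
    have "(\<Sum>l\<le>Suc ?n. c' l * gk d (Suc j) (x - \<sigma> * real l * \<kappa>)) = R (x - \<sigma> * \<kappa>) - E * R x" for x
    proof -
      have "(\<Sum>l\<le>Suc ?n. (if l = 0 then 0 else c (l - 1)) * gk d (Suc j) (x - \<sigma> * real l * \<kappa>)) = R (x - \<sigma> * \<kappa>)"
        by (subst sum.atMost_Suc_shift) (simp add: R_def algebra_simps del: gk.simps)
      moreover have "(\<Sum>l\<le>Suc ?n. (if l \<le> ?n then E * c l else 0) * gk d (Suc j) (x - \<sigma> * real l * \<kappa>)) = E * R x"
        by (simp add: R_def sum_distrib_left mult.assoc del: gk.simps)
      ultimately show ?thesis by (simp only: c'_def left_diff_distrib sum_subtractf)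
    qed
    then have "(\<Sum>l\<le>Suc ?n. c' l * gk d (Suc j) (x - \<sigma> * real l * \<kappa>)) = 0" if "\<sigma> * x < 0" for x
      using shift[OF that, of \<kappa>] \<kappa> by (simp add: E_def)
    moreover have "c' (Suc ?n) \<noteq> 0" using c by (simp add: c'_def)
    ultimately show ?thesis unfolding cd by blast
  next
    case False
    have cd: "card {k. k \<le> Suc j \<and> \<sigma> * d k < 0} = ?n" using False set by simp
    \<comment> \<open>Here the exponential grows away from the origin while \<open>R\<close> is
      bounded, so the multiple is zero and no new shift is required.\<close>
    have "R x = 0" if x: "\<sigma> * x < 0" for x
    proof -
      have dpos: "\<sigma> / ?d > 0" using False \<sigma> Suc.prems[of "Suc j"] by (auto simp: mult_less_0_iff zero_less_divide_iff)
      obtain B where B: "\<And>x. \<bar>gk d (Suc j) x\<bar> \<le> B"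
        using exp_decay_bounded[OF gk_decay[of "Suc j" d]] Suc.prems by blast
      have Rb: "\<bar>R x\<bar> \<le> (\<Sum>l\<le>?n. \<bar>c l\<bar> * B)" for x
        unfolding R_def by (rule order_trans[OF sum_abs sum_mono], subst abs_mult, rule mult_left_mono[OF B abs_ge_zero])
      have "\<bar>R x\<bar> \<le> exp (- (s * (\<sigma> / ?d))) * (\<Sum>l\<le>?n. \<bar>c l\<bar> * B)" if "s \<ge> 0" for s
      proof -
        have "exp (- (s * (\<sigma> / ?d))) * exp (\<sigma> * s / ?d) = 1" by (simp add: mult.commute flip: exp_add)
        then have "R x = exp (- (s * (\<sigma> / ?d))) * R (x - \<sigma> * s)"
          unfolding shift[OF x that] mult.assoc[symmetric] by simp
        then show ?thesis using Rb[of "x - \<sigma> * s"] by (simp add: abs_mult)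
      qed
      then have "eventually (\<lambda>s. \<bar>R x\<bar> \<le> exp (- (s * (\<sigma> / ?d))) * (\<Sum>l\<le>?n. \<bar>c l\<bar> * B)) at_top"
        by (intro eventually_mono[OF eventually_ge_at_top[of 0]]) auto
      moreover have "((\<lambda>s. exp (- (s * (\<sigma> / ?d))) * (\<Sum>l\<le>?n. \<bar>c l\<bar> * B)) \<longlongrightarrow> 0) at_top"
      proof -
        have "((\<lambda>s. exp (- (s * e)) * K) \<longlongrightarrow> 0) at_top" if "e > 0" for e K :: real
          using that by real_asymp
        from this[OF dpos] show ?thesis .
      qed
      ultimately have "\<bar>R x\<bar> \<le> 0" by (intro tendsto_lowerbound[where F = at_top and f = "\<lambda>s. exp (- (s * (\<sigma> / ?d))) * (\<Sum>l\<le>?n. \<bar>c l\<bar> * B)"]) auto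
      then show ?thesis by simp
    qed
    then show ?thesis using c unfolding cd R_def by blast
  qed
qed

section \<open>Injectivity of sampling for exponential splines\<close>

lemma card_less_Suc_filter_shift: "card {i. i < Suc j \<and> P i} = of_bool (P 0) + card {i. i < j \<and> P (Suc i)}"
  by (induction j) (simp_all only: card_less_Suc_filter, simp_all)

lemma lattice_count:
  fixes x \<alpha> A B :: real
  assumes \<alpha>: "\<alpha> > 0"
  shows "{i::int. A < x + \<alpha> * i \<and> x + \<alpha> * i < B} = {\<lfloor>(A - x) / \<alpha>\<rfloor> + 1..\<lceil>(B - x) / \<alpha>\<rceil> - 1}"
    and "real (card {i::int. A < x + \<alpha> * i \<and> x + \<alpha> * i < B}) \<ge> (B - A) / \<alpha> - 1"
proof -
  have "A < x + \<alpha> * i \<longleftrightarrow> (A - x) / \<alpha> < i" "x + \<alpha> * i < B \<longleftrightarrow> i < (B - x) / \<alpha>" for i :: int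
    using \<alpha> by (auto simp: field_simps)
  then show eq: "{i::int. A < x + \<alpha> * i \<and> x + \<alpha> * i < B} = {\<lfloor>(A - x) / \<alpha>\<rfloor> + 1..\<lceil>(B - x) / \<alpha>\<rceil> - 1}"
    by (simp add: set_eq_iff add1_zle_eq floor_less_iff less_ceiling_iff)
  have "(B - A) / \<alpha> = (B - x) / \<alpha> - (A - x) / \<alpha>" by (simp add: diff_divide_distrib)
  moreover have "(A - x) / \<alpha> \<ge> of_int \<lfloor>(A - x) / \<alpha>\<rfloor>" "(B - x) / \<alpha> \<le> of_int \<lceil>(B - x) / \<alpha>\<rceil>" by auto
  ultimately have "(B - A) / \<alpha> - 1 \<le> of_int (\<lceil>(B - x) / \<alpha>\<rceil> - \<lfloor>(A - x) / \<alpha>\<rfloor> - 1)"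
    unfolding of_int_diff by linarith
  also have "\<dots> \<le> real (nat (\<lceil>(B - x) / \<alpha>\<rceil> - \<lfloor>(A - x) / \<alpha>\<rfloor> - 1))" by linarith
  finally show "real (card {i::int. A < x + \<alpha> * i \<and> x + \<alpha> * i < B}) \<ge> (B - A) / \<alpha> - 1"
    unfolding eq by simp
qed

text \<open>All integrals of the weighted \<open>h\<close> over subintervals vanish. Continuity of
  \<open>h\<close> allows differentiating them, which gives zero at every point and not only almost
  everywhere.\<close>

lemma exp_primitive_zero:
  assumes fh: "exp_primitive d f h" and f: "\<And>x. u < x \<Longrightarrow> x < v \<Longrightarrow> f x = 0"
    and h: "continuous_on {u<..<v} h" and z: "u < z" "z < v"
  shows "h z = 0"
proof -
  obtain a b where ab: "u < a" "a < z" "z < b" "b < v" using dense[OF z(1)] dense[OF z(2)] by blast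
  let ?g = "\<lambda>s. exp (s / d) * h s / d"
  have d: "d \<noteq> 0" using fh by (simp add: exp_primitive_def)
  have "continuous_on {a..b} h" by (rule continuous_on_subset[OF h]) (use ab in auto)
  then have cont: "continuous_on {a..b} ?g" using d by (intro continuous_intros) auto
  have "integral {a..x} ?g = 0" if "x \<in> {a..b}" for x
  proof (rule integral_unique)
    have "(?g has_integral exp (x / d) * f x - exp (a / d) * f a) {a..x}"
      using fh that by (simp add: exp_primitive_def)
    then show "(?g has_integral 0) {a..x}" using f[of x] f[of a] that ab by simp
  qed
  moreover have "((\<lambda>x. integral {a..x} ?g) has_real_derivative ?g z) (at z within {a..b})"
    by (rule integral_has_real_derivative[OF cont]) (use ab in auto)
  ultimately have "((\<lambda>x. 0) has_real_derivative ?g z) (at z within {a..b})"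
    using ab by (auto intro: has_field_derivative_transform_within[where d = 1])
  then have "((\<lambda>x. 0) has_real_derivative ?g z) (at z)"
    using ab by (simp add: at_within_Icc_at)
  then have "?g z = 0" by (rule DERIV_unique) auto
  then show ?thesis using d by simp
qed

section \<open>Exponential splines with equidistant knots\<close>

locale exp_spline =
  fixes d :: "nat \<Rightarrow> real" and n :: nat and \<kappa> :: real and k1 k2 :: int and c :: "int \<Rightarrow> real"
  assumes d_nonzero: "\<And>i. i \<le> n \<Longrightarrow> d i \<noteq> 0" and n_pos: "n \<ge> 1" and \<kappa>_pos: "\<kappa> > 0" and k12: "k1 \<le> k2"
begin

definition f :: "nat \<Rightarrow> real \<Rightarrow> real" where
  "f j x = (\<Sum>k\<in>{k1..k2}. c k * gk d j (x - \<kappa> * of_int k))"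

text \<open>The cells with indices \<open>k1 - 1\<close> and \<open>k2\<close> are the half-lines outside all knots.\<close>
definition cell :: "int \<Rightarrow> real set" where
  "cell k = {x. (k \<ge> k1 \<longrightarrow> \<kappa> * of_int k < x) \<and> (k < k2 \<longrightarrow> x < \<kappa> * of_int (k + 1))}"

lemma f_exp_primitive: "j < n \<Longrightarrow> exp_primitive (d (Suc j)) (f (Suc j)) (f j)"
  unfolding f_def[abs_def]
  by (intro exp_primitive_sum gk_exp_primitive) (simp_all add: d_nonzero)

lemma f_continuous: "0 < j \<Longrightarrow> j \<le> n \<Longrightarrow> continuous_on UNIV (f j)"
  using exp_primitive_continuous[OF f_exp_primitive[of "j - 1"]] by simp

lemma f_bounded: assumes "j \<le> n" shows "\<exists>B. \<forall>x. \<bar>f j x\<bar> \<le> B"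
proof -
  obtain B where B: "\<And>x. \<bar>gk d j x\<bar> \<le> B"
    using exp_decay_bounded[OF gk_decay[of j d]] d_nonzero assms by (meson order_trans)
  have "\<bar>f j x\<bar> \<le> (\<Sum>k\<in>{k1..k2}. \<bar>c k\<bar> * B)" for x
    unfolding f_def by (rule order_trans[OF sum_abs sum_mono], subst abs_mult, rule mult_left_mono[OF B abs_ge_zero])
  then show ?thesis by blast
qed

lemma f0_eq:
  "f 0 x = exp (- x / d 0) / \<bar>d 0\<bar> * (\<Sum>k\<in>{k\<in>{k1..k2}. (x - \<kappa> * of_int k) * d 0 > 0}. c k * exp (\<kappa> * of_int k / d 0))"
  unfolding f_def sum_distrib_left
  by (rule sum.mono_neutral_cong_right)
    (auto simp: ekern_def diff_divide_distrib exp_diff exp_minus field_simps)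

definition knot_free :: "real set \<Rightarrow> bool" where
  "knot_free I \<longleftrightarrow> is_interval I \<and> open I \<and> (\<forall>k\<in>{k1..k2}. \<kappa> * of_int k \<notin> I)"

lemma f0_knot_free:
  assumes I: "knot_free I"
  shows "\<exists>C. \<forall>x\<in>I. f 0 x = C * exp (- x / d 0)"
proof (cases "I = {}")
  case False
  then obtain y where y: "y \<in> I" by auto
  have "(x - \<kappa> * of_int k) * d 0 > 0 \<longleftrightarrow> (y - \<kappa> * of_int k) * d 0 > 0" if "x \<in> I" "k \<in> {k1..k2}" for x k
  proof -
    have "x < \<kappa> * of_int k \<longleftrightarrow> y < \<kappa> * of_int k" "x > \<kappa> * of_int k \<longleftrightarrow> y > \<kappa> * of_int k"
      using I that y unfolding knot_free_def is_interval_1 by (meson not_less le_cases order.strict_implies_order)+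
    then show ?thesis by (auto simp: zero_less_mult_iff)
  qed
  then have "{k\<in>{k1..k2}. (x - \<kappa> * of_int k) * d 0 > 0} = {k\<in>{k1..k2}. (y - \<kappa> * of_int k) * d 0 > 0}" if "x \<in> I" for x
    using that by blast
  then show ?thesis unfolding f0_eq
    by (intro exI[of _ "(\<Sum>k\<in>{k\<in>{k1..k2}. (y - \<kappa> * of_int k) * d 0 > 0}. c k * exp (\<kappa> * of_int k / d 0)) / \<bar>d 0\<bar>"]) simp
qed auto

lemma f_continuous_knot_free: "knot_free I \<Longrightarrow> j \<le> n \<Longrightarrow> continuous_on I (f j)"
proof (cases "j = 0")
  case True
  assume "knot_free I"
  from f0_knot_free[OF this] obtain C where "\<And>x. x \<in> I \<Longrightarrow> f 0 x = C * exp (- x / d 0)" by blast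
  moreover have "continuous_on I (\<lambda>x. C * exp (- x / d 0))" using d_nonzero[of 0] by (intro continuous_intros) auto
  ultimately show ?thesis using True by (metis (no_types, lifting) continuous_on_cong)
qed (auto intro: continuous_on_subset[OF f_continuous])

lemma f_zero_down:
  assumes I: "knot_free I" and j: "j < n" and uv: "{u<..<v} \<subseteq> I" and f: "\<And>x. x \<in> {u<..<v} \<Longrightarrow> f (Suc j) x = 0"
    and x: "x \<in> {u<..<v}"
  shows "f j x = 0"
  by (rule exp_primitive_zero[OF f_exp_primitive[OF j], of u v])
    (use continuous_on_subset[OF f_continuous_knot_free[OF I] uv] j f x in auto)

text \<open>Unique continuation between knots: the zero set descends to level 0, where a single
  exponential is left, and the homogeneous equations carry zero back up with zero initial
  values.\<close>

lemma f_zero_extend: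
  assumes "knot_free I" "u < v" "{u<..<v} \<subseteq> I" "j \<le> n" "\<And>x. x \<in> {u<..<v} \<Longrightarrow> f j x = 0" "y \<in> I"
  shows "f j y = 0"
  using assms(4-)
proof (induction j arbitrary: y)
  case 0
  obtain C where C: "\<And>x. x \<in> I \<Longrightarrow> f 0 x = C * exp (- x / d 0)" using f0_knot_free[OF assms(1)] by blast
  obtain x where x: "x \<in> {u<..<v}" using dense[OF assms(2)] by auto
  then have "C * exp (- x / d 0) = 0" using C[of x] 0(2)[of x] assms(3) by auto
  then show ?case using C 0 by simp
next
  case (Suc j)
  have "f j x = 0" if "x \<in> {u<..<v}" for x
    using f_zero_down[OF assms(1) _ assms(3) Suc.prems(2) that] Suc.prems(1) by simp
  then have zero: "f j x = 0" if "x \<in> I" for x using Suc that by auto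
  obtain x where x: "x \<in> {u<..<v}" using dense[OF assms(2)] by auto
  have "exp (y / d (Suc j)) * f (Suc j) y = exp (x / d (Suc j)) * f (Suc j) x"
    by (rule exp_primitive_const[OF f_exp_primitive, where I = I])
      (use Suc.prems assms zero x in \<open>auto simp: knot_free_def\<close>)
  then show ?case using Suc.prems(2)[OF x] by simp
qed

lemma f_zero_levels:
  assumes I: "knot_free I" and f: "\<And>x. x \<in> I \<Longrightarrow> f n x = 0" and "j \<le> n" "x \<in> I"
  shows "f j x = 0"
  using assms(3,4)
proof (induction j arbitrary: x rule: inc_induct)
  case (step j)
  obtain e where e: "e > 0" "{x - e<..<x + e} \<subseteq> I"
  proof -
    obtain e where "e > 0" "ball x e \<subseteq> I" using I step.prems unfolding knot_free_def open_contains_ball by blast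
    then show thesis by (intro that[of e]) (auto simp: dist_real_def subset_eq abs_less_iff)
  qed
  show ?case
    by (rule f_zero_down[OF I step.hyps(2) e(2)]) (use e step.IH in auto)
qed (rule f)

lemma knot_free_cell: "knot_free (cell k)"
proof -
  have "cell k = (if k \<ge> k1 then {\<kappa> * of_int k<..} else UNIV) \<inter> (if k < k2 then {..<\<kappa> * of_int (k + 1)} else UNIV)"
    by (auto simp: cell_def)
  then have "open (cell k)" "is_interval (cell k)" by (auto intro!: is_interval_Int)
  moreover have "\<kappa> * of_int l \<notin> cell k" if "l \<in> {k1..k2}" for l
  proof
    assume "\<kappa> * of_int l \<in> cell k"
    then have "k < l" "l < k + 1 \<or> k \<ge> k2" using that \<kappa>_pos by (auto simp: cell_def)
    then show False using that by auto
  qed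
  ultimately show ?thesis by (simp add: knot_free_def)
qed

definition index :: "real \<Rightarrow> int" where "index x = max (k1 - 1) (min k2 \<lfloor>x / \<kappa>\<rfloor>)"

lemma in_cell_index: assumes "\<And>k. k \<in> {k1..k2} \<Longrightarrow> x \<noteq> \<kappa> * of_int k" shows "x \<in> cell (index x)"
proof -
  have lo: "\<kappa> * of_int \<lfloor>x / \<kappa>\<rfloor> \<le> x" and hi: "x < \<kappa> * of_int (\<lfloor>x / \<kappa>\<rfloor> + 1)"
    using \<kappa>_pos floor_divide_lower[of \<kappa> x] floor_divide_upper[of \<kappa> x] by (auto simp: mult.commute)
  have mono: "\<kappa> * of_int i \<le> \<kappa> * of_int j" if "i \<le> j" for i j :: int using that \<kappa>_pos by simp
  show ?thesis unfolding cell_def mem_Collect_eq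
  proof (intro conjI impI)
    assume "k1 \<le> index x"
    then have i: "index x \<le> \<lfloor>x / \<kappa>\<rfloor>" "index x \<in> {k1..k2}" using k12 by (auto simp: index_def)
    have "\<kappa> * of_int (index x) \<le> x" using mono[OF i(1)] lo by linarith
    then show "\<kappa> * of_int (index x) < x" using assms[OF i(2)] by simp
  next
    assume "index x < k2"
    then have "\<lfloor>x / \<kappa>\<rfloor> + 1 \<le> index x + 1" by (auto simp: index_def)
    from mono[OF this] hi show "x < \<kappa> * of_int (index x + 1)" by linarith
  qed
qed

text \<open>At level 0, crossing the knot of \<open>k\<close> switches exactly the term with
  \<open>c k\<close> on or off, depending on the sign of \<open>d 0\<close>. If both adjacent cells
  carry zero, that term is zero. In the proof \<open>A\<close> collects the terms active on both
  sides.\<close>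

lemma coefficients_zero:
  assumes f: "\<And>k x. k \<in> {k1 - 1..k2} \<Longrightarrow> x \<in> cell k \<Longrightarrow> f n x = 0" and k: "k \<in> {k1..k2}"
  shows "c k = 0"
proof -
  define x y where "x = \<kappa> * of_int k - \<kappa> / 2" and "y = \<kappa> * of_int k + \<kappa> / 2"
  have "x \<in> cell (k - 1)" "y \<in> cell k" using k \<kappa>_pos by (auto simp: cell_def x_def y_def algebra_simps)
  moreover have "f 0 z = 0" if "z \<in> cell l" "l \<in> {k1 - 1..k2}" for z l
    by (rule f_zero_levels[OF knot_free_cell, of l]) (use f that in auto)
  ultimately have xy: "f 0 x = 0" "f 0 y = 0" using k by auto
  define V where "V z = (\<Sum>k\<in>{k\<in>{k1..k2}. (z - \<kappa> * of_int k) * d 0 > 0}. c k * exp (\<kappa> * of_int k / d 0))" for z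
  have V: "V x = 0" "V y = 0" using xy d_nonzero[of 0] by (auto simp: f0_eq V_def)
  have sgn: "x < \<kappa> * of_int l \<longleftrightarrow> l \<ge> k" "\<kappa> * of_int l < x \<longleftrightarrow> l < k" "y < \<kappa> * of_int l \<longleftrightarrow> l > k" "\<kappa> * of_int l < y \<longleftrightarrow> l \<le> k" for l
  proof -
    have a: "\<kappa> * of_int k + \<kappa> \<le> \<kappa> * of_int l" if "l > k" for l k
      using mult_left_mono[of "of_int (k + 1)" "of_int l" \<kappa>] that \<kappa>_pos by (simp add: algebra_simps)
    show "x < \<kappa> * of_int l \<longleftrightarrow> l \<ge> k" "\<kappa> * of_int l < x \<longleftrightarrow> l < k" "y < \<kappa> * of_int l \<longleftrightarrow> l > k" "\<kappa> * of_int l < y \<longleftrightarrow> l \<le> k"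
      using a[of k l] a[of l k] \<kappa>_pos by (cases l k rule: linorder_cases; auto simp: x_def y_def)+
  qed
  have "\<exists>A. finite A \<and> k \<notin> A \<and> (V x = (\<Sum>k\<in>A. c k * exp (\<kappa> * of_int k / d 0)) \<and> V y = (\<Sum>k\<in>insert k A. c k * exp (\<kappa> * of_int k / d 0)) \<or> V y = (\<Sum>k\<in>A. c k * exp (\<kappa> * of_int k / d 0)) \<and> V x = (\<Sum>k\<in>insert k A. c k * exp (\<kappa> * of_int k / d 0)))"
  proof (cases "d 0 > 0")
    case True
    have "{l\<in>{k1..k2}. (x - \<kappa> * of_int l) * d 0 > 0} = {k1..<k}" "{l\<in>{k1..k2}. (y - \<kappa> * of_int l) * d 0 > 0} = insert k {k1..<k}"
      using True k by (auto simp: zero_less_mult_iff sgn)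
    then show ?thesis unfolding V_def by (intro exI[of _ "{k1..<k}"]) simp
  next
    case False
    have "{l\<in>{k1..k2}. (x - \<kappa> * of_int l) * d 0 > 0} = insert k {k<..k2}" "{l\<in>{k1..k2}. (y - \<kappa> * of_int l) * d 0 > 0} = {k<..k2}"
      using False k d_nonzero[of 0] by (auto simp: zero_less_mult_iff sgn)
    then show ?thesis unfolding V_def by (intro exI[of _ "{k<..k2}"]) simp
  qed
  then obtain A where A: "finite A" "k \<notin> A" "V x = (\<Sum>k\<in>A. c k * exp (\<kappa> * of_int k / d 0)) \<and> V y = (\<Sum>k\<in>insert k A. c k * exp (\<kappa> * of_int k / d 0)) \<or> V y = (\<Sum>k\<in>A. c k * exp (\<kappa> * of_int k / d 0)) \<and> V x = (\<Sum>k\<in>insert k A. c k * exp (\<kappa> * of_int k / d 0))"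
    by blast
  then have "(\<Sum>k\<in>A. c k * exp (\<kappa> * of_int k / d 0)) = 0" "(\<Sum>k\<in>insert k A. c k * exp (\<kappa> * of_int k / d 0)) = 0"
    using V by metis+
  then have "c k * exp (\<kappa> * of_int k / d 0) = 0" using sum.insert[OF A(1,2), of "\<lambda>k. c k * exp (\<kappa> * of_int k / d 0)"] by linarith
  then show ?thesis by simp
qed

text \<open>Level 0 is a positive exponential times a factor that depends only on the set of active
  knots, so its sign is constant on cells. The two subtracted terms account for the half-line on
  which no kernel is active, where level 0 vanishes: the left one for \<open>d 0 > 0\<close>, the
  right one for \<open>d 0 < 0\<close>.\<close>

lemma f0_alternates_bound:
  assumes S: "S = {x. (a \<ge> k1 \<longrightarrow> \<kappa> * of_int a < x) \<and> (b < k2 \<longrightarrow> x < \<kappa> * of_int (b + 1))}"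
    and ab: "a \<le> b" "k1 - 1 \<le> a" "b \<le> k2" and alt: "alternates (f 0) S N" "N \<ge> 1"
  shows "int N \<le> b - a + 1 - of_bool (a < k1 \<and> d 0 > 0) - of_bool (k2 \<le> b \<and> d 0 < 0)"
proof (cases "d 0 > 0")
  case True
  \<comment> \<open>For \<open>d 0 > 0\<close> a knot takes its value from the cell on its left,
    hence the ceiling; the cell \<open>k\<close> receives the index \<open>k + 1\<close>. The
    minimum merges everything beyond the last knot.\<close>
  define \<iota> where "\<iota> x = min \<lceil>x / \<kappa>\<rceil> (k2 + 1)" for x
  define W where "W i = (\<Sum>k\<in>{k\<in>{k1..k2}. k < i}. c k * exp (\<kappa> * of_int k / d 0))" for i
  have "(x - \<kappa> * of_int k) * d 0 > 0 \<longleftrightarrow> k < \<iota> x" if "k \<in> {k1..k2}" for x k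
    using True that \<kappa>_pos by (auto simp: \<iota>_def zero_less_mult_iff less_ceiling_iff field_simps)
  then have f0: "f 0 x = exp (- x / d 0) / \<bar>d 0\<bar> * W (\<iota> x)" for x
    unfolding f0_eq W_def by (intro arg_cong[where f = "\<lambda>A. _ * sum _ A"]) blast
  have "int N \<le> b + 1 - (a + 1 + of_bool (a < k1)) + 1"
  proof (rule alternates_bound[OF alt(1) _ _ _ alt(2)])
    show "mono \<iota>" unfolding \<iota>_def using \<kappa>_pos
      by (intro monoI min.mono ceiling_mono divide_right_mono) auto
    fix x assume x: "x \<in> S" "f 0 x \<noteq> 0"
    have "\<exists>k\<in>{k1..k2}. k < \<iota> x"
    proof (rule ccontr)
      assume "\<not> ?thesis"
      then have "W (\<iota> x) = 0" unfolding W_def by (intro sum.neutral) auto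
      with x f0 show False by simp
    qed
    then have 1: "k1 < \<iota> x" by auto
    have 2: "a < \<iota> x" if "k1 \<le> a"
    proof -
      have "of_int a < x / \<kappa>" using x(1) that \<kappa>_pos unfolding S by (simp add: field_simps)
      then show ?thesis using ab by (simp add: \<iota>_def less_ceiling_iff)
    qed
    have 3: "\<iota> x \<le> b + 1"
    proof (cases "b < k2")
      case True
      then have "x / \<kappa> \<le> of_int (b + 1)" using x(1) \<kappa>_pos unfolding S by (simp add: field_simps)
      then show ?thesis by (simp only: \<iota>_def min_le_iff_disj ceiling_le_iff simp_thms)
    qed (simp add: \<iota>_def)
    show "a + 1 + of_bool (a < k1) \<le> \<iota> x \<and> \<iota> x \<le> b + 1" using 1 2 3 ab by auto
  next
    fix x y assume eq: "\<iota> x = \<iota> y"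
    have "f 0 x * f 0 y = (exp (- x / d 0) / \<bar>d 0\<bar> * (exp (- y / d 0) / \<bar>d 0\<bar>)) * (W (\<iota> y) * W (\<iota> y))"
      unfolding f0 eq by (simp only: ac_simps)
    then show "0 \<le> f 0 x * f 0 y" by simp
  qed
  then show ?thesis using True by simp
next
  case False
  then have d0: "d 0 < 0" using d_nonzero[of 0] by simp
  \<comment> \<open>The mirror image: a knot now takes its value from the cell on its right, and
    everything before the first knot is merged.\<close>
  define \<iota> where "\<iota> x = max \<lfloor>x / \<kappa>\<rfloor> (k1 - 1)" for x
  define W where "W i = (\<Sum>k\<in>{k\<in>{k1..k2}. i < k}. c k * exp (\<kappa> * of_int k / d 0))" for i
  have "(x - \<kappa> * of_int k) * d 0 > 0 \<longleftrightarrow> \<iota> x < k" if "k \<in> {k1..k2}" for x k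
    using d0 that \<kappa>_pos by (auto simp: \<iota>_def zero_less_mult_iff floor_less_iff field_simps)
  then have f0: "f 0 x = exp (- x / d 0) / \<bar>d 0\<bar> * W (\<iota> x)" for x
    unfolding f0_eq W_def by (intro arg_cong[where f = "\<lambda>A. _ * sum _ A"]) blast
  have "int N \<le> (b - of_bool (k2 \<le> b)) - a + 1"
  proof (rule alternates_bound[OF alt(1) _ _ _ alt(2)])
    show "mono \<iota>" unfolding \<iota>_def using \<kappa>_pos
      by (intro monoI max.mono floor_mono divide_right_mono) auto
    fix x assume x: "x \<in> S" "f 0 x \<noteq> 0"
    have "\<exists>k\<in>{k1..k2}. \<iota> x < k"
    proof (rule ccontr)
      assume "\<not> ?thesis"
      then have "W (\<iota> x) = 0" unfolding W_def by (intro sum.neutral) auto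
      with x f0 show False by simp
    qed
    then have 1: "\<iota> x < k2" by auto
    have 2: "\<iota> x < b + 1" if "b < k2"
    proof -
      have "x / \<kappa> < of_int (b + 1)" using x(1) that \<kappa>_pos unfolding S by (simp add: field_simps)
      then have "\<lfloor>x / \<kappa>\<rfloor> < b + 1" by (simp only: floor_less_iff)
      then show ?thesis using ab by (simp add: \<iota>_def)
    qed
    have 3: "a \<le> \<iota> x"
    proof (cases "k1 \<le> a")
      case True
      then have "of_int a \<le> x / \<kappa>" using x(1) \<kappa>_pos unfolding S by (simp add: field_simps)
      then show ?thesis by (simp add: \<iota>_def le_max_iff_disj le_floor_iff)
    qed (use ab in \<open>simp add: \<iota>_def\<close>)
    show "a \<le> \<iota> x \<and> \<iota> x \<le> b - of_bool (k2 \<le> b)" using 1 2 3 ab by auto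
  next
    fix x y assume eq: "\<iota> x = \<iota> y"
    have "f 0 x * f 0 y = (exp (- x / d 0) / \<bar>d 0\<bar> * (exp (- y / d 0) / \<bar>d 0\<bar>)) * (W (\<iota> y) * W (\<iota> y))"
      unfolding f0 eq by (simp only: ac_simps)
    then show "0 \<le> f 0 x * f 0 y" by simp
  qed
  then show ?thesis using d0 by simp
qed

text \<open>Maximality of the run makes the neighbouring cells vanish identically, hence at all
  levels, and this gives zero boundary values at the bounded ends of \<open>S\<close>. The final
  cases distinguish which ends are infinite; the hypothesis \<open>dense\<close> enters when the
  zeros are counted over the whole sample window.\<close>

theorem vanishing_samples_imp_zero:
  fixes x \<alpha> :: real and p q :: nat
  assumes \<alpha>: "0 < \<alpha>" "\<alpha> < \<kappa>"
    and p: "p = card {i. i \<le> n \<and> d i > 0}" and q: "q = card {i. i \<le> n \<and> d i < 0}"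
    and dense: "(k2 - k1 - n + 1) * \<kappa> / \<alpha> - 1 > k2 - k1"
    and zero: "\<And>i::int. \<kappa> * (k1 + int p - 1) < x + \<alpha> * i \<Longrightarrow> x + \<alpha> * i < \<kappa> * (k2 - int q + 1) \<Longrightarrow> f n (x + \<alpha> * i) = 0"
    and k: "k \<in> {k1..k2}"
  shows "c k = 0"
proof (rule ccontr)
  assume ck: "c k \<noteq> 0"
  define nz where "nz k \<longleftrightarrow> (\<exists>x\<in>cell k. f n x \<noteq> 0)" for k
  obtain k0 where k0: "k0 \<in> {k1 - 1..k2}" "nz k0"
    using coefficients_zero[OF _ k] ck unfolding nz_def by blast
  define a where "a = Min {a\<in>{k1 - 1..k0}. \<forall>l\<in>{a..k0}. nz l}"
  define b where "b = Max {b\<in>{k0..k2}. \<forall>l\<in>{k0..b}. nz l}"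
  have fin: "finite {a\<in>{k1 - 1..k0}. \<forall>l\<in>{a..k0}. nz l}" "finite {b\<in>{k0..k2}. \<forall>l\<in>{k0..b}. nz l}"
    by (rule finite_subset[of _ "{k1 - 1..k0}"] finite_subset[of _ "{k0..k2}"]; auto)+
  have "k0 \<in> {a\<in>{k1 - 1..k0}. \<forall>l\<in>{a..k0}. nz l}" "k0 \<in> {b\<in>{k0..k2}. \<forall>l\<in>{k0..b}. nz l}"
    using k0 by auto
  then have ne: "{a\<in>{k1 - 1..k0}. \<forall>l\<in>{a..k0}. nz l} \<noteq> {}" "{b\<in>{k0..k2}. \<forall>l\<in>{k0..b}. nz l} \<noteq> {}" by blast+
  have "a \<in> {a\<in>{k1 - 1..k0}. \<forall>l\<in>{a..k0}. nz l}"
    unfolding a_def by (rule Min_in[OF fin(1) ne(1)])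
  then have a: "k1 - 1 \<le> a" "a \<le> k0" "\<And>l. a \<le> l \<Longrightarrow> l \<le> k0 \<Longrightarrow> nz l" by auto
  have "b \<in> {b\<in>{k0..k2}. \<forall>l\<in>{k0..b}. nz l}"
    unfolding b_def by (rule Max_in[OF fin(2) ne(2)])
  then have b: "k0 \<le> b" "b \<le> k2" "\<And>l. k0 \<le> l \<Longrightarrow> l \<le> b \<Longrightarrow> nz l" by auto
  have nz_ab: "nz l" if "a \<le> l" "l \<le> b" for l using that a(3) b(3) by (cases "l \<le> k0") auto
  have a_max: "\<not> nz (a - 1)" if "k1 \<le> a"
  proof
    assume "nz (a - 1)"
    then have "nz l" if "l \<in> {a - 1..k0}" for l using a(3)[of l] that by (cases "l = a - 1") auto
    then have "a - 1 \<in> {a\<in>{k1 - 1..k0}. \<forall>l\<in>{a..k0}. nz l}" using that a by auto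
    then have "a \<le> a - 1" by (rule Min_le[OF fin(1), folded a_def])
    then show False by simp
  qed
  have b_max: "\<not> nz (b + 1)" if "b < k2"
  proof
    assume "nz (b + 1)"
    then have "nz l" if "l \<in> {k0..b + 1}" for l using b(3)[of l] that by (cases "l = b + 1") auto
    then have "b + 1 \<in> {b\<in>{k0..k2}. \<forall>l\<in>{k0..b}. nz l}" using that b by auto
    then have "b + 1 \<le> b" by (rule Max_ge[OF fin(2), folded b_def])
    then show False by simp
  qed
  define S where "S = {x. (a \<ge> k1 \<longrightarrow> \<kappa> * of_int a < x) \<and> (b < k2 \<longrightarrow> x < \<kappa> * of_int (b + 1))}"
  have mono: "\<kappa> * of_int i \<le> \<kappa> * of_int j" if "i \<le> j" for i j :: int using that \<kappa>_pos by simp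
  have "S = (if a \<ge> k1 then {\<kappa> * of_int a<..} else UNIV) \<inter> (if b < k2 then {..<\<kappa> * of_int (b + 1)} else UNIV)"
    by (auto simp: S_def)
  then have S: "open S" "is_interval S" by (auto intro!: is_interval_Int)
  have "cell k0 \<subseteq> S"
  proof
    fix y assume y: "y \<in> cell k0"
    have "\<kappa> * of_int a < y" if "k1 \<le> a" using y a(2) that mono[of a k0] by (simp add: cell_def)
    moreover have "y < \<kappa> * of_int (b + 1)" if "b < k2" using y b(1) that mono[of "k0 + 1" "b + 1"] by (simp add: cell_def)
    ultimately show "y \<in> S" by (simp add: S_def)
  qed
  then have S_ne: "S \<noteq> {}" using k0(2) by (auto simp: nz_def)
  have S_cell: "l \<in> {a..b}" if "y \<in> S" "y \<in> cell l" "l \<in> {k1 - 1..k2}" for y l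
  proof (rule ccontr)
    assume "l \<notin> {a..b}"
    then consider "l < a" | "b < l" by force
    then show False
    proof cases
      case 1
      then have "y < \<kappa> * of_int (l + 1)" "\<kappa> * of_int a < y" using that a k0 by (auto simp: cell_def S_def)
      with mono[of "l + 1" a] 1 show False by simp
    next
      case 2
      then have "\<kappa> * of_int l < y" "y < \<kappa> * of_int (b + 1)" using that b k0 by (auto simp: cell_def S_def)
      with mono[of "b + 1" l] 2 show False by simp
    qed
  qed
  \<comment> \<open>A zero interval would meet the interior of some cell of the run, and unique
    continuation would make that whole cell vanish.\<close>
  have nondeg: "nondegenerate (f n) S" unfolding nondegenerate_def
  proof (intro allI impI)
    fix u v :: real assume uv: "u < v" "{u<..<v} \<subseteq> S"
    have "infinite ({u<..<v} - (\<lambda>k. \<kappa> * of_int k) ` {k1..k2})" using uv by (intro Diff_infinite_finite) auto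
    then obtain w where w: "w \<in> {u<..<v}" "w \<notin> (\<lambda>k. \<kappa> * of_int k) ` {k1..k2}"
      using infinite_imp_nonempty by blast
    define l where "l = index w"
    have wl: "w \<in> cell l" unfolding l_def by (rule in_cell_index) (use w in auto)
    have l: "l \<in> {k1 - 1..k2}" using k12 by (auto simp: l_def index_def)
    then have "nz l" using S_cell[of w l] uv w wl nz_ab by auto
    then obtain z where z: "z \<in> cell l" "f n z \<noteq> 0" by (auto simp: nz_def)
    have "open (cell l \<inter> {u<..<v})" using knot_free_cell by (auto simp: knot_free_def)
    then obtain e where e: "e > 0" "ball w e \<subseteq> cell l \<inter> {u<..<v}"
      using w wl unfolding open_contains_ball by blast
    then have sub: "{w - e<..<w + e} \<subseteq> cell l" "{w - e<..<w + e} \<subseteq> {u<..<v}"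
      by (auto simp: subset_eq dist_real_def abs_less_iff)
    show "\<exists>w\<in>{u<..<v}. f n w \<noteq> 0"
    proof (rule ccontr)
      assume "\<not> ?thesis"
      then have "f n y = 0" if "y \<in> {w - e<..<w + e}" for y using sub(2) that by blast
      from f_zero_extend[OF knot_free_cell _ sub(1) order_refl this z(1)] e(1) have "f n z = 0" by simp
      with z show False by simp
    qed
  qed
  \<comment> \<open>At a bounded end all continuous levels vanish. At an infinite end the levels are
    merely bounded, and the weight \<open>exp (x / d j)\<close> tends to 0 there only for the sign
    of \<open>d j\<close> named here.\<close>
  define bL where "bL j \<longleftrightarrow> k1 \<le> a \<or> d j > 0" for j
  define bR where "bR j \<longleftrightarrow> b < k2 \<or> d j < 0" for j
  have cell_zero: "f j y = 0" if "\<not> nz l" "j \<le> n" "y \<in> cell l" for j l y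
    by (rule f_zero_levels[OF knot_free_cell, of l]) (use that in \<open>auto simp: nz_def\<close>)
  have L: "left_vanish (d j) (f j) S" if jn: "bL j" "0 < j" "j \<le> n" for j
    unfolding left_vanish_def
  proof (intro ballI allI impI)
    fix y \<epsilon> :: real assume y: "y \<in> S" and \<epsilon>: "\<epsilon> > 0"
    have Sy: "u \<in> S" if "u < y" "k1 \<le> a \<longrightarrow> \<kappa> * of_int a < u" for u using y that by (auto simp: S_def)
    show "\<exists>u<y. {u<..<y} \<subseteq> S \<and> \<bar>exp (u / d j) * f j u\<bar> < \<epsilon>"
    proof (cases "k1 \<le> a")
      case True
      have "f j (\<kappa> * of_int a) = 0"
      proof (rule continuous_constant_on_closure[where f = "f j" and S = "{\<kappa> * of_int a - \<kappa><..<\<kappa> * of_int a}"])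
        show "continuous_on (closure {\<kappa> * of_int a - \<kappa><..<\<kappa> * of_int a}) (f j)"
          using f_continuous[OF jn(2,3)] by (rule continuous_on_subset) simp
        show "f j x = 0" if "x \<in> {\<kappa> * of_int a - \<kappa><..<\<kappa> * of_int a}" for x
          by (rule cell_zero[OF a_max[OF True] \<open>j \<le> n\<close>]) (use that in \<open>auto simp: cell_def algebra_simps\<close>)
        show "\<kappa> * of_int a \<in> closure {\<kappa> * of_int a - \<kappa><..<\<kappa> * of_int a}" using \<kappa>_pos by simp
      qed
      then show ?thesis using True y \<epsilon> Sy by (intro exI[of _ "\<kappa> * of_int a"]) (auto simp: S_def)
    next
      case False
      then have dj: "d j > 0" using jn by (simp add: bL_def)
      obtain B where B: "\<And>x. \<bar>f j x\<bar> \<le> B" using f_bounded[OF jn(3)] by blast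
      have "((\<lambda>u. exp (u / d j) * B) \<longlongrightarrow> 0) at_bot" using dj by real_asymp
      then have "\<forall>\<^sub>F u in at_bot. exp (u / d j) * B < \<epsilon> \<and> u < y"
        using \<epsilon> by (intro eventually_conj order_tendstoD(2) eventually_gt_at_bot)
      then obtain u where u: "exp (u / d j) * B < \<epsilon>" "u < y" using eventually_happens[of _ "at_bot :: real filter"] eventually_happens[of _ "at_top :: real filter"] by force
      have "\<bar>exp (u / d j) * f j u\<bar> \<le> exp (u / d j) * B" by (simp add: abs_mult B)
      then show ?thesis using u False Sy by (intro exI[of _ u]) auto
    qed
  qed
  have R: "right_vanish (d j) (f j) S" if jn: "bR j" "0 < j" "j \<le> n" for j
    unfolding right_vanish_def
  proof (intro ballI allI impI)
    fix y \<epsilon> :: real assume y: "y \<in> S" and \<epsilon>: "\<epsilon> > 0"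
    have Sy: "u \<in> S" if "y < u" "b < k2 \<longrightarrow> u < \<kappa> * of_int (b + 1)" for u using y that by (auto simp: S_def)
    show "\<exists>u>y. {y<..<u} \<subseteq> S \<and> \<bar>exp (u / d j) * f j u\<bar> < \<epsilon>"
    proof (cases "b < k2")
      case True
      let ?b = "\<kappa> * of_int (b + 1)"
      have "f j ?b = 0"
      proof (rule continuous_constant_on_closure[where f = "f j" and S = "{?b<..<?b + \<kappa>}"])
        show "continuous_on (closure {?b<..<?b + \<kappa>}) (f j)"
          using f_continuous[OF jn(2,3)] by (rule continuous_on_subset) simp
        show "f j x = 0" if "x \<in> {?b<..<?b + \<kappa>}" for x
          by (rule cell_zero[OF b_max[OF True] \<open>j \<le> n\<close>]) (use that in \<open>auto simp: cell_def algebra_simps\<close>)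
        show "?b \<in> closure {?b<..<?b + \<kappa>}" using \<kappa>_pos by simp
      qed
      then show ?thesis using True y \<epsilon> Sy by (intro exI[of _ ?b]) (auto simp: S_def)
    next
      case False
      then have dj: "d j < 0" using jn by (simp add: bR_def)
      obtain B where B: "\<And>x. \<bar>f j x\<bar> \<le> B" using f_bounded[OF jn(3)] by blast
      have "((\<lambda>u. exp (u / d j) * B) \<longlongrightarrow> 0) at_top" using dj by real_asymp
      then have "\<forall>\<^sub>F u in at_top. exp (u / d j) * B < \<epsilon> \<and> u > y"
        using \<epsilon> by (intro eventually_conj order_tendstoD(2) eventually_gt_at_top)
      then obtain u where u: "exp (u / d j) * B < \<epsilon>" "u > y" using eventually_happens[of _ "at_bot :: real filter"] eventually_happens[of _ "at_top :: real filter"] by force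
      have "\<bar>exp (u / d j) * f j u\<bar> \<le> exp (u / d j) * B" by (simp add: abs_mult B)
      then show ?thesis using u False Sy by (intro exI[of _ u]) auto
    qed
  qed
  have LR: "bL j \<or> bR j" if "j \<le> n" for j using d_nonzero[OF that] by (auto simp: bL_def bR_def)
  \<comment> \<open>Zeros are available only where the run and the sample window overlap, so the
    inner one of the two ends counts on each side.\<close>
  define lo where "lo = (if k1 \<le> a then max a (k1 + int p - 1) else k1 + int p - 1)"
  define hi where "hi = (if b < k2 then min (b + 1) (k2 - int q + 1) else k2 - int q + 1)"
  define I where "I = {i::int. \<kappa> * of_int lo < x + \<alpha> * i \<and> x + \<alpha> * i < \<kappa> * of_int hi}"
  define Z where "Z = (\<lambda>i::int. x + \<alpha> * of_int i) ` I"
  have finI: "finite I" unfolding I_def lattice_count(1)[OF \<alpha>(1)] by simp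
  have cardZ: "card Z = card I" unfolding Z_def using \<alpha> by (intro card_image) (auto intro!: inj_onI)
  have cnt: "real (card Z) \<ge> \<kappa> * of_int (hi - lo) / \<alpha> - 1"
    using lattice_count(2)[OF \<alpha>(1), where A = "\<kappa> * of_int lo" and x = x and B = "\<kappa> * of_int hi"] cardZ
    by (simp add: I_def right_diff_distrib)
  \<comment> \<open>One zero per cell suffices for a run with a bounded end inside the window; it
    comes from \<open>\<alpha> < \<kappa>\<close>.\<close>
  have cnt1: "int (card Z) \<ge> hi - lo"
  proof (cases "lo < hi")
    case True
    have "of_int (hi - lo) * 1 < of_int (hi - lo) * (\<kappa> / \<alpha>)"
      by (rule mult_strict_left_mono) (use True \<alpha> in auto)
    then have "real (card Z) > of_int (hi - lo) - 1" using cnt by (simp add: mult.commute)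
    then show ?thesis by linarith
  qed simp
  have pq: "p + q = n + 1"
  proof -
    have "{i. i \<le> n \<and> d i > 0} \<union> {i. i \<le> n \<and> d i < 0} = {..n}" using d_nonzero by force
    then have "card {..n} = p + q" unfolding p q by (subst card_Un_disjoint[symmetric]) auto
    then show ?thesis by simp
  qed
  have cnt2: "int (card Z) \<ge> k2 - k1 + 1" if "lo = k1 + int p - 1" "hi = k2 - int q + 1"
  proof -
    have "hi - lo = k2 - k1 - n + 1" using that pq by simp
    then have "real (card Z) > k2 - k1" using cnt dense by (simp add: mult.commute)
    then show ?thesis by linarith
  qed
  have Z: "finite Z" "Z \<subseteq> S" "\<forall>z\<in>Z. f n z = 0"
  proof -
    show "finite Z" using finI by (simp add: Z_def)
    show "Z \<subseteq> S"
    proof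
      fix z assume "z \<in> Z"
      then have "\<kappa> * of_int lo < z" "z < \<kappa> * of_int hi" by (auto simp: Z_def I_def)
      then show "z \<in> S" using mono[of a lo] mono[of hi "b + 1"] by (auto simp: S_def lo_def hi_def split: if_splits)
    qed
    show "\<forall>z\<in>Z. f n z = 0"
    proof
      fix z assume "z \<in> Z"
      then obtain i where i: "z = x + \<alpha> * of_int i" "\<kappa> * of_int lo < z" "z < \<kappa> * of_int hi" by (auto simp: Z_def I_def)
      have "\<kappa> * of_int (k1 + int p - 1) < z" "z < \<kappa> * of_int (k2 - int q + 1)"
        using i(2,3) mono[of "k1 + int p - 1" lo] mono[of hi "k2 - int q + 1"] by (auto simp: lo_def hi_def split: if_splits)
      then show "f n z = 0" unfolding i(1) by (intro zero)
    qed
  qed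
  obtain j where j: "n = Suc j" using n_pos by (cases n) auto
  have "alternates (f j) S (card Z + of_bool (bL n) + of_bool (bR n))"
    by (rule alternates_of_zeros[OF _ S(2,1) S_ne _ _ nondeg Z]) (use f_exp_primitive[of j] L R j n_pos in auto)
  from alternates_chain[where f = f and j = j and d = d and bL = bL and bR = bR, OF _ S(2) _ _ _ this]
  have "alternates (f 0) S (card Z + of_bool (bL n) + of_bool (bR n) + card {i. i < j \<and> bL (Suc i) \<and> bR (Suc i)})"
    using f_exp_primitive L R LR j LR[of n] by auto
  \<comment> \<open>By \<open>LR\<close>, the top level contributes \<open>card Z + 1\<close>, and
    one more if both ends vanish for it. The last summand thus runs over all factors other than
    \<open>d 0\<close>.\<close>
  then have alt: "alternates (f 0) S (card Z + 1 + card {i. i < n \<and> bL (Suc i) \<and> bR (Suc i)})"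
    using LR[of n] unfolding j card_less_Suc_filter by (auto simp: j split: if_splits)
  have bound: "int (card Z + 1 + card {i. i < n \<and> bL (Suc i) \<and> bR (Suc i)})
      \<le> b - a + 1 - of_bool (a < k1 \<and> d 0 > 0) - of_bool (k2 \<le> b \<and> d 0 < 0)"
    by (rule f0_alternates_bound[OF S_def _ a(1) b(2) alt]) (use a b in auto)
  \<comment> \<open>\<open>d 0\<close> is split off because it enters through the vanishing
    half-line in \<open>bound\<close> and not through a Rolle step.\<close>
  have p': "int p = of_bool (d 0 > 0) + int (card {i. i < n \<and> d (Suc i) > 0})"
    and q': "int q = of_bool (d 0 < 0) + int (card {i. i < n \<and> d (Suc i) < 0})"
    unfolding p q less_Suc_eq_le[symmetric] card_less_Suc_filter_shift by simp_all
  show False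
  proof (cases "k1 \<le> a"; cases "b < k2")
    assume ab: "k1 \<le> a" "b < k2"
    then have "int (card Z) + n \<le> b - a" using bound by (simp add: bL_def bR_def)
    then show False using cnt1 cnt2 ab pq by (auto simp: lo_def hi_def max_def min_def split: if_splits)
  next
    \<comment> \<open>Here \<open>a = k1 - 1\<close>, so the window begins at
      \<open>lo = a + p\<close>: the \<open>p\<close> cells without counted zeros are exactly those
      paid for by the term \<open>p\<close> in the bound.\<close>
    assume ab: "\<not> k1 \<le> a" "b < k2"
    then have "int (card Z) + int p \<le> b - a" using bound p' by (simp add: bL_def bR_def)
    then show False using cnt1 cnt2 ab pq a by (auto simp: lo_def hi_def max_def min_def split: if_splits)
  next
    assume ab: "k1 \<le> a" "\<not> b < k2"
    then have "int (card Z) + int q \<le> b - a" using bound q' by (simp add: bL_def bR_def)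
    then show False using cnt1 cnt2 ab pq a b by (auto simp: lo_def hi_def max_def min_def split: if_splits)
  next
    assume ab: "\<not> k1 \<le> a" "\<not> b < k2"
    have "d 0 > 0 \<or> d 0 < 0" using d_nonzero[of 0] by auto
    then have "int (card Z) + 1 \<le> b - a" using bound ab by (elim disjE) (simp_all add: bL_def bR_def)
    then show False using cnt2 ab a b by (auto simp: lo_def hi_def)
  qed
qed

end

section \<open>The pseudoinverse of an injective matrix\<close>

text \<open>With \<open>w\<close> inverse to the Gram matrix \<open>G\<close>, the pseudoinverse is
  \<open>w\<close> times the transpose of \<open>P\<close>. For uniqueness, \<open>P Q P = P\<close>
  and the symmetry of \<open>P Q\<close> already imply the normal equations, which \<open>w\<close>
  solves.\<close>

lemma pinv_eq:
  fixes w :: "int \<Rightarrow> int \<Rightarrow> real"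
  assumes fin: "finite I" "finite J"
    and w: "\<And>k k'. k \<in> J \<Longrightarrow> k' \<in> J \<Longrightarrow> (\<Sum>l\<in>J. w k l * (\<Sum>i\<in>I. P i l * P i k')) = (if k = k' then 1 else 0)"
    and ki: "k \<in> J" "i \<in> I"
  shows "pinv I J P k i = (\<Sum>l\<in>J. w k l * P i l)"
proof -
  define G where "G l l' = (\<Sum>i\<in>I. P i l * P i l')" for l l'
  have Gsym: "G l l' = G l' l" for l l' by (simp add: G_def mult.commute)
  have w': "(\<Sum>l\<in>J. w k l * G l k') = (if k = k' then 1 else 0)" if "k \<in> J" "k' \<in> J" for k k'
    using w[OF that] by (simp add: G_def)
  \<comment> \<open>Only a left inverse is given. Evaluating \<open>w G\<close> times the transpose
    of \<open>w\<close> in two ways shows that it is symmetric, which the symmetry of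
    \<open>P Q\<close> depends on.\<close>
  have wsym: "w k k' = w k' k" if "k \<in> J" "k' \<in> J" for k k'
  proof -
    have "w k k' = (\<Sum>l\<in>J. w k l * (\<Sum>l'\<in>J. w k' l' * G l' l))"
      using that fin by (simp add: w' if_distrib cong: if_cong)
    also have "\<dots> = (\<Sum>l\<in>J. \<Sum>l'\<in>J. w k l * (w k' l' * G l' l))" by (simp add: sum_distrib_left)
    also have "\<dots> = (\<Sum>l'\<in>J. w k' l' * (\<Sum>l\<in>J. w k l * G l l'))"
      by (subst sum.swap) (simp add: sum_distrib_left Gsym mult.left_commute)
    also have "\<dots> = w k' k" using that fin by (simp add: w' if_distrib cong: if_cong)
    finally show ?thesis .
  qed
  define Q where "Q k i = (if k \<in> J \<and> i \<in> I then \<Sum>l\<in>J. w k l * P i l else 0)" for k i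
  have QP: "(\<Sum>i\<in>I. Q k i * P i k') = (if k = k' then 1 else 0)" if "k \<in> J" "k' \<in> J" for k k'
  proof -
    have "(\<Sum>i\<in>I. Q k i * P i k') = (\<Sum>i\<in>I. \<Sum>l\<in>J. w k l * (P i l * P i k'))"
      using that by (simp add: Q_def sum_distrib_right mult.assoc)
    also have "\<dots> = (\<Sum>l\<in>J. w k l * G l k')" by (subst sum.swap) (simp add: G_def sum_distrib_left)
    finally show ?thesis using w' that by simp
  qed
  have delta: "(\<Sum>k'\<in>J. h k' * (if k' = k then 1 else 0)) = h k" "(\<Sum>k'\<in>J. (if k = k' then 1 else 0) * h k') = h k"
    if "k \<in> J" for h :: "int \<Rightarrow> real" and k
    using that fin by (simp_all add: mult_delta_left mult_delta_right)
  define pen where "pen Q \<longleftrightarrow>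
     (\<forall>k i. (k \<notin> J \<or> i \<notin> I) \<longrightarrow> Q k i = 0) \<and>
     (\<forall>i\<in>I. \<forall>k\<in>J. (\<Sum>k'\<in>J. P i k' * (\<Sum>i'\<in>I. Q k' i' * P i' k)) = P i k) \<and>
     (\<forall>k\<in>J. \<forall>i\<in>I. (\<Sum>i'\<in>I. Q k i' * (\<Sum>k'\<in>J. P i' k' * Q k' i)) = Q k i) \<and>
     (\<forall>i\<in>I. \<forall>i'\<in>I. (\<Sum>k\<in>J. P i k * Q k i') = (\<Sum>k\<in>J. P i' k * Q k i)) \<and>
     (\<forall>k\<in>J. \<forall>k'\<in>J. (\<Sum>i\<in>I. Q k i * P i k') = (\<Sum>i\<in>I. Q k' i * P i k))" for Q :: "int \<Rightarrow> int \<Rightarrow> real"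
  have "pen Q" unfolding pen_def
  proof (intro conjI ballI allI impI)
    fix i k assume "i \<in> I" "k \<in> J"
    then show "(\<Sum>k'\<in>J. P i k' * (\<Sum>i'\<in>I. Q k' i' * P i' k)) = P i k" by (simp add: QP delta)
  next
    fix k i assume ki: "k \<in> J" "i \<in> I"
    have "(\<Sum>i'\<in>I. Q k i' * (\<Sum>k'\<in>J. P i' k' * Q k' i)) = (\<Sum>i'\<in>I. \<Sum>k'\<in>J. Q k i' * P i' k' * Q k' i)"
      by (simp add: sum_distrib_left mult.assoc)
    also have "\<dots> = (\<Sum>k'\<in>J. (\<Sum>i'\<in>I. Q k i' * P i' k') * Q k' i)"
      by (subst sum.swap) (simp add: sum_distrib_right)
    also have "\<dots> = Q k i" using ki by (simp add: QP delta cong: sum.cong)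
    finally show "(\<Sum>i'\<in>I. Q k i' * (\<Sum>k'\<in>J. P i' k' * Q k' i)) = Q k i" .
  next
    fix i i' assume i: "i \<in> I" "i' \<in> I"
    have "(\<Sum>k\<in>J. P i k * Q k i') = (\<Sum>k\<in>J. \<Sum>l\<in>J. P i k * (w k l * P i' l))"
      using i by (simp add: Q_def sum_distrib_left)
    also have "\<dots> = (\<Sum>l\<in>J. \<Sum>k\<in>J. P i' l * (w l k * P i k))"
      by (subst sum.swap) (intro sum.cong refl, simp add: wsym)
    also have "\<dots> = (\<Sum>k\<in>J. P i' k * Q k i)"
      using i by (simp add: Q_def sum_distrib_left)
    finally show "(\<Sum>k\<in>J. P i k * Q k i') = (\<Sum>k\<in>J. P i' k * Q k i)" .
  next
    fix k k' assume "k \<in> J" "k' \<in> J"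
    then show "(\<Sum>i\<in>I. Q k i * P i k') = (\<Sum>i\<in>I. Q k' i * P i k)" by (auto simp: QP)
  qed (auto simp: Q_def)
  moreover have "Q' = Q" if "pen Q'" for Q'
  proof (intro ext)
    fix k i
    show "Q' k i = Q k i"
    proof (cases "k \<in> J \<and> i \<in> I")
      case True
      have P1: "(\<Sum>k'\<in>J. P i k' * (\<Sum>i'\<in>I. Q' k' i' * P i' k)) = P i k" if "i \<in> I" "k \<in> J" for i k
        using \<open>pen Q'\<close> that unfolding pen_def by blast
      have P3: "(\<Sum>k\<in>J. P i k * Q' k i') = (\<Sum>k\<in>J. P i' k * Q' k i)" if "i \<in> I" "i' \<in> I" for i i'
        using \<open>pen Q'\<close> that unfolding pen_def by blast
      have GQ: "(\<Sum>k'\<in>J. G l k' * Q' k' i) = P i l" if l: "l \<in> J" for l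
      proof -
        have "(\<Sum>k'\<in>J. G l k' * Q' k' i) = (\<Sum>k'\<in>J. \<Sum>i'\<in>I. P i' l * (P i' k' * Q' k' i))"
          by (simp add: G_def sum_distrib_right mult.assoc)
        also have "\<dots> = (\<Sum>i'\<in>I. P i' l * (\<Sum>k'\<in>J. P i' k' * Q' k' i))"
          by (subst sum.swap) (simp add: sum_distrib_left)
        also have "\<dots> = (\<Sum>i'\<in>I. P i' l * (\<Sum>k'\<in>J. P i k' * Q' k' i'))"
          using True by (intro sum.cong refl arg_cong2[where f = "(*)"] P3) auto
        also have "\<dots> = (\<Sum>i'\<in>I. \<Sum>k'\<in>J. P i k' * (Q' k' i' * P i' l))"
          by (simp add: sum_distrib_left mult.commute mult.left_commute)
        also have "\<dots> = (\<Sum>k'\<in>J. P i k' * (\<Sum>i'\<in>I. Q' k' i' * P i' l))"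
          by (subst sum.swap) (simp add: sum_distrib_left)
        also have "\<dots> = P i l" using P1 l True by blast
        finally show ?thesis .
      qed
      have "Q' k i = (\<Sum>k'\<in>J. (\<Sum>l\<in>J. w k l * G l k') * Q' k' i)"
        using True by (simp add: w' delta cong: sum.cong)
      also have "\<dots> = (\<Sum>l\<in>J. w k l * (\<Sum>k'\<in>J. G l k' * Q' k' i))"
        unfolding sum_distrib_right sum_distrib_left by (subst sum.swap) (simp add: mult.assoc)
      also have "\<dots> = (\<Sum>l\<in>J. w k l * P i l)" by (simp add: GQ)
      finally show ?thesis using True by (simp add: Q_def)
    qed (use that in \<open>auto simp: pen_def Q_def\<close>)
  qed
  ultimately have "(THE Q. pen Q) = Q" by (intro the_equality)
  then have "pinv I J P = Q" unfolding pinv_def pen_def .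
  then show ?thesis using ki by (simp add: Q_def)
qed

text \<open>Solving the normal equations by iteration, rather than by Cramer's rule, makes the measurable
  dependence of the solution on the matrix evident.\<close>
primrec richardson :: "(int \<Rightarrow> int \<Rightarrow> real) \<Rightarrow> int set \<Rightarrow> real \<Rightarrow> (int \<Rightarrow> real) \<Rightarrow> nat \<Rightarrow> int \<Rightarrow> real" where
  "richardson G J \<tau> b 0 k = 0"
| "richardson G J \<tau> b (Suc n) k = richardson G J \<tau> b n k + \<tau> * (b k - (\<Sum>l\<in>J. G k l * richardson G J \<tau> b n l))"

lemma sum_square_le_card:
  fixes f :: "'a \<Rightarrow> real"
  assumes "finite A"
  shows "(\<Sum>x\<in>A. f x)\<^sup>2 \<le> card A * (\<Sum>x\<in>A. (f x)\<^sup>2)"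
  using Cauchy_Schwarz_ineq_sum[of "\<lambda>_. 1" f A] by simp

text \<open>Successive differences are multiplied by \<open>1 - \<tau> G\<close>, so their squared
  norm shrinks at least by the factor
  \<open>1 - 2 \<tau> \<epsilon> + \<tau>\<^sup>2 \<Lambda>\<close>. The choice
  \<open>\<tau> = \<epsilon> / \<Lambda>\<close> minimizes it. The summand
  \<open>\<epsilon>\<^sup>2\<close> in \<open>\<Lambda>\<close> keeps \<open>\<Lambda>\<close>
  positive and the resulting factor \<open>1 - \<epsilon>\<^sup>2 / \<Lambda>\<close>
  nonnegative.\<close>

lemma richardson_converges:
  assumes J: "finite J" and \<epsilon>: "\<epsilon> > 0"
    and coercive: "\<And>v :: int \<Rightarrow> real. \<epsilon> * (\<Sum>k\<in>J. (v k)\<^sup>2) \<le> (\<Sum>k\<in>J. v k * (\<Sum>l\<in>J. G k l * v l))"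
    and B: "\<And>k l. k \<in> J \<Longrightarrow> l \<in> J \<Longrightarrow> \<bar>G k l\<bar> \<le> B"
    and \<Lambda>: "\<Lambda> = B\<^sup>2 * (real (card J))\<^sup>2 + \<epsilon>\<^sup>2" and \<tau>: "\<tau> = \<epsilon> / \<Lambda>"
  shows "\<exists>w. \<forall>k\<in>J. (\<lambda>n. richardson G J \<tau> b n k) \<longlonglongrightarrow> w k \<and> (\<Sum>l\<in>J. G k l * w l) = b k"
proof -
  define N where "N v = (\<Sum>k\<in>J. (v k)\<^sup>2)" for v :: "int \<Rightarrow> real"
  define r where "r = richardson G J \<tau> b"
  define e where "e n k = r (Suc n) k - r n k" for n k
  define \<rho> where "\<rho> = 1 - \<epsilon>\<^sup>2 / \<Lambda>"
  have \<Lambda>0: "\<Lambda> > 0" "\<epsilon>\<^sup>2 \<le> \<Lambda>" using \<epsilon> by (auto simp: \<Lambda> add_nonneg_pos)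
  have \<tau>0: "\<tau> > 0" using \<epsilon> \<Lambda>0 by (simp add: \<tau>)
  have \<rho>: "0 \<le> \<rho>" "\<rho> < 1" using \<epsilon> \<Lambda>0 by (auto simp: \<rho>_def)
  have NG: "N (\<lambda>k. \<Sum>l\<in>J. G k l * v l) \<le> \<Lambda> * N v" for v
  proof -
    have "(\<Sum>l\<in>J. G k l * v l)\<^sup>2 \<le> card J * (B\<^sup>2 * N v)" if k: "k \<in> J" for k
    proof -
      have "(\<Sum>l\<in>J. (G k l * v l)\<^sup>2) \<le> (\<Sum>l\<in>J. B\<^sup>2 * (v l)\<^sup>2)"
        unfolding power_mult_distrib using B[OF k]
        by (intro sum_mono mult_right_mono) (auto intro: power2_le_iff_abs_le[THEN iffD2] simp: abs_le_square_iff[symmetric] intro!: order_trans[OF _ abs_ge_self])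
      then show ?thesis
        by (intro order_trans[OF sum_square_le_card[OF J]] mult_left_mono) (auto simp: N_def sum_distrib_left)
    qed
    then have "N (\<lambda>k. \<Sum>l\<in>J. G k l * v l) \<le> (\<Sum>k\<in>J. card J * (B\<^sup>2 * N v))" unfolding N_def by (intro sum_mono)
    also have "\<dots> = B\<^sup>2 * (real (card J))\<^sup>2 * N v" by (simp add: power2_eq_square)
    also have "\<dots> \<le> \<Lambda> * N v" by (intro mult_right_mono) (auto simp: \<Lambda> N_def sum_nonneg)
    finally show ?thesis .
  qed
  have e_Suc: "e (Suc n) k = e n k - \<tau> * (\<Sum>l\<in>J. G k l * e n l)" for n k
  proof -
    have r_Suc: "r (Suc n) k = r n k + \<tau> * (b k - (\<Sum>l\<in>J. G k l * r n l))" for n by (simp add: r_def)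
    show ?thesis unfolding e_def r_Suc[of "Suc n"] by (simp add: r_Suc right_diff_distrib sum_subtractf)
  qed
  have N_Suc: "N (e (Suc n)) \<le> \<rho> * N (e n)" for n
  proof -
    let ?v = "e n" and ?g = "\<lambda>k. \<Sum>l\<in>J. G k l * e n l"
    have "N (e (Suc n)) = N ?v - 2 * \<tau> * (\<Sum>k\<in>J. ?v k * ?g k) + \<tau>\<^sup>2 * N ?g"
    proof -
      have sq: "(x - \<tau> * y)\<^sup>2 = x\<^sup>2 - 2 * \<tau> * (x * y) + \<tau>\<^sup>2 * y\<^sup>2" for x y :: real
        by (simp add: power2_eq_square algebra_simps)
      show ?thesis
        by (simp only: N_def e_Suc sq sum.distrib sum_subtractf sum_distrib_left[symmetric])
    qed
    also have "\<dots> \<le> N ?v - 2 * \<tau> * (\<epsilon> * N ?v) + \<tau>\<^sup>2 * (\<Lambda> * N ?v)"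
      using coercive[of ?v] NG[of ?v] \<tau>0 unfolding N_def[symmetric] by (intro add_mono diff_mono mult_left_mono) auto
    also have "\<dots> = \<rho> * N ?v"
      using \<Lambda>0 by (simp add: \<rho>_def \<tau> field_simps power2_eq_square)
    finally show ?thesis .
  qed
  have N_le: "N (e n) \<le> \<rho> ^ n * N (e 0)" for n
  proof (induction n)
    case (Suc n)
    have "N (e (Suc n)) \<le> \<rho> * (\<rho> ^ n * N (e 0))"
      using order_trans[OF N_Suc mult_left_mono[OF Suc \<rho>(1)]] .
    then show ?case by simp
  qed simp
  have e_le: "\<bar>e n k\<bar> \<le> sqrt (N (e 0)) * sqrt \<rho> ^ n" if "k \<in> J" for n k
  proof -
    have "(e n k)\<^sup>2 \<le> N (e n)" unfolding N_def by (rule member_le_sum) (use that J in auto)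
    then have "sqrt ((e n k)\<^sup>2) \<le> sqrt (\<rho> ^ n * N (e 0))" using N_le[of n] by (intro real_sqrt_le_mono) linarith
    then have "\<bar>e n k\<bar> \<le> sqrt (\<rho> ^ n * N (e 0))" by simp
    then show ?thesis by (simp add: real_sqrt_mult real_sqrt_power mult.commute)
  qed
  have sum: "summable (\<lambda>n. e n k)" if "k \<in> J" for k
  proof (rule summable_comparison_test')
    show "summable (\<lambda>n. sqrt (N (e 0)) * sqrt \<rho> ^ n)" using \<rho> by (intro summable_mult summable_geometric) auto
    show "norm (e n k) \<le> sqrt (N (e 0)) * sqrt \<rho> ^ n" if "n \<ge> 0" for n using e_le[OF \<open>k \<in> J\<close>] by simp
  qed
  have r_sum: "r n k = (\<Sum>j<n. e j k)" for n k
    using sum_lessThan_telescope[of "\<lambda>j. r j k" n] by (simp add: e_def r_def del: richardson.simps(2))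
  define w where "w k = suminf (\<lambda>n. e n k)" for k
  have lim: "(\<lambda>n. r n k) \<longlonglongrightarrow> w k" if "k \<in> J" for k
    unfolding r_sum w_def using summable_LIMSEQ[OF sum[OF that]] .
  have "(\<Sum>l\<in>J. G k l * w l) = b k" if k: "k \<in> J" for k
  proof -
    have "(\<lambda>n. \<tau> * (b k - (\<Sum>l\<in>J. G k l * r n l))) \<longlonglongrightarrow> \<tau> * (b k - (\<Sum>l\<in>J. G k l * w l))"
      by (intro tendsto_intros lim)
    moreover have "(\<lambda>n. e n k) \<longlonglongrightarrow> 0" by (rule summable_LIMSEQ_zero[OF sum[OF k]])
    then have "(\<lambda>n. \<tau> * (b k - (\<Sum>l\<in>J. G k l * r n l))) \<longlonglongrightarrow> 0" by (simp add: e_def r_def)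
    ultimately have "\<tau> * (b k - (\<Sum>l\<in>J. G k l * w l)) = 0" by (rule LIMSEQ_unique)
    then show ?thesis using \<tau>0 by simp
  qed
  with lim show ?thesis unfolding r_def by blast
qed

lemma bounded_family_convergent_subsequence:
  fixes c :: "nat \<Rightarrow> 'a \<Rightarrow> real"
  assumes "finite A" and "\<And>n a. a \<in> A \<Longrightarrow> \<bar>c n a\<bar> \<le> B"
  shows "\<exists>r l. strict_mono r \<and> (\<forall>a\<in>A. (\<lambda>n. c (r n) a) \<longlonglongrightarrow> l a)"
  using assms
proof (induction A)
  case empty
  show ?case by (rule exI[of _ "\<lambda>n. n"]) (auto simp: strict_mono_def)
next
  case (insert a A)
  have "\<exists>r l. strict_mono r \<and> (\<forall>a\<in>A. (\<lambda>n. c (r n) a) \<longlonglongrightarrow> l a)"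
    by (rule insert.IH) (use insert.prems in auto)
  then obtain r l where r: "strict_mono r" "\<And>x. x \<in> A \<Longrightarrow> (\<lambda>n. c (r n) x) \<longlonglongrightarrow> l x" by blast
  have "seq_compact {- B..B}" by (simp add: compact_eq_seq_compact_metric[symmetric])
  moreover have "\<forall>n. c (r n) a \<in> {- B..B}" using insert.prems[of a] by (auto simp: abs_le_iff minus_le_iff)
  ultimately obtain y s where s: "strict_mono (s :: nat \<Rightarrow> nat)" "((\<lambda>n. c (r n) a) \<circ> s) \<longlonglongrightarrow> y"
    by (elim seq_compactE) auto
  have "(\<lambda>n. c ((r \<circ> s) n) x) \<longlonglongrightarrow> (l(a := y)) x" if "x \<in> insert a A" for x
  proof (cases "x = a")
    case True
    then show ?thesis using s(2) by (simp add: o_def)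
  next
    case False
    then show ?thesis using LIMSEQ_subseq_LIMSEQ[OF r(2)[of x] s(1)] that by (simp add: o_def)
  qed
  moreover have "strict_mono (r \<circ> s)" using r(1) s(1) by (rule strict_mono_o)
  ultimately show ?case by blast
qed

section \<open>The compactly supported dual window on the real line\<close>

locale tp_window =
  fixes g :: "real \<Rightarrow> real" and m :: nat and C :: real and \<delta> :: "nat \<Rightarrow> real" and \<alpha> \<beta> :: real and L :: nat
  assumes tp: "tp_finite_type g m C \<delta>" and cont: "continuous_on UNIV g" and m2: "m \<ge> 2"
    and \<alpha>_pos: "\<alpha> > 0" and \<beta>_pos: "\<beta> > 0" and \<alpha>\<beta>: "\<alpha> * \<beta> < 1"
begin

abbreviation (input) "\<kappa> \<equiv> 1 / \<beta>"
abbreviation (input) "p \<equiv> tp_p m \<delta>"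
abbreviation (input) "q \<equiv> tp_q m \<delta>"
abbreviation (input) "k1 \<equiv> alg_k1 p \<alpha> \<beta> L"
abbreviation (input) "k2 \<equiv> alg_k2 q \<alpha> \<beta> L"
abbreviation (input) "J \<equiv> {k1..k2}"

text \<open>The interval from which the algorithm takes its samples; \<open>W x = {i\<^sub>1..i\<^sub>2}\<close> (lemma \<open>W_eq\<close>).\<close>
definition win :: "real \<Rightarrow> bool" where
  "win s \<longleftrightarrow> \<kappa> * (k1 + int p - 1) < s \<and> s < \<kappa> * (k2 - int q + 1)"

definition W :: "real \<Rightarrow> int set" where "W x = {i. win (x + \<alpha> * of_int i)}"

lemma C_pos: "C > 0" and \<delta>_nonzero: "k \<le> m - 1 \<Longrightarrow> \<delta> k \<noteq> 0"
  using tp m2 by (auto simp: tp_finite_type_def)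

lemma g_eq: "g x = C * gk \<delta> (m - 1) x"
  by (rule tp_finite_type_eq_gk[OF tp cont m2])

lemma g_decay: "exp_decay g"
proof -
  have "exp_decay (gk \<delta> (m - 1))" by (rule gk_decay) (rule \<delta>_nonzero)
  then obtain B c where c: "c > 0" "\<And>x. \<bar>gk \<delta> (m - 1) x\<bar> \<le> B * exp (- c * \<bar>x\<bar>)" by (auto simp: exp_decay_def)
  have "\<bar>g x\<bar> \<le> C * B * exp (- c * \<bar>x\<bar>)" for x
    using mult_left_mono[OF c(2)[of x], of C] C_pos by (simp add: g_eq abs_mult mult.assoc)
  then show ?thesis unfolding exp_decay_def
    using c(1) cont by (blast intro: borel_measurable_continuous_onI)
qed

lemma p_eq: "p = card {i. i \<le> m - 1 \<and> \<delta> i > 0}" and q_eq: "q = card {i. i \<le> m - 1 \<and> \<delta> i < 0}"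
proof -
  have "i < m \<longleftrightarrow> i \<le> m - 1" for i using m2 by auto
  then show "p = card {i. i \<le> m - 1 \<and> \<delta> i > 0}" "q = card {i. i \<le> m - 1 \<and> \<delta> i < 0}"
    by (simp_all add: tp_p_def tp_q_def)
qed

lemma pq: "p + q = m"
proof -
  have "\<delta> k > 0 \<or> \<delta> k < 0" if "k < m" for k using tp that by (auto simp: tp_finite_type_def)
  then have "{k. k < m \<and> \<delta> k > 0} \<union> {k. k < m \<and> \<delta> k < 0} = {..<m}" by auto
  moreover have "card ({k. k < m \<and> \<delta> k > 0} \<union> {k. k < m \<and> \<delta> k < 0}) = p + q"
    unfolding tp_p_def tp_q_def by (rule card_Un_disjoint) auto
  ultimately show ?thesis by simp
qed

lemma r_ge: "alg_r \<alpha> \<beta> \<ge> 1" and r_gt: "real_of_int (alg_r \<alpha> \<beta>) * (1 - \<alpha> * \<beta>) > \<alpha> * \<beta>"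
proof -
  have ab: "0 < 1 - \<alpha> * \<beta>" "1 - \<alpha> * \<beta> < 1" using \<alpha>\<beta> \<alpha>_pos \<beta>_pos by auto
  then have "1 \<le> 1 / (1 - \<alpha> * \<beta>)" by simp
  then show "alg_r \<alpha> \<beta> \<ge> 1" by (simp add: alg_r_def le_floor_iff)
  have "1 / (1 - \<alpha> * \<beta>) < real_of_int (alg_r \<alpha> \<beta>) + 1" unfolding alg_r_def by linarith
  then have "1 < (real_of_int (alg_r \<alpha> \<beta>) + 1) * (1 - \<alpha> * \<beta>)" using ab by (simp add: divide_less_eq)
  then show "real_of_int (alg_r \<alpha> \<beta>) * (1 - \<alpha> * \<beta>) > \<alpha> * \<beta>" by (simp add: algebra_simps)
qed

lemma k1_le: "k1 + int p \<le> 0" and k2_ge: "k2 - int q \<ge> 0"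
  using r_ge mult_right_mono[of 1 "alg_r \<alpha> \<beta>" "int p"] mult_right_mono[of 1 "alg_r \<alpha> \<beta>" "int q"]
  by (auto simp: alg_k1_def alg_k2_def algebra_simps)

lemma zero_in_J: "0 \<in> J" using k1_le k2_ge by auto

text \<open>The window is \<open>U\<close> cells long and contains at least
  \<open>U / (\<alpha> * \<beta>) - 1\<close> samples, against \<open>U + m - 1\<close>
  coefficients. It suffices that
  \<open>U * (1 - \<alpha> * \<beta>) > m * (\<alpha> * \<beta>)\<close>; the part
  \<open>r * m\<close> of \<open>U\<close> achieves this by \<open>r_gt\<close>, and
  \<open>L\<close> only enlarges the surplus.\<close>

lemma dense: "(k2 - k1 - int (m - 1) + 1) * \<kappa> / \<alpha> - 1 > k2 - k1"
proof -
  define r where "r = real_of_int (alg_r \<alpha> \<beta>)"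
  have mp: "real p + real q = real m" using pq by linarith
  have k21: "real_of_int (k2 - k1) = (r + 1) * m + 2 * L"
    by (simp add: alg_k1_def alg_k2_def r_def mp[symmetric] algebra_simps)
  have m': "real_of_int (int (m - 1)) = real m - 1" using m2 by (simp add: of_nat_diff)
  define U where "U = r * m + 2 * L + 2"
  have ab: "0 < \<alpha> * \<beta>" "\<alpha> * \<beta> < 1" using \<alpha>\<beta> \<alpha>_pos \<beta>_pos by auto
  have "(U + m) * (\<alpha> * \<beta>) < U"
  proof -
    have "m * (\<alpha> * \<beta>) < m * (r * (1 - \<alpha> * \<beta>))" using r_gt m2 by (intro mult_strict_left_mono) (auto simp: r_def)
    also have "\<dots> \<le> U * (1 - \<alpha> * \<beta>)"
    proof -
      have "0 \<le> (2 * real L + 2) * (1 - \<alpha> * \<beta>)" using ab by simp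
      then show ?thesis by (simp add: U_def algebra_simps)
    qed
    finally show ?thesis by (simp add: algebra_simps)
  qed
  then have "U + m < U / (\<alpha> * \<beta>)" using ab by (simp add: pos_less_divide_eq)
  moreover have "(k2 - k1 - int (m - 1) + 1) * \<kappa> / \<alpha> = U / (\<alpha> * \<beta>)"
  proof -
    have "real_of_int (k2 - k1 - int (m - 1) + 1) = U"
      unfolding of_int_add of_int_diff[of "k2 - k1"] k21 m' by (simp add: U_def algebra_simps)
    then show ?thesis by (simp add: mult.commute)
  qed
  ultimately show ?thesis unfolding k21 by (simp add: U_def algebra_simps)
qed

text \<open>The claim covers every real \<open>x\<close>, because the limit of base points in
  \<open>uniform_coercive\<close> may be \<alpha> itself.\<close>

lemma samples_injective:
  fixes c :: "int \<Rightarrow> real"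
  assumes "\<And>i. i \<in> W x \<Longrightarrow> (\<Sum>k\<in>J. g (x + \<alpha> * of_int i - of_int k * \<kappa>) * c k) = 0" and "k \<in> J"
  shows "c k = 0"
proof -
  interpret exp_spline \<delta> "m - 1" \<kappa> k1 k2 c
    by unfold_locales (use \<delta>_nonzero m2 \<beta>_pos k1_le k2_ge in auto)
  show ?thesis
  proof (rule vanishing_samples_imp_zero[OF \<alpha>_pos _ p_eq q_eq _ _ assms(2), of x])
    show "\<alpha> < \<kappa>" using \<alpha>\<beta> \<beta>_pos by (simp add: field_simps)
    show "(k2 - k1 - int (m - 1) + 1) * \<kappa> / \<alpha> - 1 > k2 - k1" by (rule dense)
    fix i :: int
    assume "\<kappa> * (k1 + int p - 1) < x + \<alpha> * i" "x + \<alpha> * i < \<kappa> * (k2 - int q + 1)"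
    then have "i \<in> W x" by (simp add: W_def win_def)
    from assms(1)[OF this] have "C * f (m - 1) (x + \<alpha> * i) = 0"
      by (simp add: f_def g_eq sum_distrib_left mult.commute mult.left_commute)
    then show "f (m - 1) (x + \<alpha> * i) = 0" using C_pos by simp
  qed
qed

lemma W_eq: "W x = {alg_i1 p \<alpha> \<beta> L x..alg_i2 q \<alpha> \<beta> L x}"
proof -
  have "(\<kappa> * z - x) / \<alpha> = z / (\<alpha> * \<beta>) - x / \<alpha>" for z :: real
    using \<alpha>_pos \<beta>_pos by (simp add: field_simps)
  note eq = this
  show ?thesis
    unfolding W_def win_def lattice_count(1)[OF \<alpha>_pos] alg_i1_def alg_i2_def eq by simp
qed

lemma finite_W: "finite (W x)" by (simp add: W_eq)

section \<open>Uniform positivity of the Gram matrices\<close>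

definition Gram :: "real \<Rightarrow> int \<Rightarrow> int \<Rightarrow> real" where
  "Gram x k l = (\<Sum>i\<in>W x. g (x + \<alpha> * of_int i - of_int k * \<kappa>) * g (x + \<alpha> * of_int i - of_int l * \<kappa>))"

lemma W_bound: "\<exists>N. \<forall>x\<in>{0..<\<alpha>}. W x \<subseteq> {- N..N}"
proof -
  define A where "A = \<bar>\<kappa> * (k1 + int p - 1)\<bar> + \<bar>\<kappa> * (k2 - int q + 1)\<bar> + \<alpha>"
  have "i \<in> {- \<lceil>A / \<alpha>\<rceil>..\<lceil>A / \<alpha>\<rceil>}" if "x \<in> {0..<\<alpha>}" "i \<in> W x" for x i
  proof -
    have "\<bar>x + \<alpha> * of_int i\<bar> \<le> \<bar>\<kappa> * (k1 + int p - 1)\<bar> + \<bar>\<kappa> * (k2 - int q + 1)\<bar>"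
      using that(2) unfolding W_def win_def mem_Collect_eq by linarith
    then have "\<bar>\<alpha> * of_int i\<bar> \<le> A" using that(1) unfolding A_def atLeastLessThan_iff by linarith
    then have "\<bar>of_int i\<bar> \<le> A / \<alpha>" using \<alpha>_pos by (simp add: abs_mult field_simps)
    then show ?thesis unfolding atLeastAtMost_iff by linarith
  qed
  then show ?thesis by blast
qed

lemma Gram_quadratic:
  fixes v :: "int \<Rightarrow> real"
  shows
  "(\<Sum>k\<in>J. v k * (\<Sum>l\<in>J. Gram x k l * v l)) = (\<Sum>i\<in>W x. (\<Sum>k\<in>J. g (x + \<alpha> * of_int i - of_int k * \<kappa>) * v k)\<^sup>2)"
proof -
  let ?P = "\<lambda>i k. g (x + \<alpha> * of_int i - of_int k * \<kappa>)"
  have "(\<Sum>i\<in>W x. (\<Sum>k\<in>J. ?P i k * v k)\<^sup>2) = (\<Sum>i\<in>W x. \<Sum>k\<in>J. \<Sum>l\<in>J. v k * (?P i k * ?P i l * v l))"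
    by (simp add: power2_eq_square sum_product ac_simps)
  also have "\<dots> = (\<Sum>k\<in>J. \<Sum>l\<in>J. \<Sum>i\<in>W x. v k * (?P i k * ?P i l * v l))"
    by (subst sum.swap, rule sum.cong[OF refl], subst sum.swap, rule refl)
  also have "\<dots> = (\<Sum>k\<in>J. v k * (\<Sum>l\<in>J. Gram x k l * v l))"
    by (simp add: Gram_def sum_distrib_left sum_distrib_right)
  finally show ?thesis by simp
qed

text \<open>If it failed, almost annihilated unit vectors would converge, along with their base
  points, to a unit vector annihilated by all samples at the limit point. The Gram matrix is not
  continuous in the base point, as \<open>W\<close> jumps. But the window is open, so every index of
  the limit eventually belongs to the sequence, and no sample of the limit is missed.\<close>

lemma uniform_coercive:
  "\<exists>\<epsilon>>0. \<forall>x\<in>{0..<\<alpha>}. \<forall>v :: int \<Rightarrow> real. \<epsilon> * (\<Sum>k\<in>J. (v k)\<^sup>2) \<le> (\<Sum>k\<in>J. v k * (\<Sum>l\<in>J. Gram x k l * v l))"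
proof (rule ccontr)
  assume no: "\<not> ?thesis"
  let ?N = "\<lambda>v :: int \<Rightarrow> real. \<Sum>k\<in>J. (v k)\<^sup>2" and ?S = "\<lambda>x v i. \<Sum>k\<in>J. g (x + \<alpha> * of_int i - of_int k * \<kappa>) * v k"
  define small where "small n x v \<longleftrightarrow> x \<in> {0..<\<alpha>} \<and> ?N v = 1 \<and> (\<Sum>i\<in>W x. (?S x v i)\<^sup>2) \<le> 1 / Suc n"
    for n x and v :: "int \<Rightarrow> real"
  have "\<exists>x v. small n x v" for n
  proof -
    have "0 < 1 / real (Suc n)" by simp
    with no obtain x and v :: "int \<Rightarrow> real" where x: "x \<in> {0..<\<alpha>}"
      and "\<not> 1 / Suc n * ?N v \<le> (\<Sum>k\<in>J. v k * (\<Sum>l\<in>J. Gram x k l * v l))" by blast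
    then have lt: "(\<Sum>i\<in>W x. (?S x v i)\<^sup>2) < 1 / Suc n * ?N v" by (simp only: Gram_quadratic not_le)
    have N: "?N v > 0"
    proof -
      have "0 \<le> (\<Sum>i\<in>W x. (?S x v i)\<^sup>2)" by (rule sum_nonneg) auto
      with lt have "0 < 1 / Suc n * ?N v" by linarith
      then show ?thesis by (simp add: zero_less_mult_iff zero_less_divide_iff)
    qed
    define s where "s = 1 / sqrt (?N v)"
    have s2: "s\<^sup>2 = 1 / ?N v" using N by (simp add: s_def power_divide)
    have "?N (\<lambda>k. s * v k) = s\<^sup>2 * ?N v" by (simp add: power_mult_distrib sum_distrib_left)
    then have 1: "?N (\<lambda>k. s * v k) = 1" using N by (simp add: s2)
    have Ss: "?S x (\<lambda>k. s * v k) i = s * ?S x v i" for i by (simp add: sum_distrib_left mult.left_commute)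
    have "(\<Sum>i\<in>W x. (?S x (\<lambda>k. s * v k) i)\<^sup>2) = s\<^sup>2 * (\<Sum>i\<in>W x. (?S x v i)\<^sup>2)"
      by (simp only: Ss power_mult_distrib sum_distrib_left[symmetric])
    also have "\<dots> \<le> s\<^sup>2 * (1 / Suc n * ?N v)" using lt by (intro mult_left_mono) auto
    also have "\<dots> = 1 / Suc n" using N by (simp add: s2)
    finally have "small n x (\<lambda>k. s * v k)" using 1 x unfolding small_def by (intro conjI)
    then show ?thesis by blast
  qed
  then obtain x v where xv: "\<And>n. small n (x n) (v n)" by metis
  then have x: "\<And>n. x n \<in> {0..<\<alpha>}" and N: "\<And>n. ?N (v n) = 1"
    and S: "\<And>n. (\<Sum>i\<in>W (x n). (?S (x n) (v n) i)\<^sup>2) \<le> 1 / Suc n"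
    unfolding small_def by blast+
  have vb: "\<bar>v n k\<bar> \<le> 1" if "k \<in> J" for n k
  proof -
    have "(v n k)\<^sup>2 \<le> ?N (v n)" by (rule member_le_sum) (use that in auto)
    then show ?thesis unfolding N by (simp add: abs_square_le_1)
  qed
  \<comment> \<open>The base point (\<open>None\<close>) and the vector components
    (\<open>Some k\<close>) form one finite family, so a single subsequence serves all of
    them.\<close>
  define c where "c n a = (case a of None \<Rightarrow> x n | Some k \<Rightarrow> v n k)" for n a
  have "\<bar>c n a\<bar> \<le> max 1 \<alpha>" if "a \<in> insert None (Some ` J)" for n a
    using that x[of n] vb[of _ n] by (auto simp: c_def le_max_iff_disj)
  then have "\<exists>r l. strict_mono r \<and> (\<forall>a\<in>insert None (Some ` J). (\<lambda>n. c (r n) a) \<longlonglongrightarrow> l a)"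
    by (intro bounded_family_convergent_subsequence) simp_all
  then obtain r l where r: "strict_mono r" and l: "\<And>a. a \<in> insert None (Some ` J) \<Longrightarrow> (\<lambda>n. c (r n) a) \<longlonglongrightarrow> l a"
    by blast
  define y u where "y = l None" and "u k = l (Some k)" for k
  have y: "(\<lambda>n. x (r n)) \<longlonglongrightarrow> y" using l[of None] by (simp add: c_def y_def)
  have u: "(\<lambda>n. v (r n) k) \<longlonglongrightarrow> u k" if "k \<in> J" for k using l[of "Some k"] that by (simp add: c_def u_def)
  have "u k = 0" if "k \<in> J" for k
  proof (rule samples_injective[OF _ that])
    fix i assume i: "i \<in> W y"
    have lim: "(\<lambda>n. ?S (x (r n)) (v (r n)) i) \<longlonglongrightarrow> ?S y u i"
      using cont u y by (intro tendsto_sum tendsto_mult continuous_on_tendsto_compose[OF cont] tendsto_intros) auto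
    have "\<forall>\<^sub>F n in sequentially. i \<in> W (x (r n))"
    proof -
      have "(\<lambda>n. x (r n) + \<alpha> * of_int i) \<longlonglongrightarrow> y + \<alpha> * of_int i" by (intro tendsto_intros y)
      then show ?thesis using i unfolding W_def win_def mem_Collect_eq
        by (intro eventually_conj) (auto elim: order_tendstoD)
    qed
    then have "\<forall>\<^sub>F n in sequentially. (?S (x (r n)) (v (r n)) i)\<^sup>2 \<le> 1 / Suc (r n)"
    proof eventually_elim
      case (elim n)
      have "(?S (x (r n)) (v (r n)) i)\<^sup>2 \<le> (\<Sum>i\<in>W (x (r n)). (?S (x (r n)) (v (r n)) i)\<^sup>2)"
        by (rule member_le_sum[OF elim]) (auto simp: finite_W)
      with S[of "r n"] show ?case by linarith
    qed
    moreover have "(\<lambda>n. 1 / real (Suc (r n))) \<longlonglongrightarrow> 0"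
      using LIMSEQ_subseq_LIMSEQ[OF LIMSEQ_inverse_real_of_nat r] by (simp add: o_def inverse_eq_divide)
    ultimately have "(?S y u i)\<^sup>2 \<le> 0"
      by (intro tendsto_le[OF sequentially_bot _ tendsto_power[OF lim]]) auto
    then show "?S y u i = 0" by simp
  qed
  moreover have "(\<lambda>n. ?N (v (r n))) \<longlonglongrightarrow> ?N u" by (intro tendsto_sum tendsto_power u)
  then have "?N u = 1" using N LIMSEQ_unique[OF tendsto_const] by fastforce
  ultimately show False by simp
qed

section \<open>Measurable dependence on the base point and the window \<gamma>\<close>

definition rem :: "real \<Rightarrow> real" where "rem t = t - \<alpha> * of_int \<lfloor>t / \<alpha>\<rfloor>"

lemma rem_range: "rem t \<in> {0..<\<alpha>}"
  using \<alpha>_pos floor_divide_lower[of \<alpha> t] floor_divide_upper[of \<alpha> t] by (auto simp: rem_def algebra_simps)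

lemma rem_shift: "rem (t + \<alpha> * of_int i) = rem t"
proof -
  have "(t + \<alpha> * of_int i) / \<alpha> = t / \<alpha> + of_int i" using \<alpha>_pos by (simp add: field_simps)
  then show ?thesis by (simp add: rem_def algebra_simps)
qed

lemma rem_measurable [measurable]: "rem \<in> borel_measurable borel"
  unfolding rem_def[abs_def] by measurable

lemma g_measurable [measurable]: "g \<in> borel_measurable borel"
  using cont by (rule borel_measurable_continuous_onI)

lemma Gram_sym: "Gram x k l = Gram x l k"
  by (simp add: Gram_def mult.commute)

text \<open>The bounds \<open>\<epsilon>\<close> and \<open>B\<close> are uniform, so one step size
  \<open>\<tau>\<close> serves all base points. Every iterate is then a measurable function of
  \<open>t\<close>, and so is the limit.\<close>

lemma gram_inverse:
  "\<exists>w K. \<forall>k\<in>J. (\<forall>l\<in>J. (\<lambda>t. w k (rem t) l) \<in> borel_measurable borel) \<and>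
     (\<forall>x\<in>{0..<\<alpha>}. \<forall>l\<in>J. \<bar>w k x l\<bar> \<le> K \<and> (\<Sum>l'\<in>J. Gram x l l' * w k x l') = (if l = k then 1 else (0::real)))"
proof -
  obtain \<epsilon> where \<epsilon>: "\<epsilon> > 0" and co: "\<And>x v. x \<in> {0..<\<alpha>} \<Longrightarrow>
      \<epsilon> * (\<Sum>k\<in>J. (v k :: real)\<^sup>2) \<le> (\<Sum>k\<in>J. v k * (\<Sum>l\<in>J. Gram x k l * v l))"
    using uniform_coercive by blast
  obtain N where N: "\<And>x. x \<in> {0..<\<alpha>} \<Longrightarrow> W x \<subseteq> {- N..N}" using W_bound by blast
  obtain Bg where Bg: "\<And>x. \<bar>g x\<bar> \<le> Bg" using exp_decay_bounded[OF g_decay] by blast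
  have Bg0: "Bg \<ge> 0" using Bg[of 0] by linarith
  define B where "B = real (card {- N..N}) * (Bg * Bg)"
  have B: "\<bar>Gram x k l\<bar> \<le> B" if "x \<in> {0..<\<alpha>}" for x k l
  proof -
    have "\<bar>Gram x k l\<bar> \<le> (\<Sum>i\<in>W x. Bg * Bg)" unfolding Gram_def
      by (rule order_trans[OF sum_abs sum_mono], subst abs_mult) (intro mult_mono Bg Bg0 abs_ge_zero)
    also have "\<dots> \<le> B" unfolding B_def sum_constant
      using card_mono[OF _ N[OF that]] Bg0 by (intro mult_right_mono) auto
    finally show ?thesis .
  qed
  define \<Lambda> where "\<Lambda> = B\<^sup>2 * (real (card J))\<^sup>2 + \<epsilon>\<^sup>2"
  define \<tau> where "\<tau> = \<epsilon> / \<Lambda>"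
  define e :: "int \<Rightarrow> int \<Rightarrow> real" where "e k l = (if l = k then 1 else 0)" for k l
  \<comment> \<open>Convergence of the iterates belongs to the chosen property, so on
    \<open>J\<close> the choice operator can only return their limit.\<close>
  define sol where "sol x k w \<longleftrightarrow> (\<forall>l\<in>J. (\<lambda>n. richardson (Gram x) J \<tau> (e k) n l) \<longlonglongrightarrow> w l \<and>
    (\<Sum>l'\<in>J. Gram x l l' * w l') = e k l)" for x k w
  define w where "w x k = (SOME w. sol x k w)" for x k
  have "sol x k (w x k)" if "x \<in> {0..<\<alpha>}" for x k
    unfolding w_def
  proof (rule someI_ex[of "sol x k"])
    show "\<exists>w. sol x k w" unfolding sol_def
      by (rule richardson_converges[OF _ \<epsilon> co[OF that] B[OF that] \<Lambda>_def \<tau>_def]) simp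
  qed
  then have w: "\<And>x k l. x \<in> {0..<\<alpha>} \<Longrightarrow> l \<in> J \<Longrightarrow> (\<lambda>n. richardson (Gram x) J \<tau> (e k) n l) \<longlonglongrightarrow> w x k l"
    and Gw: "\<And>x k l. x \<in> {0..<\<alpha>} \<Longrightarrow> l \<in> J \<Longrightarrow> (\<Sum>l'\<in>J. Gram x l l' * w x k l') = e k l"
    unfolding sol_def by blast+
  \<comment> \<open>The index set depends on \<open>t\<close>. A fixed range of indices with the
    window as a condition on each summand removes this dependence.\<close>
  have Gm: "(\<lambda>t. Gram (rem t) k l) \<in> borel_measurable borel" for k l
  proof -
    have "Gram (rem t) k l = (\<Sum>i\<in>{- N..N}. if win (rem t + \<alpha> * of_int i)
        then g (rem t + \<alpha> * of_int i - of_int k * \<kappa>) * g (rem t + \<alpha> * of_int i - of_int l * \<kappa>) else 0)" for t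
      unfolding Gram_def using N[OF rem_range, of t]
      by (intro sum.mono_neutral_cong_left) (auto simp: W_def)
    moreover have "(\<lambda>t. \<Sum>i\<in>{- N..N}. if win (rem t + \<alpha> * of_int i)
        then g (rem t + \<alpha> * of_int i - of_int k * \<kappa>) * g (rem t + \<alpha> * of_int i - of_int l * \<kappa>) else 0) \<in> borel_measurable borel"
      unfolding win_def by measurable
    ultimately show ?thesis by simp
  qed
  have rm: "(\<lambda>t. richardson (Gram (rem t)) J \<tau> b n l) \<in> borel_measurable borel" for b n l
  proof (induction n arbitrary: l)
    case (Suc n)
    show ?case unfolding richardson.simps
      by (intro borel_measurable_add borel_measurable_times borel_measurable_diff borel_measurable_sum Suc Gm borel_measurable_const)
  qed simp
  \<comment> \<open>Coercivity applied to the solution itself gives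
    \<open>\<epsilon> * ?N \<le> w x k k\<close>, while the square of \<open>w x k k\<close> is at
    most \<open>?N\<close>; so the Euclidean norm is at most \<open>1 / \<epsilon>\<close>.\<close>
  have "\<bar>w x k l\<bar> \<le> 1 / \<epsilon>" if x: "x \<in> {0..<\<alpha>}" and kl: "k \<in> J" "l \<in> J" for x k l
  proof -
    let ?N = "\<Sum>l\<in>J. (w x k l)\<^sup>2"
    have le: "(w x k l)\<^sup>2 \<le> ?N" if "l \<in> J" for l by (rule member_le_sum) (use that in auto)
    have "\<epsilon> * ?N \<le> (\<Sum>l\<in>J. w x k l * (\<Sum>l'\<in>J. Gram x l l' * w x k l'))" by (rule co[OF x])
    also have "\<dots> = w x k k" using kl by (simp add: Gw[OF x] e_def mult_delta_right)
    finally have 1: "\<epsilon> * ?N \<le> w x k k" .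
    have "?N \<le> (1 / \<epsilon>)\<^sup>2"
    proof (cases "w x k k = 0")
      case True
      then have "?N \<le> 0" using 1 \<epsilon> by (simp add: mult_le_0_iff)
      then show ?thesis by (rule order_trans) simp
    next
      case False
      have "\<epsilon> * (w x k k)\<^sup>2 \<le> w x k k" using 1 mult_left_mono[OF le[OF kl(1)], of \<epsilon>] \<epsilon> by linarith
      moreover have "w x k k > 0" using False calculation \<epsilon> by (smt (verit) mult_nonneg_nonneg zero_le_power2)
      ultimately have "w x k k \<le> 1 / \<epsilon>" using \<epsilon> by (simp add: power2_eq_square field_simps)
      then have "\<epsilon> * ?N \<le> \<epsilon> * (1 / \<epsilon>)\<^sup>2" using 1 \<epsilon> by (simp add: power2_eq_square)
      then show ?thesis using \<epsilon> by simp
    qed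
    then have "(w x k l)\<^sup>2 \<le> (1 / \<epsilon>)\<^sup>2" using le[OF kl(2)] by linarith
    then show ?thesis using \<epsilon> by (simp add: abs_le_square_iff[symmetric])
  qed
  moreover have "(\<lambda>t. w (rem t) k l) \<in> borel_measurable borel" if "l \<in> J" for k l
    by (rule borel_measurable_LIMSEQ_real[OF w[OF rem_range that] rm])
  ultimately show ?thesis using Gw
    by (intro exI[of _ "\<lambda>k x. w x k"] exI[of _ "1 / \<epsilon>"]) (auto simp: e_def)
qed

abbreviation (input) \<gamma> :: "real \<Rightarrow> real" where "\<gamma> \<equiv> alg_gamma g p q \<alpha> \<beta> L"

text \<open>This is the form in which the algorithm is used later. The coefficients depend on
  \<open>t\<close> only through \<open>rem t\<close>, so the same ones occur at all points
  \<open>t + \<alpha> * i\<close> of a lattice. They are row 0 of the inverse Gram matrix.\<close>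

lemma gamma_eq:
  "\<exists>w K. (\<forall>l\<in>J. (\<lambda>t. w (rem t) l) \<in> borel_measurable borel \<and> (\<forall>t. \<bar>w (rem t) l\<bar> \<le> K)) \<and>
     (\<forall>t. \<forall>l\<in>J. (\<Sum>l'\<in>J. w (rem t) l' * Gram (rem t) l' l) = (if l = 0 then 1 else 0)) \<and>
     (\<forall>t. \<gamma> t = (if win t then \<beta> * (\<Sum>l\<in>J. w (rem t) l * g (t - of_int l * \<kappa>)) else 0))"
proof -
  obtain w K where w: "\<And>k l. k \<in> J \<Longrightarrow> l \<in> J \<Longrightarrow> (\<lambda>t. w k (rem t) l) \<in> borel_measurable borel"
    and K: "\<And>k l x. k \<in> J \<Longrightarrow> l \<in> J \<Longrightarrow> x \<in> {0..<\<alpha>} \<Longrightarrow> \<bar>w k x l\<bar> \<le> K"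
    and G: "\<And>k l x. k \<in> J \<Longrightarrow> l \<in> J \<Longrightarrow> x \<in> {0..<\<alpha>} \<Longrightarrow> (\<Sum>l'\<in>J. Gram x l l' * w k x l') = (if l = k then 1 else 0)"
    using gram_inverse by blast
  have "\<gamma> t = (if win t then \<beta> * (\<Sum>l\<in>J. w 0 (rem t) l * g (t - of_int l * \<kappa>)) else 0)" for t
  proof -
    let ?x = "rem t" and ?i = "\<lfloor>t / \<alpha>\<rfloor>"
    have t: "?x + \<alpha> * of_int ?i = t" by (simp add: rem_def)
    have win: "?i \<in> W ?x \<longleftrightarrow> win t" by (simp add: W_def t)
    have "pinv (W ?x) J (\<lambda>i k. g (?x + \<alpha> * of_int i - of_int k / \<beta>)) 0 ?i = (\<Sum>l\<in>J. w 0 ?x l * g (?x + \<alpha> * of_int ?i - of_int l / \<beta>))"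
      if "win t"
    proof (rule pinv_eq[where w = "\<lambda>k l. w k ?x l"])
      fix k k' assume k: "k \<in> J" "k' \<in> J"
      have "(\<Sum>l\<in>J. w k ?x l * (\<Sum>i\<in>W ?x. g (?x + \<alpha> * of_int i - of_int l / \<beta>) * g (?x + \<alpha> * of_int i - of_int k' / \<beta>)))
          = (\<Sum>l\<in>J. Gram ?x k' l * w k ?x l)"
        by (intro sum.cong refl) (simp add: Gram_def mult.commute)
      then show "(\<Sum>l\<in>J. w k ?x l * (\<Sum>i\<in>W ?x. g (?x + \<alpha> * of_int i - of_int l / \<beta>) * g (?x + \<alpha> * of_int i - of_int k' / \<beta>)))
          = (if k = k' then 1 else 0)" using G[OF k rem_range] by auto
    qed (use finite_W win that zero_in_J in auto)
    then show ?thesis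
      unfolding alg_gamma_def alg_gamma_at_def Let_def W_eq[symmetric] rem_def[symmetric] using win t by auto
  qed
  moreover have "(\<Sum>l'\<in>J. w 0 (rem t) l' * Gram (rem t) l' l) = (if l = 0 then 1 else 0)" if "l \<in> J" for t l
    using G[OF zero_in_J that rem_range, of t] by (simp add: Gram_sym mult.commute)
  ultimately show ?thesis using w[OF zero_in_J] K[OF zero_in_J _ rem_range]
    by (intro exI[of _ "w 0"] exI[of _ K]) auto
qed

text \<open>On the window \<open>\<bar>t\<bar> \<le> R\<close>, so that
  \<open>1 \<le> exp R * exp (- \<bar>t\<bar>)\<close> and the bound \<open>D\<close> becomes an
  exponential one. The rate 1 is an arbitrary choice.\<close>

lemma gamma_decay: "exp_decay \<gamma>"
proof -
  obtain w K where w: "\<And>l. l \<in> J \<Longrightarrow> (\<lambda>t. w (rem t) l) \<in> borel_measurable borel"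
    and K: "\<And>l t. l \<in> J \<Longrightarrow> \<bar>w (rem t) l\<bar> \<le> K"
    and \<gamma>: "\<And>t. \<gamma> t = (if win t then \<beta> * (\<Sum>l\<in>J. w (rem t) l * g (t - of_int l * \<kappa>)) else 0)"
    using gamma_eq by blast
  obtain Bg where Bg: "\<And>x. \<bar>g x\<bar> \<le> Bg" using exp_decay_bounded[OF g_decay] by blast
  have Bg0: "Bg \<ge> 0" using Bg[of 0] by linarith
  have K0: "K \<ge> 0" using K[OF zero_in_J, of 0] by linarith
  define D where "D = \<beta> * (card J * (K * Bg))"
  define R where "R = \<bar>\<kappa> * (k1 + int p - 1)\<bar> + \<bar>\<kappa> * (k2 - int q + 1)\<bar>"
  have "\<bar>\<gamma> t\<bar> \<le> (D * exp R) * exp (- 1 * \<bar>t\<bar>)" for t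
  proof (cases "win t")
    case True
    have "\<bar>\<Sum>l\<in>J. w (rem t) l * g (t - of_int l * \<kappa>)\<bar> \<le> (\<Sum>l\<in>J. K * Bg)"
      by (rule order_trans[OF sum_abs sum_mono], subst abs_mult) (intro mult_mono K Bg K0 abs_ge_zero)
    then have "\<bar>\<gamma> t\<bar> \<le> D" using True \<beta>_pos by (simp add: \<gamma> D_def abs_mult)
    moreover have "\<bar>t\<bar> \<le> R" using True unfolding win_def R_def by linarith
    then have "1 \<le> exp R * exp (- \<bar>t\<bar>)" by (simp flip: exp_add)
    moreover have "D \<ge> 0" using \<beta>_pos K0 Bg0 by (simp add: D_def)
    ultimately have "\<bar>\<gamma> t\<bar> \<le> D * (exp R * exp (- \<bar>t\<bar>))" using mult_left_mono[of 1 "exp R * exp (- \<bar>t\<bar>)" D] by linarith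
    then show ?thesis by (simp add: mult.assoc)
  next
    case False
    have "D \<ge> 0" using \<beta>_pos K0 Bg0 by (simp add: D_def)
    then show ?thesis using False by (simp add: \<gamma>)
  qed
  moreover have "\<gamma> \<in> borel_measurable borel"
  proof -
    have "(\<lambda>t. \<Sum>l\<in>J. w (rem t) l * g (t - of_int l * \<kappa>)) \<in> borel_measurable borel"
      by (intro borel_measurable_sum borel_measurable_times w) measurable
    then have [measurable]: "(\<lambda>t. \<beta> * (\<Sum>l\<in>J. w (rem t) l * g (t - of_int l * \<kappa>))) \<in> borel_measurable borel" by simp
    show ?thesis unfolding \<gamma>[abs_def] win_def by measurable
  qed
  ultimately show ?thesis unfolding exp_decay_def by (intro conjI exI[of _ "D * exp R"] exI[of _ 1]) auto
qed

section \<open>Biorthogonality to all integer shifts\<close>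

lemma g_recurrence:
  assumes "\<sigma> = 1 \<or> \<sigma> = -1" and "s = card {k. k \<le> m - 1 \<and> \<sigma> * \<delta> k < 0}"
  shows "\<exists>c. c s \<noteq> 0 \<and> (\<forall>x. \<sigma> * x < 0 \<longrightarrow> (\<Sum>l\<le>s. c l * g (x - \<sigma> * real l * \<kappa>)) = 0)"
proof -
  have "\<kappa> > 0" using \<beta>_pos by simp
  from gk_recurrence[of "m - 1" \<delta> \<sigma> \<kappa>, OF \<delta>_nonzero assms(1) this]
  obtain c where c: "c s \<noteq> 0" and rec: "\<And>x. \<sigma> * x < 0 \<Longrightarrow> (\<Sum>l\<le>s. c l * gk \<delta> (m - 1) (x - \<sigma> * real l * \<kappa>)) = 0"
    unfolding assms(2) by blast
  have "(\<Sum>l\<le>s. c l * g (x - \<sigma> * real l * \<kappa>)) = 0" if "\<sigma> * x < 0" for x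
  proof -
    have "(\<Sum>l\<le>s. c l * g (x - \<sigma> * real l * \<kappa>)) = C * (\<Sum>l\<le>s. c l * gk \<delta> (m - 1) (x - \<sigma> * real l * \<kappa>))"
      by (simp only: g_eq sum_distrib_left mult.left_commute)
    then show ?thesis using rec[OF that] by simp
  qed
  with c show ?thesis by blast
qed

text \<open>For \<open>k\<close> in \<open>J\<close> this is the left inverse property of the pseudoinverse. On the window, the columns
  with \<open>k > k\<^sub>2\<close> (or \<open>k < k\<^sub>1\<close>) are combinations of columns between \<open>0\<close> and \<open>k\<close> by the difference equation.\<close>
lemma gamma_biorthogonal_W:
  "(\<Sum>i\<in>W t. \<gamma> (t + \<alpha> * of_int i) * g (t + \<alpha> * of_int i - of_int k * \<kappa>)) = (if k = 0 then \<beta> else 0)"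
proof -
  obtain w K where Gw: "\<And>t l. l \<in> J \<Longrightarrow> (\<Sum>l'\<in>J. w (rem t) l' * Gram (rem t) l' l) = (if l = 0 then 1 else (0::real))"
    and \<gamma>: "\<And>t. \<gamma> t = (if win t then \<beta> * (\<Sum>l\<in>J. w (rem t) l * g (t - of_int l * \<kappa>)) else 0)"
    using gamma_eq by blast
  define b where "b k = (\<Sum>i\<in>W t. \<gamma> (t + \<alpha> * of_int i) * g (t + \<alpha> * of_int i - of_int k * \<kappa>))" for k
  have Gram_rem: "Gram t l k = Gram (rem t) l k" for l k
  proof -
    have t: "rem t + \<alpha> * of_int (i + \<lfloor>t / \<alpha>\<rfloor>) = t + \<alpha> * of_int i" for i by (simp add: rem_def algebra_simps)
    show ?thesis unfolding Gram_def
      by (rule sum.reindex_bij_witness[where i = "\<lambda>i. i - \<lfloor>t / \<alpha>\<rfloor>" and j = "\<lambda>i. i + \<lfloor>t / \<alpha>\<rfloor>"])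
        (auto simp: W_def t simp flip: t)
  qed
  have bJ: "b k = (if k = 0 then \<beta> else 0)" if "k \<in> J" for k
  proof -
    have "b k = (\<Sum>i\<in>W t. \<Sum>l\<in>J. \<beta> * (w (rem t) l * (g (t + \<alpha> * of_int i - of_int l * \<kappa>) * g (t + \<alpha> * of_int i - of_int k * \<kappa>))))"
      unfolding b_def
    proof (rule sum.cong[OF refl])
      fix i assume "i \<in> W t"
      then have "win (t + \<alpha> * of_int i)" by (simp add: W_def)
      then show "\<gamma> (t + \<alpha> * of_int i) * g (t + \<alpha> * of_int i - of_int k * \<kappa>)
        = (\<Sum>l\<in>J. \<beta> * (w (rem t) l * (g (t + \<alpha> * of_int i - of_int l * \<kappa>) * g (t + \<alpha> * of_int i - of_int k * \<kappa>))))"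
        unfolding \<gamma> rem_shift by (simp only: if_True sum_distrib_left sum_distrib_right mult.assoc)
    qed
    also have "\<dots> = \<beta> * (\<Sum>l\<in>J. w (rem t) l * Gram t l k)"
      unfolding Gram_def by (subst sum.swap) (simp only: sum_distrib_left)
    also have "\<dots> = \<beta> * (if k = 0 then 1 else 0)" unfolding Gram_rem Gw[OF that] ..
    finally show ?thesis by simp
  qed
  have right: "b k = 0" if "k \<ge> 1" for k
    using that
  proof (induction "nat k" arbitrary: k rule: less_induct)
    case less
    show ?case
    proof (cases "k \<le> k2")
      case True
      then show ?thesis using bJ[of k] less.prems zero_in_J by auto
    next
      case False
      obtain c where c: "c q \<noteq> 0" and rec: "\<And>x. x < 0 \<Longrightarrow> (\<Sum>l\<le>q. c l * g (x - real l * \<kappa>)) = 0"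
        using g_recurrence[of 1 q] q_eq by auto
      have "(\<Sum>l\<le>q. c l * b (k - int q + int l)) = (\<Sum>i\<in>W t. \<gamma> (t + \<alpha> * of_int i) *
          (\<Sum>l\<le>q. c l * g ((t + \<alpha> * of_int i - of_int (k - int q) * \<kappa>) - real l * \<kappa>)))"
        unfolding b_def sum_distrib_left by (subst sum.swap) (simp add: algebra_simps)
      also have "\<dots> = 0"
      proof (intro sum.neutral ballI)
        fix i assume "i \<in> W t"
        then have "t + \<alpha> * of_int i < \<kappa> * of_int (k2 - int q + 1)" by (simp add: W_def win_def)
        also have "\<dots> \<le> \<kappa> * of_int (k - int q)" using False \<beta>_pos by (intro mult_left_mono) auto
        finally have "t + \<alpha> * of_int i - of_int (k - int q) * \<kappa> < 0" by (simp add: mult.commute)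
        from rec[OF this] show "\<gamma> (t + \<alpha> * of_int i) * (\<Sum>l\<le>q. c l * g ((t + \<alpha> * of_int i - of_int (k - int q) * \<kappa>) - real l * \<kappa>)) = 0" by simp
      qed
      also have "(\<Sum>l\<le>q. c l * b (k - int q + int l)) = (\<Sum>l<q. c l * b (k - int q + int l)) + c q * b k"
        unfolding lessThan_Suc_atMost[symmetric] by simp
      \<comment> \<open>From \<open>k > k2\<close> and \<open>k2 - q \<ge> 0\<close> the indices
        \<open>k - q + l\<close> are at least 1, so the recursion never reaches the column 0, where
        \<open>b\<close> is nonzero.\<close>
      also have "(\<Sum>l<q. c l * b (k - int q + int l)) = 0"
      proof (intro sum.neutral ballI)
        fix l assume "l \<in> {..<q}"
        then show "c l * b (k - int q + int l) = 0" using less.hyps[of "k - int q + int l"] False k2_ge by auto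
      qed
      finally show ?thesis using c by simp
    qed
  qed
  have left: "b k = 0" if "k \<le> -1" for k
    using that
  proof (induction "nat (- k)" arbitrary: k rule: less_induct)
    case less
    show ?case
    proof (cases "k \<ge> k1")
      case True
      then show ?thesis using bJ[of k] less.prems zero_in_J by auto
    next
      case False
      obtain c where c: "c p \<noteq> 0" and rec: "\<And>x. x > 0 \<Longrightarrow> (\<Sum>l\<le>p. c l * g (x + real l * \<kappa>)) = 0"
        using g_recurrence[of "-1" p] p_eq by auto
      have "(\<Sum>l\<le>p. c l * b (k + int p - int l)) = (\<Sum>i\<in>W t. \<gamma> (t + \<alpha> * of_int i) *
          (\<Sum>l\<le>p. c l * g ((t + \<alpha> * of_int i - of_int (k + int p) * \<kappa>) + real l * \<kappa>)))"
        unfolding b_def sum_distrib_left by (subst sum.swap) (simp add: algebra_simps)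
      also have "\<dots> = 0"
      proof (intro sum.neutral ballI)
        fix i assume "i \<in> W t"
        then have "t + \<alpha> * of_int i > \<kappa> * of_int (k1 + int p - 1)" by (simp add: W_def win_def)
        moreover have "\<kappa> * of_int (k + int p) \<le> \<kappa> * of_int (k1 + int p - 1)" using False \<beta>_pos by (intro mult_left_mono) auto
        ultimately have "t + \<alpha> * of_int i - of_int (k + int p) * \<kappa> > 0" by (simp only: mult.commute[of _ \<kappa>])
        from rec[OF this] show "\<gamma> (t + \<alpha> * of_int i) * (\<Sum>l\<le>p. c l * g ((t + \<alpha> * of_int i - of_int (k + int p) * \<kappa>) + real l * \<kappa>)) = 0" by simp
      qed
      also have "(\<Sum>l\<le>p. c l * b (k + int p - int l)) = (\<Sum>l<p. c l * b (k + int p - int l)) + c p * b k"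
        unfolding lessThan_Suc_atMost[symmetric] by simp
      also have "(\<Sum>l<p. c l * b (k + int p - int l)) = 0"
      proof (intro sum.neutral ballI)
        fix l assume "l \<in> {..<p}"
        then show "c l * b (k + int p - int l) = 0" using less.hyps[of "k + int p - int l"] False k1_le by auto
      qed
      finally show ?thesis using c by simp
    qed
  qed
  have "b k = (if k = 0 then \<beta> else 0)"
    using left[of k] right[of k] bJ[OF zero_in_J] by (cases k "0::int" rule: linorder_cases) auto
  then show ?thesis by (simp only: b_def)
qed

lemma gamma_finite_support: "finite {i::int. \<gamma> (t + \<alpha> * of_int i) \<noteq> 0}"
proof (rule finite_subset[OF _ finite_W])
  obtain w where \<gamma>: "\<And>t. \<gamma> t = (if win t then \<beta> * (\<Sum>l\<in>J. w (rem t) l * g (t - of_int l * \<kappa>)) else 0)"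
    using gamma_eq by blast
  show "{i. \<gamma> (t + \<alpha> * of_int i) \<noteq> 0} \<subseteq> W t" unfolding \<gamma> by (auto simp: W_def)
qed

theorem gamma_biorthogonal:
  "((\<lambda>i::int. \<gamma> (t + \<alpha> * of_int i) * g (t + \<alpha> * of_int i - of_int k / \<beta>)) has_sum (if k = 0 then \<beta> else 0)) UNIV"
proof (rule has_sum_finite_neutralI[OF finite_W[of t]])
  obtain w where \<gamma>: "\<And>t. \<gamma> t = (if win t then \<beta> * (\<Sum>l\<in>J. w (rem t) l * g (t - of_int l * \<kappa>)) else 0)"
    using gamma_eq by blast
  show "\<gamma> (t + \<alpha> * of_int i) * g (t + \<alpha> * of_int i - of_int k / \<beta>) = 0" if "i \<in> UNIV - W t" for i
    using that unfolding \<gamma> by (simp add: W_def)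
  show "(if k = 0 then \<beta> else 0) = (\<Sum>i\<in>W t. \<gamma> (t + \<alpha> * of_int i) * g (t + \<alpha> * of_int i - of_int k / \<beta>))"
    using gamma_biorthogonal_W[of t k] by simp
qed simp

end

section \<open>Square integrable functions\<close>

lemma L2_iff: "L2 S f \<longleftrightarrow> f \<in> borel_measurable borel \<and> set_integrable lborel S (\<lambda>x. (cmod (f x))\<^sup>2)"
  by (simp add: L2_def set_integrable_def)

lemma L2_measurable: "L2 S f \<Longrightarrow> f \<in> borel_measurable borel"
  by (simp add: L2_iff)

lemma nrm2_nonneg: "nrm2 S f \<ge> 0"
  unfolding nrm2_def set_lebesgue_integral_def by (intro Bochner_Integration.integral_nonneg) auto

lemma cmod_add_square_le: "(cmod (x + y))\<^sup>2 \<le> 2 * (cmod x)\<^sup>2 + 2 * (cmod y)\<^sup>2"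
proof -
  have "(cmod (x + y))\<^sup>2 \<le> (cmod x + cmod y)\<^sup>2" by (intro power_mono norm_triangle_ineq) auto
  also have "\<dots> \<le> 2 * (cmod x)\<^sup>2 + 2 * (cmod y)\<^sup>2"
    using sum_squares_bound[of "cmod x" "cmod y"] by (simp add: power2_sum)
  finally show ?thesis .
qed

lemma L2_bound:
  assumes "f \<in> borel_measurable borel" "set_integrable lborel S b" "S \<in> sets borel"
    and "\<And>x. x \<in> S \<Longrightarrow> (cmod (f x))\<^sup>2 \<le> b x"
  shows "L2 S f" and "nrm2 S f \<le> (LINT x:S|lborel. b x)"
proof -
  have "set_integrable lborel S (\<lambda>x. (cmod (f x))\<^sup>2)"
    using assms(2) unfolding set_integrable_def
    by (rule Bochner_Integration.integrable_bound)
      (use assms in \<open>auto simp: indicator_def intro!: AE_I2 order_trans[OF _ abs_ge_self]\<close>)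
  then show "L2 S f" using assms by (simp add: L2_iff)
  with assms show "nrm2 S f \<le> (LINT x:S|lborel. b x)"
    unfolding nrm2_def by (intro set_integral_mono) (auto simp: L2_iff)
qed

lemma L2_add:
  assumes S: "S \<in> sets borel" and f: "L2 S f" and h: "L2 S h"
  shows "L2 S (\<lambda>x. f x + h x)" and "nrm2 S (\<lambda>x. f x + h x) \<le> 2 * nrm2 S f + 2 * nrm2 S h"
proof -
  have int: "set_integrable lborel S (\<lambda>x. 2 * (cmod (f x))\<^sup>2)" "set_integrable lborel S (\<lambda>x. 2 * (cmod (h x))\<^sup>2)"
    using f h by (auto simp: L2_iff)
  have m: "(\<lambda>x. f x + h x) \<in> borel_measurable borel" using f h by (auto simp: L2_iff)
  note * = L2_bound[OF m set_integral_add(1)[OF int] S cmod_add_square_le]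
  show "L2 S (\<lambda>x. f x + h x)" using * by blast
  show "nrm2 S (\<lambda>x. f x + h x) \<le> 2 * nrm2 S f + 2 * nrm2 S h"
    using *(2) set_integral_add(2)[OF int] by (simp add: nrm2_def)
qed

lemma L2_mult_bounded:
  assumes S: "S \<in> sets borel" and f: "L2 S f" and u: "u \<in> borel_measurable borel" "\<And>x. cmod (u x) \<le> B"
  shows "L2 S (\<lambda>x. u x * f x)" and "nrm2 S (\<lambda>x. u x * f x) \<le> B\<^sup>2 * nrm2 S f"
proof -
  have int: "set_integrable lborel S (\<lambda>x. B\<^sup>2 * (cmod (f x))\<^sup>2)" using f by (auto simp: L2_iff)
  have m: "(\<lambda>x. u x * f x) \<in> borel_measurable borel" using f u by (auto simp: L2_iff)
  have "(cmod (u x * f x))\<^sup>2 \<le> B\<^sup>2 * (cmod (f x))\<^sup>2" for x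
    unfolding norm_mult power_mult_distrib by (intro mult_right_mono power_mono u) auto
  note * = L2_bound[OF m int S this]
  show "L2 S (\<lambda>x. u x * f x)" using * by blast
  show "nrm2 S (\<lambda>x. u x * f x) \<le> B\<^sup>2 * nrm2 S f" using *(2) by (simp add: nrm2_def)
qed

lemma L2_cmult: "S \<in> sets borel \<Longrightarrow> L2 S f \<Longrightarrow> L2 S (\<lambda>x. c * f x)"
  by (rule L2_mult_bounded(1)[where B = "cmod c"]) auto

lemma L2_diff: "S \<in> sets borel \<Longrightarrow> L2 S f \<Longrightarrow> L2 S h \<Longrightarrow> L2 S (\<lambda>x. f x - h x)"
  using L2_add(1)[of S f "\<lambda>x. - 1 * h x"] L2_cmult[of S h "-1"] by simp

lemma L2_sum: "finite F \<Longrightarrow> S \<in> sets borel \<Longrightarrow> (\<And>i. i \<in> F \<Longrightarrow> L2 S (f i)) \<Longrightarrow> L2 S (\<lambda>x. \<Sum>i\<in>F. f i x)"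
proof (induction F rule: finite_induct)
  case empty
  then show ?case by (simp add: L2_iff set_integrable_def)
next
  case (insert i F)
  then show ?case using L2_add(1)[of S "f i" "\<lambda>x. \<Sum>i\<in>F. f i x"] by simp
qed

lemma L2_bounded_Icc:
  assumes "f \<in> borel_measurable borel" "\<And>x. x \<in> {a..b} \<Longrightarrow> cmod (f x) \<le> B"
  shows "L2 {a..b::real} f" and "a \<le> b \<Longrightarrow> nrm2 {a..b} f \<le> B\<^sup>2 * (b - a)"
proof -
  have c: "set_integrable lborel {a..b} (\<lambda>x. B\<^sup>2)"
    unfolding set_integrable_def by (cases "a \<le> b") auto
  have b: "(cmod (f x))\<^sup>2 \<le> B\<^sup>2" if "x \<in> {a..b}" for x by (intro power_mono assms(2) that) auto
  show "L2 {a..b} f" using L2_bound(1)[OF assms(1) c _ b] by simp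
  show "nrm2 {a..b} f \<le> B\<^sup>2 * (b - a)" if "a \<le> b"
    using L2_bound(2)[OF assms(1) c _ b] that by (simp add: set_lebesgue_integral_def mult.commute)
qed

lemma cnj_measurable [measurable (raw)]:
  "f \<in> borel_measurable M \<Longrightarrow> (\<lambda>x. cnj (f x)) \<in> borel_measurable M"
  by (erule measurable_compose) (intro borel_measurable_continuous_onI continuous_intros)

lemma ip_integrable:
  assumes S: "S \<in> sets borel" and f: "L2 S f" and h: "L2 S h"
  shows "set_integrable lborel S (\<lambda>x. f x * cnj (h x))"
proof -
  have int: "set_integrable lborel S (\<lambda>x. (cmod (f x))\<^sup>2)" "set_integrable lborel S (\<lambda>x. (cmod (h x))\<^sup>2)"
    using f h by (auto simp: L2_iff)
  have [measurable]: "f \<in> borel_measurable borel" "h \<in> borel_measurable borel" using f h by (auto simp: L2_iff)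
  have le: "cmod (f x) * cmod (h x) \<le> (cmod (f x))\<^sup>2 + (cmod (h x))\<^sup>2" for x
    using sum_squares_bound[of "cmod (f x)" "cmod (h x)"] mult_nonneg_nonneg[OF norm_ge_zero norm_ge_zero, of "f x" "h x"]
    unfolding power2_eq_square by linarith
  show ?thesis
    using set_integral_add(1)[OF int] unfolding set_integrable_def
  proof (rule Bochner_Integration.integrable_bound)
    show "(\<lambda>x. indicator S x *\<^sub>R (f x * cnj (h x))) \<in> borel_measurable lborel" using S by measurable
    show "AE x in lborel. norm (indicator S x *\<^sub>R (f x * cnj (h x))) \<le> norm (indicator S x *\<^sub>R ((cmod (f x))\<^sup>2 + (cmod (h x))\<^sup>2))"
      using le by (intro AE_I2) (auto simp: indicator_def norm_mult)
  qed
qed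

lemma nrm2_tendsto_zero:
  assumes S: "S \<in> sets borel" and m: "\<And>n. u n \<in> borel_measurable borel" and b: "set_integrable lborel S b"
    and le: "\<And>n x. x \<in> S \<Longrightarrow> (cmod (u n x))\<^sup>2 \<le> b x"
    and lim: "AE x in lborel. x \<in> S \<longrightarrow> (\<lambda>n. u n x) \<longlonglongrightarrow> 0"
  shows "(\<lambda>n. nrm2 S (u n)) \<longlonglongrightarrow> 0"
proof -
  have "(\<lambda>n. LINT x|lborel. indicator S x *\<^sub>R (cmod (u n x))\<^sup>2) \<longlonglongrightarrow> integral\<^sup>L lborel (\<lambda>x :: real. 0 :: real)"
  proof (rule Bochner_Integration.integral_dominated_convergence[where M = lborel and f = "\<lambda>x. 0"
      and s = "\<lambda>n x. indicator S x *\<^sub>R (cmod (u n x))\<^sup>2" and w = "\<lambda>x. indicator S x *\<^sub>R b x"])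
    show "integrable lborel (\<lambda>x. indicator S x *\<^sub>R b x)" using b by (simp add: set_integrable_def)
    show "AE x in lborel. (\<lambda>n. indicator S x *\<^sub>R (cmod (u n x))\<^sup>2) \<longlonglongrightarrow> 0"
      using lim
    proof eventually_elim
      case (elim x)
      show ?case
      proof (cases "x \<in> S")
        case True
        then have "(\<lambda>n. (cmod (u n x))\<^sup>2) \<longlonglongrightarrow> (cmod 0)\<^sup>2" using elim by (intro tendsto_intros) auto
        then show ?thesis using True by simp
      qed simp
    qed
  qed (use S m le in \<open>auto simp: indicator_def\<close>)
  then show ?thesis by (simp add: nrm2_def set_lebesgue_integral_def)
qed

lemma set_integral_sum:
  fixes f :: "'i \<Rightarrow> 'a \<Rightarrow> 'b::{banach, second_countable_topology}"
  assumes "\<And>i. i \<in> F \<Longrightarrow> set_integrable M S (f i)"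
  shows "set_integrable M S (\<lambda>x. \<Sum>i\<in>F. f i x)" and "(LINT x:S|M. (\<Sum>i\<in>F. f i x)) = (\<Sum>i\<in>F. LINT x:S|M. f i x)"
  using assms unfolding set_integrable_def set_lebesgue_integral_def scaleR_sum_right
  by (auto intro!: Bochner_Integration.integral_sum)

section \<open>Fourier series\<close>

text \<open>Generated by monomials and sums, so that frequencies may repeat and closure under
  products is a plain induction; \<open>trig_poly_eq_sum\<close> collects the frequencies
  afterwards.\<close>

inductive trig_poly :: "real \<Rightarrow> (real \<Rightarrow> complex) \<Rightarrow> bool" for T where
  monom: "trig_poly T (\<lambda>t. c * cis (2 * pi * (of_int l / T) * t))"
| add: "trig_poly T u \<Longrightarrow> trig_poly T v \<Longrightarrow> trig_poly T (\<lambda>t. u t + v t)"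

lemma trig_poly_const: "trig_poly T (\<lambda>t. c)"
  using trig_poly.monom[of T c 0] by simp

lemma trig_poly_mult:
  assumes "trig_poly T u" "trig_poly T v"
  shows "trig_poly T (\<lambda>t. u t * v t)"
  using assms
proof (induction arbitrary: v)
  case (monom c l)
  from monom show ?case
  proof induction
    case (monom c' l')
    have "c * cis (2 * pi * (of_int l / T) * t) * (c' * cis (2 * pi * (of_int l' / T) * t))
        = (c * c') * cis (2 * pi * (of_int (l + l') / T) * t)" for t
      by (simp add: add_divide_distrib ring_distribs flip: cis_mult)
    then show ?case by (simp only: trig_poly.monom)
  next
    case (add u v)
    show ?case using trig_poly.add[OF add.IH] by (simp add: distrib_left)
  qed
next
  case (add u w)
  show ?case using trig_poly.add[OF add.IH(1)[OF add.prems] add.IH(2)[OF add.prems]] by (simp add: distrib_right)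
qed

lemma trig_poly_eq_sum:
  "trig_poly T u \<Longrightarrow> \<exists>F c. finite F \<and> u = (\<lambda>t. \<Sum>l\<in>F. c l * cis (2 * pi * (of_int l / T) * t))"
proof (induction rule: trig_poly.induct)
  case (monom c l)
  show ?case by (rule exI[of _ "{l}"]) (auto intro: exI[of _ "\<lambda>_. c"])
next
  case (add u v)
  then obtain F c F' c' where F: "finite F" "finite F'"
    and u: "u = (\<lambda>t. \<Sum>l\<in>F. c l * cis (2 * pi * (of_int l / T) * t))"
    and v: "v = (\<lambda>t. \<Sum>l\<in>F'. c' l * cis (2 * pi * (of_int l / T) * t))" by auto
  let ?c = "\<lambda>l. (if l \<in> F then c l else 0) + (if l \<in> F' then c' l else 0)"
  have "u t = (\<Sum>l\<in>F \<union> F'. (if l \<in> F then c l else 0) * cis (2 * pi * (of_int l / T) * t))"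
    "v t = (\<Sum>l\<in>F \<union> F'. (if l \<in> F' then c' l else 0) * cis (2 * pi * (of_int l / T) * t))" for t
    unfolding u v by (rule sum.mono_neutral_cong_left; use F in auto)+
  then have "(\<lambda>t. u t + v t) = (\<lambda>t. \<Sum>l\<in>F \<union> F'. ?c l * cis (2 * pi * (of_int l / T) * t))"
    by (simp add: sum.distrib ring_distribs)
  then show ?case using F by (intro exI[of _ "F \<union> F'"] exI[of _ ?c]) auto
qed

section \<open>Orthogonality and best approximation by trigonometric sums\<close>

locale fourier_series =
  fixes T :: real
  assumes T_pos: "T > 0"
begin

definition e :: "int \<Rightarrow> real \<Rightarrow> complex" where
  "e l t = cis (2 * pi * (of_int l / T) * t)"

lemma e_measurable [measurable]: "e l \<in> borel_measurable borel"
  unfolding e_def[abs_def] by (intro borel_measurable_continuous_onI continuous_intros)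

lemma norm_e [simp]: "cmod (e l t) = 1" by (simp add: e_def)

lemma L2_e: "L2 {0..T} (e l)"
  by (rule L2_bounded_Icc(1)[where B = 1]) auto

lemma e_cnj_e: "e l t * cnj (e l' t) = e (l - l') t"
  by (simp add: e_def cis_cnj cis_mult diff_divide_distrib left_diff_distrib right_diff_distrib)

lemma integral_e: "(LINT t:{0..T}|lborel. e l t) = (if l = 0 then of_real T else 0)"
proof (cases "l = 0")
  case True
  then show ?thesis using T_pos by (simp add: e_def set_lebesgue_integral_def scaleR_conv_of_real)
next
  case False
  define w where "w = 2 * pi * (of_int l / T)"
  have w: "w \<noteq> 0" using False T_pos by (simp add: w_def)
  have "(LINT t|lborel. indicator {0..T} t *\<^sub>R e l t) = cis (w * T) / (\<i> * w) - cis (w * 0) / (\<i> * w)"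
  proof (rule integral_FTC_Icc)
    show "0 \<le> T" using T_pos by simp
    show "continuous_on {0..T} (e l)" unfolding e_def[abs_def] by (intro continuous_intros)
    fix t :: real
    have "((\<lambda>z. exp (\<i> * (complex_of_real w * z)) / (\<i> * w)) has_field_derivative exp (\<i> * (complex_of_real w * complex_of_real t))) (at (complex_of_real t))"
      using w by (auto intro!: derivative_eq_intros simp: ac_simps)
    from has_vector_derivative_real_field[OF this]
    have "((\<lambda>t. cis (w * t) / (\<i> * w)) has_vector_derivative e l t) (at t)"
      by (simp add: cis_conv_exp e_def w_def)
    then show "((\<lambda>t. cis (w * t) / (\<i> * w)) has_vector_derivative e l t) (at t within {0..T})"
      by (rule has_vector_derivative_at_within)
  qed
  moreover have "cis (w * T) = 1"
    using T_pos cos_int_2pin[of l] sin_int_2pin[of l] by (simp add: w_def complex_eq_iff mult.commute)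
  ultimately show ?thesis using False by (simp add: set_lebesgue_integral_def)
qed

definition coef :: "(real \<Rightarrow> complex) \<Rightarrow> int \<Rightarrow> complex" where
  "coef f l = ip {0..T} f (e l)"

text \<open>Orthogonality of the \<open>e l\<close>, followed by completing the square in each
  coefficient. The last sum is the excess over the best choice \<open>coef f l / T\<close>, so
  Bessel's inequality and the best approximation property can both be read off.\<close>

lemma approximation_identity:
  assumes f: "L2 {0..T} f" and F: "finite F"
  shows "nrm2 {0..T} (\<lambda>t. f t - (\<Sum>l\<in>F. c l * e l t))
    = nrm2 {0..T} f - (\<Sum>l\<in>F. (cmod (coef f l))\<^sup>2) / T + T * (\<Sum>l\<in>F. (cmod (c l - coef f l / T))\<^sup>2)"
proof -
  let ?S = "{0..T}"
  define p where "p t = (\<Sum>l\<in>F. c l * e l t)" for t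
  have p: "L2 ?S p" unfolding p_def[abs_def] by (intro L2_sum F L2_cmult L2_e) auto
  have fe: "set_integrable lborel ?S (\<lambda>t. f t * cnj (e l t))" for l by (intro ip_integrable f L2_e) auto
  have ee: "set_integrable lborel ?S (\<lambda>t. e l t * cnj (e l' t))" for l l' by (intro ip_integrable L2_e) auto
  have fp: "(LINT t:?S|lborel. f t * cnj (p t)) = (\<Sum>l\<in>F. cnj (c l) * coef f l)"
  proof -
    have "(LINT t:?S|lborel. f t * cnj (p t)) = (LINT t:?S|lborel. (\<Sum>l\<in>F. cnj (c l) * (f t * cnj (e l t))))"
      by (simp add: p_def cnj_sum sum_distrib_left mult.left_commute)
    also have "\<dots> = (\<Sum>l\<in>F. LINT t:?S|lborel. cnj (c l) * (f t * cnj (e l t)))"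
      by (intro set_integral_sum(2) set_integrable_mult_right fe)
    also have "\<dots> = (\<Sum>l\<in>F. cnj (c l) * coef f l)"
      by (simp add: coef_def ip_def)
    finally show ?thesis .
  qed
  have pp: "(LINT t:?S|lborel. p t * cnj (p t)) = (\<Sum>l\<in>F. of_real (T * (cmod (c l))\<^sup>2))"
  proof -
    have "(LINT t:?S|lborel. p t * cnj (p t)) = (LINT t:?S|lborel. (\<Sum>l\<in>F. \<Sum>l'\<in>F. c l * cnj (c l') * (e l t * cnj (e l' t))))"
      by (simp add: p_def cnj_sum sum_product ac_simps)
    also have "\<dots> = (\<Sum>l\<in>F. \<Sum>l'\<in>F. c l * cnj (c l') * (LINT t:?S|lborel. e l t * cnj (e l' t)))"
      by (subst set_integral_sum(2), intro set_integral_sum(1) set_integrable_mult_right ee,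
          intro sum.cong refl, subst set_integral_sum(2), intro set_integrable_mult_right ee, simp)
    also have "\<dots> = (\<Sum>l\<in>F. \<Sum>l'\<in>F. if l = l' then c l * cnj (c l') * T else 0)"
      by (intro sum.cong refl) (auto simp: e_cnj_e integral_e)
    also have "\<dots> = (\<Sum>l\<in>F. c l * cnj (c l) * T)" using F by simp
    finally show ?thesis by (simp add: complex_norm_square mult.commute del: of_real_power)
  qed
  have point: "(cmod (f t - p t))\<^sup>2 = (cmod (f t))\<^sup>2 - 2 * Re (f t * cnj (p t)) + Re (p t * cnj (p t))" for t
  proof -
    have "(cmod (x - y))\<^sup>2 = (cmod x)\<^sup>2 - 2 * Re (x * cnj y) + Re (y * cnj y)" for x y
      unfolding cmod_power2 by (simp add: power2_eq_square algebra_simps)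
    then show ?thesis .
  qed
  have i1: "set_integrable lborel ?S (\<lambda>t. (cmod (f t))\<^sup>2)" using f by (simp add: L2_iff)
  have i2: "set_integrable lborel ?S (\<lambda>t. f t * cnj (p t))" by (intro ip_integrable f p) auto
  have i3: "set_integrable lborel ?S (\<lambda>t. p t * cnj (p t))" by (intro ip_integrable p) auto
  have re: "set_integrable lborel ?S (\<lambda>t. Re (u t))" "(LINT t:?S|lborel. Re (u t)) = Re (LINT t:?S|lborel. u t)"
    if "set_integrable lborel ?S u" for u
    using that integral_Re[of lborel "\<lambda>t. indicator ?S t *\<^sub>R u t"] integrable_Re[of lborel "\<lambda>t. indicator ?S t *\<^sub>R u t"]
    by (simp_all add: set_integrable_def set_lebesgue_integral_def)
  have "nrm2 ?S (\<lambda>t. f t - p t) = nrm2 ?S f - 2 * Re (LINT t:?S|lborel. f t * cnj (p t)) + Re (LINT t:?S|lborel. p t * cnj (p t))"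
  proof -
    have "nrm2 ?S (\<lambda>t. f t - p t) = (LINT t:?S|lborel. ((cmod (f t))\<^sup>2 - 2 * Re (f t * cnj (p t))) + Re (p t * cnj (p t)))"
      unfolding nrm2_def point ..
    also have "\<dots> = (LINT t:?S|lborel. (cmod (f t))\<^sup>2 - 2 * Re (f t * cnj (p t))) + (LINT t:?S|lborel. Re (p t * cnj (p t)))"
      by (intro set_integral_add(2) set_integral_diff(1) i1 set_integrable_mult_right re(1)[OF i2] re(1)[OF i3])
    also have "(LINT t:?S|lborel. (cmod (f t))\<^sup>2 - 2 * Re (f t * cnj (p t)))
        = (LINT t:?S|lborel. (cmod (f t))\<^sup>2) - (LINT t:?S|lborel. 2 * Re (f t * cnj (p t)))"
      by (intro set_integral_diff(2) i1 set_integrable_mult_right re(1)[OF i2])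
    finally show ?thesis
      by (simp only: set_integral_mult_right re(2)[OF i2] re(2)[OF i3] nrm2_def)
  qed
  also have "\<dots> = nrm2 ?S f - (\<Sum>l\<in>F. 2 * Re (cnj (c l) * coef f l)) + (\<Sum>l\<in>F. T * (cmod (c l))\<^sup>2)"
    unfolding fp pp by (simp add: Re_sum sum_distrib_left)
  also have "\<dots> = nrm2 ?S f - (\<Sum>l\<in>F. (cmod (coef f l))\<^sup>2) / T + T * (\<Sum>l\<in>F. (cmod (c l - coef f l / T))\<^sup>2)"
  proof -
    have "T * (cmod (c l))\<^sup>2 - 2 * Re (cnj (c l) * coef f l) = T * (cmod (c l - coef f l / T))\<^sup>2 - (cmod (coef f l))\<^sup>2 / T" for l
      using T_pos unfolding cmod_power2 by (simp add: power2_eq_square field_simps)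
    then have "(\<Sum>l\<in>F. T * (cmod (c l))\<^sup>2) - (\<Sum>l\<in>F. 2 * Re (cnj (c l) * coef f l))
        = T * (\<Sum>l\<in>F. (cmod (c l - coef f l / T))\<^sup>2) - (\<Sum>l\<in>F. (cmod (coef f l))\<^sup>2) / T"
      unfolding sum_subtractf[symmetric] sum_distrib_left sum_divide_distrib by simp
    then show ?thesis by linarith
  qed
  finally show ?thesis by (simp only: p_def)
qed

lemma nrm2_trig_sum:
  assumes F: "finite F"
  shows "nrm2 {0..T} (\<lambda>t. \<Sum>l\<in>F. c l * e l t) = T * (\<Sum>l\<in>F. (cmod (c l))\<^sup>2)"
proof -
  have "L2 {0..T} (\<lambda>_. 0)" by (simp add: L2_iff set_integrable_def)
  from approximation_identity[OF this F, of "\<lambda>l. - c l"] show ?thesis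
    by (simp add: nrm2_def coef_def ip_def sum_negf set_lebesgue_integral_def)
qed

section \<open>Density of trigonometric polynomials in L2\<close>

lemma trig_poly_L2: "trig_poly T u \<Longrightarrow> L2 {0..T} u"
proof (induction rule: trig_poly.induct)
  case (monom c l)
  show ?case using L2_cmult[OF _ L2_e, of c l] by (simp add: e_def)
qed (auto intro: L2_add)

text \<open>On the circle a real linear form is a combination of \<open>cis \<theta>\<close> and
  \<open>cis (- \<theta>)\<close>; sums and products preserve the class.\<close>

lemma trig_poly_real_polynomial:
  fixes p :: "complex \<Rightarrow> real"
  assumes "real_polynomial_function p"
  shows "trig_poly T (\<lambda>t. of_real (p (cis (2 * pi * t / T))))"
  using assms
proof (induction rule: real_polynomial_function.induct)
  case (linear f)
  let ?c = "\<lambda>s::real. complex_of_real (f 1) / 2 + s * complex_of_real (f \<i>) / (2 * \<i>)"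
  have "complex_of_real (f (cis \<theta>)) = ?c 1 * cis \<theta> + ?c (- 1) * cis (- \<theta>)" for \<theta>
  proof -
    have "cis \<theta> = cos \<theta> *\<^sub>R 1 + sin \<theta> *\<^sub>R \<i>" by (simp add: complex_eq_iff)
    then have "f (cis \<theta>) = f (cos \<theta> *\<^sub>R 1 + sin \<theta> *\<^sub>R \<i>)" by (rule arg_cong)
    also have "\<dots> = cos \<theta> * f 1 + sin \<theta> * f \<i>"
      using bounded_linear.linear[OF linear] by (simp only: linear_add linear_scale real_scaleR_def)
    finally have "f (cis \<theta>) = cos \<theta> * f 1 + sin \<theta> * f \<i>" .
    then show ?thesis by (simp add: complex_eq_iff field_simps)
  qed
  then show ?case
    using trig_poly.add[OF trig_poly.monom[of T "?c 1" 1] trig_poly.monom[of T "?c (- 1)" "- 1"]] by simp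
next
  case (const c)
  show ?case by (rule trig_poly_const)
next
  case (add f g)
  show ?case using trig_poly.add[OF add.IH] by simp
next
  case (mult f g)
  show ?case using trig_poly_mult[OF mult.IH] by simp
qed

text \<open>Stone-Weierstrass is applied on the circle, a compact set of complex numbers. There
  \<open>H\<close> represents \<open>h\<close>: two parameters of the same point can only be equal
  or the two end points, where \<open>h\<close> agrees. \<open>H\<close> is continuous because
  closed subsets of the compact interval have compact images on the circle.\<close>

lemma trig_poly_uniform:
  assumes h: "continuous_on {0..T} h" "h 0 = h T" and \<epsilon>: "\<epsilon> > 0"
  shows "\<exists>u. trig_poly T u \<and> (\<forall>t\<in>{0..T}. cmod (h t - u t) < \<epsilon>)"
proof -
  let ?e = "\<lambda>t. cis (2 * pi * t / T)"
  define H where "H z = h (SOME t. t \<in> {0..T} \<and> ?e t = z)" for z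
  have eq: "h s = h t" if "s \<in> {0..T}" "t \<in> {0..T}" "?e s = ?e t" for s t
  proof -
    have "cos (2 * pi * (s - t) / T) = Re (?e s * cnj (?e t))"
      by (simp add: cis_cnj cis_mult diff_divide_distrib right_diff_distrib)
    also have "\<dots> = 1" unfolding that(3) by (simp add: cis_cnj cis_mult)
    finally obtain n :: int where "2 * pi * (s - t) / T = real_of_int n * 2 * pi" using cos_one_2pi_int by blast
    then have "(2 * pi) * (s - t) = (2 * pi) * (n * T)" using T_pos by (simp add: field_simps)
    then have n: "s - t = n * T" by (subst (asm) mult_cancel_left) simp
    have "\<bar>real_of_int n * T\<bar> \<le> 1 * T" using that(1,2) n[symmetric] by auto
    then have "\<bar>real_of_int n\<bar> \<le> 1" using T_pos by (simp only: abs_mult abs_of_pos mult_le_cancel_right_pos)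
    then have "n = 0 \<or> n = 1 \<or> n = -1" by linarith
    then have "s = t \<or> s = T \<and> t = 0 \<or> s = 0 \<and> t = T" using n that(1,2) by auto
    then show ?thesis using h(2) by auto
  qed
  have He: "H (?e t) = h t" if "t \<in> {0..T}" for t
  proof -
    have "(SOME s. s \<in> {0..T} \<and> ?e s = ?e t) \<in> {0..T} \<and> ?e (SOME s. s \<in> {0..T} \<and> ?e s = ?e t) = ?e t"
      by (rule someI[where P = "\<lambda>s. s \<in> {0..T} \<and> ?e s = ?e t"]) (use that in auto)
    then show ?thesis unfolding H_def using eq[OF _ that] by blast
  qed
  let ?C = "?e ` {0..T}"
  have ce: "continuous_on {0..T} ?e" by (intro continuous_intros) (use T_pos in auto)
  have compact: "compact ?C" by (rule compact_continuous_image[OF ce]) simp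
  have "continuous_on ?C H"
    unfolding continuous_on_closed_vimage[OF compact_imp_closed[OF compact]]
  proof (intro allI impI)
    fix B :: "complex set" assume B: "closed B"
    have "compact ({0..T} \<inter> h -` B)"
      using continuous_closed_preimage[OF h(1) closed_atLeastAtMost B] compact_Icc[of 0 T]
      by (metis compact_Int_closed inf.left_idem)
    then have "compact (?e ` ({0..T} \<inter> h -` B))"
      by (intro compact_continuous_image continuous_on_subset[OF ce]) auto
    moreover have "?e ` ({0..T} \<inter> h -` B) = H -` B \<inter> ?C" using He by auto
    ultimately show "closed (H -` B \<inter> ?C)" by (simp add: compact_imp_closed)
  qed
  from Stone_Weierstrass_polynomial_function[OF compact this \<epsilon>]
  obtain P where P: "polynomial_function P" "\<And>z. z \<in> ?C \<Longrightarrow> cmod (H z - P z) < \<epsilon>" by blast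
  have "real_polynomial_function (Re \<circ> P)" "real_polynomial_function (Im \<circ> P)"
    using P(1) bounded_linear_Re bounded_linear_Im unfolding polynomial_function_def by blast+
  from this[THEN trig_poly_real_polynomial]
  have "trig_poly T (\<lambda>t. of_real (Re (P (?e t))))" "trig_poly T (\<lambda>t. of_real (Im (P (?e t))))" by simp_all
  then have "trig_poly T (\<lambda>t. of_real (Re (P (?e t))) + \<i> * of_real (Im (P (?e t))))"
    by (intro trig_poly.add trig_poly_mult[OF trig_poly_const])
  then have "trig_poly T (\<lambda>t. P (?e t))" by (simp flip: complex_eq)
  moreover have "cmod (h t - P (?e t)) < \<epsilon>" if "t \<in> {0..T}" for t
    using P(2)[of "?e t"] He[OF that] that by auto
  ultimately show ?thesis by blast
qed

definition approximable :: "(real \<Rightarrow> complex) \<Rightarrow> bool" where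
  "approximable f \<longleftrightarrow> (\<forall>\<epsilon>>0. \<exists>u. trig_poly T u \<and> nrm2 {0..T} (\<lambda>t. f t - u t) < \<epsilon>)"

lemma approximable_limit:
  assumes f: "L2 {0..T} f" and fn: "\<And>n. L2 {0..T} (fn n)" "\<And>n. approximable (fn n)"
    and lim: "(\<lambda>n. nrm2 {0..T} (\<lambda>t. f t - fn n t)) \<longlonglongrightarrow> 0"
  shows "approximable f"
  unfolding approximable_def
proof (intro allI impI)
  fix \<epsilon> :: real assume \<epsilon>: "\<epsilon> > 0"
  then have "\<forall>\<^sub>F n in sequentially. nrm2 {0..T} (\<lambda>t. f t - fn n t) < \<epsilon> / 4" by (intro order_tendstoD[OF lim]) simp
  then obtain n where n: "nrm2 {0..T} (\<lambda>t. f t - fn n t) < \<epsilon> / 4" by (auto simp: eventually_sequentially)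
  have "\<epsilon> / 4 > 0" using \<epsilon> by simp
  then obtain u where u: "trig_poly T u" "nrm2 {0..T} (\<lambda>t. fn n t - u t) < \<epsilon> / 4"
    using fn(2)[of n] unfolding approximable_def by blast
  have "nrm2 {0..T} (\<lambda>t. (f t - fn n t) + (fn n t - u t)) \<le> 2 * nrm2 {0..T} (\<lambda>t. f t - fn n t) + 2 * nrm2 {0..T} (\<lambda>t. fn n t - u t)"
    using f fn(1)[of n] trig_poly_L2[OF u(1)] by (intro L2_add(2) L2_diff) auto
  then have "nrm2 {0..T} (\<lambda>t. f t - u t) < \<epsilon>" using n u(2) by simp
  with u(1) show "\<exists>u. trig_poly T u \<and> nrm2 {0..T} (\<lambda>t. f t - u t) < \<epsilon>" by blast
qed

lemma approximable_continuous_periodic: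
  assumes h: "continuous_on UNIV h" "h 0 = h T"
  shows "approximable h"
  unfolding approximable_def
proof (intro allI impI)
  fix \<epsilon> :: real assume \<epsilon>: "\<epsilon> > 0"
  define d where "d = sqrt (\<epsilon> / (2 * T))"
  have d: "d > 0" "d\<^sup>2 = \<epsilon> / (2 * T)" using \<epsilon> T_pos by (auto simp: d_def)
  obtain u where u: "trig_poly T u" "\<forall>t\<in>{0..T}. cmod (h t - u t) < d"
    using trig_poly_uniform[OF continuous_on_subset[OF h(1)] h(2) d(1)] by blast
  have "(\<lambda>t. h t - u t) \<in> borel_measurable borel"
    using borel_measurable_continuous_onI[OF h(1)] L2_measurable[OF trig_poly_L2[OF u(1)]] by simp
  then have "nrm2 {0..T} (\<lambda>t. h t - u t) \<le> d\<^sup>2 * (T - 0)"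
    using u(2) T_pos by (intro L2_bounded_Icc(2)) (auto intro: less_imp_le)
  also have "\<dots> < \<epsilon>" using \<epsilon> T_pos by (simp add: d)
  finally show "\<exists>u. trig_poly T u \<and> nrm2 {0..T} (\<lambda>t. h t - u t) < \<epsilon>" using u(1) by blast
qed

lemma approximable_continuous:
  assumes h: "continuous_on UNIV h"
  shows "approximable h"
proof -
  \<comment> \<open>A trapezoidal cutoff that vanishes at both end points, which makes the product
    periodic, and is eventually 1 at every inner point, so that the error tends to 0 in mean
    square.\<close>
  define cut where "cut n t = max 0 (min 1 (min (real n * t) (real n * (T - t))))" for n t
  have cutc: "continuous_on UNIV (cut n)" for n unfolding cut_def[abs_def] by (intro continuous_intros)
  have hc: "continuous_on UNIV (\<lambda>t. cut n t * h t)" for n by (intro continuous_intros cutc h)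
  obtain B where B: "\<And>t. t \<in> {0..T} \<Longrightarrow> cmod (h t) \<le> B"
  proof -
    have "bounded (h ` {0..T})"
      by (intro compact_imp_bounded compact_continuous_image continuous_on_subset[OF h]) auto
    then obtain a where "\<forall>x\<in>h ` {0..T}. cmod x \<le> a" by (auto simp: bounded_iff)
    then show thesis by (intro that[of a]) auto
  qed
  have m[measurable]: "h \<in> borel_measurable borel" "cut n \<in> borel_measurable borel" for n
    using h cutc by (auto intro: borel_measurable_continuous_onI)
  have le: "cmod (cut n t * h t) \<le> B" if "t \<in> {0..T}" for n t
  proof -
    have "\<bar>cut n t\<bar> * cmod (h t) \<le> 1 * B" using B[OF that] by (intro mult_mono) (auto simp: cut_def)
    then show ?thesis by (simp add: norm_mult)
  qed
  show ?thesis
  proof (rule approximable_limit)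
    show "L2 {0..T} h" by (rule L2_bounded_Icc(1)[OF m(1) B])
    show "L2 {0..T} (\<lambda>t. cut n t * h t)" for n by (rule L2_bounded_Icc(1)[OF _ le]) measurable
    show "approximable (\<lambda>t. cut n t * h t)" for n
      by (rule approximable_continuous_periodic[OF hc]) (use T_pos in \<open>auto simp: cut_def\<close>)
    show "(\<lambda>n. nrm2 {0..T} (\<lambda>t. h t - cut n t * h t)) \<longlonglongrightarrow> 0"
    proof (rule nrm2_tendsto_zero[where b = "\<lambda>_. (2 * B)\<^sup>2"])
      show "set_integrable lborel {0..T} (\<lambda>_. (2 * B)\<^sup>2)" unfolding set_integrable_def using T_pos by simp
      show "(cmod (h t - cut n t * h t))\<^sup>2 \<le> (2 * B)\<^sup>2" if "t \<in> {0..T}" for n t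
        using norm_triangle_ineq4[of "h t" "cut n t * h t"] B[OF that] le[OF that, of n] by (intro power_mono) auto
      show "AE t in lborel. t \<in> {0..T} \<longrightarrow> (\<lambda>n. h t - cut n t * h t) \<longlonglongrightarrow> 0"
        using AE_lborel_singleton[of 0] AE_lborel_singleton[of T]
      proof eventually_elim
        case (elim t)
        show ?case
        proof
          assume "t \<in> {0..T}"
          then have t: "0 < t" "0 < T - t" using elim by auto
          have "\<forall>\<^sub>F n in sequentially. real n \<ge> max (1 / t) (1 / (T - t))"
            using filterlim_real_sequentially unfolding filterlim_at_top by blast
          then have "\<forall>\<^sub>F n in sequentially. h t - cut n t * h t = 0"
          proof eventually_elim
            case (elim n)
            then have "1 \<le> real n * t" "1 \<le> real n * (T - t)" using t by (auto simp: field_simps)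
            then show ?case by (simp add: cut_def)
          qed
          then show "(\<lambda>n. h t - cut n t * h t) \<longlonglongrightarrow> 0" by (rule tendsto_eventually)
        qed
      qed
    qed auto
  qed
qed

text \<open>A measurable function is almost everywhere a limit of continuous ones. Composing these
  with the continuous retraction \<open>clip\<close> onto the ball of radius \<open>B\<close> makes
  dominated convergence applicable and leaves \<open>f\<close> unchanged.\<close>

lemma approximable_bounded:
  assumes m[measurable]: "f \<in> borel_measurable borel" and B: "\<And>t. cmod (f t) \<le> B" "B > 0"
  shows "approximable f"
proof -
  define clip where "clip z = of_real (B / max B (cmod z)) * z" for z :: complex
  have clip_c: "continuous_on UNIV clip" unfolding clip_def using B(2) by (intro continuous_intros) auto
  have clip_b: "cmod (clip z) \<le> B" for z
    using B(2) by (auto simp: clip_def norm_mult norm_divide max_def field_simps)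
  have clip_id: "clip z = z" if "cmod z \<le> B" for z using that B(2) by (simp add: clip_def max_def)
  have "f \<in> borel_measurable lebesgue" using m by (simp add: measurable_completion)
  then have "f measurable_on UNIV" by (rule lebesgue_measurable_imp_measurable_on) simp
  then obtain N g where N: "negligible N" and g: "\<And>n. continuous_on UNIV (g n)"
    and lim: "\<And>x. x \<notin> N \<Longrightarrow> (\<lambda>n. g n x) \<longlonglongrightarrow> f x"
    unfolding measurable_on_def by auto
  have gc: "continuous_on UNIV (\<lambda>t. clip (g n t))" for n
    by (rule continuous_on_compose2[OF clip_c g]) simp
  have gm[measurable]: "(\<lambda>t. clip (g n t)) \<in> borel_measurable borel" for n using gc by (rule borel_measurable_continuous_onI)
  show ?thesis
  proof (rule approximable_limit)
    show "L2 {0..T} f" by (rule L2_bounded_Icc(1)[OF m B(1)])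
    show "L2 {0..T} (\<lambda>t. clip (g n t))" for n by (rule L2_bounded_Icc(1)[OF gm clip_b])
    show "approximable (\<lambda>t. clip (g n t))" for n by (rule approximable_continuous[OF gc])
    show "(\<lambda>n. nrm2 {0..T} (\<lambda>t. f t - clip (g n t))) \<longlonglongrightarrow> 0"
    proof (rule nrm2_tendsto_zero[where b = "\<lambda>_. (2 * B)\<^sup>2"])
      show "set_integrable lborel {0..T} (\<lambda>_. (2 * B)\<^sup>2)" unfolding set_integrable_def using T_pos by simp
      show "(cmod (f t - clip (g n t)))\<^sup>2 \<le> (2 * B)\<^sup>2" for n t
        using norm_triangle_ineq4[of "f t" "clip (g n t)"] B(1)[of t] clip_b[of "g n t"] by (intro power_mono) auto
      have "AE t in lebesgue. t \<notin> N" using N by (auto simp: negligible_iff_null_sets intro: AE_not_in)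
      then have "AE t in lborel. t \<notin> N" by (simp add: AE_completion_iff)
      then show "AE t in lborel. t \<in> {0..T} \<longrightarrow> (\<lambda>n. f t - clip (g n t)) \<longlonglongrightarrow> 0"
      proof eventually_elim
        case (elim t)
        have "(\<lambda>n. clip (g n t)) \<longlonglongrightarrow> clip (f t)"
          by (rule continuous_on_tendsto_compose[OF clip_c lim[OF elim]]) auto
        then have "(\<lambda>n. f t - clip (g n t)) \<longlonglongrightarrow> f t - f t" unfolding clip_id[OF B(1)] by (intro tendsto_intros)
        then show ?case by simp
      qed
    qed auto
  qed
qed

theorem approximable_L2:
  assumes f: "L2 {0..T} f"
  shows "approximable f"
proof -
  have [measurable]: "f \<in> borel_measurable borel" using f by (simp add: L2_iff)
  define fn where "fn n t = (if cmod (f t) \<le> real (Suc n) then f t else 0)" for n t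
  have m[measurable]: "fn n \<in> borel_measurable borel" for n unfolding fn_def[abs_def] by measurable
  have b: "cmod (fn n t) \<le> real (Suc n)" for n t by (simp add: fn_def)
  show ?thesis
  proof (rule approximable_limit[OF f])
    show "L2 {0..T} (fn n)" for n by (rule L2_bounded_Icc(1)[OF m b])
    show "approximable (fn n)" for n by (rule approximable_bounded[OF m b]) simp
    show "(\<lambda>n. nrm2 {0..T} (\<lambda>t. f t - fn n t)) \<longlonglongrightarrow> 0"
    proof (rule nrm2_tendsto_zero[where b = "\<lambda>t. (cmod (f t))\<^sup>2"])
      show "set_integrable lborel {0..T} (\<lambda>t. (cmod (f t))\<^sup>2)" using f by (simp add: L2_iff)
      show "(cmod (f t - fn n t))\<^sup>2 \<le> (cmod (f t))\<^sup>2" for n t by (simp add: fn_def)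
      have "(\<lambda>n. f t - fn n t) \<longlonglongrightarrow> 0" for t
      proof (rule tendsto_eventually)
        have "\<forall>\<^sub>F n in sequentially. cmod (f t) \<le> real n"
          using filterlim_real_sequentially unfolding filterlim_at_top by blast
        then show "\<forall>\<^sub>F n in sequentially. f t - fn n t = 0" by eventually_elim (simp add: fn_def)
      qed
      then show "AE t in lborel. t \<in> {0..T} \<longrightarrow> (\<lambda>n. f t - fn n t) \<longlonglongrightarrow> 0" by simp
    qed auto
  qed
qed

text \<open>If an approximating polynomial has its frequencies in \<open>F0\<close>, then for every
  finite \<open>F\<close> containing \<open>F0\<close> the Fourier coefficients over
  \<open>F\<close> do at least as well.\<close>

theorem fourier_expansion:
  assumes f: "L2 {0..T} f"
  shows "((\<lambda>F. nrm2 {0..T} (\<lambda>t. f t - (\<Sum>l\<in>F. coef f l / T * e l t))) \<longlongrightarrow> 0) (finite_subsets_at_top UNIV)"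
proof (rule order_tendstoI)
  fix a :: real assume "a < 0"
  then show "\<forall>\<^sub>F F in finite_subsets_at_top UNIV. a < nrm2 {0..T} (\<lambda>t. f t - (\<Sum>l\<in>F. coef f l / T * e l t))"
    by (intro always_eventually allI less_le_trans[OF _ nrm2_nonneg])
next
  fix \<epsilon> :: real assume "0 < \<epsilon>"
  then obtain u where u: "trig_poly T u" "nrm2 {0..T} (\<lambda>t. f t - u t) < \<epsilon>"
    using approximable_L2[OF f] unfolding approximable_def by blast
  obtain F0 c where F0: "finite F0" and u_eq: "u = (\<lambda>t. \<Sum>l\<in>F0. c l * e l t)"
    using trig_poly_eq_sum[OF u(1)] unfolding e_def by blast
  show "\<forall>\<^sub>F F in finite_subsets_at_top UNIV. nrm2 {0..T} (\<lambda>t. f t - (\<Sum>l\<in>F. coef f l / T * e l t)) < \<epsilon>"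
    unfolding eventually_finite_subsets_at_top
  proof (intro exI[of _ F0] conjI allI impI F0 subset_UNIV)
    fix F assume "finite F \<and> F0 \<subseteq> F \<and> F \<subseteq> UNIV"
    then have F: "finite F" "F0 \<subseteq> F" by auto
    let ?c = "\<lambda>l. if l \<in> F0 then c l else 0"
    have u': "u = (\<lambda>t. \<Sum>l\<in>F. ?c l * e l t)"
      unfolding u_eq using F by (intro ext sum.mono_neutral_cong_left) auto
    have "nrm2 {0..T} (\<lambda>t. f t - (\<Sum>l\<in>F. coef f l / T * e l t)) = nrm2 {0..T} f - (\<Sum>l\<in>F. (cmod (coef f l))\<^sup>2) / T"
      unfolding approximation_identity[OF f F(1)] by simp
    also have "\<dots> \<le> nrm2 {0..T} (\<lambda>t. f t - u t)"
      unfolding u' approximation_identity[OF f F(1)] using T_pos by (simp add: sum_nonneg)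
    also have "\<dots> < \<epsilon>" by (rule u(2))
    finally show "nrm2 {0..T} (\<lambda>t. f t - (\<Sum>l\<in>F. coef f l / T * e l t)) < \<epsilon>" .
  qed
qed

theorem parseval:
  assumes f: "L2 {0..T} f"
  shows "((\<lambda>l. (cmod (coef f l))\<^sup>2) has_sum T * nrm2 {0..T} f) UNIV"
proof -
  have "\<forall>\<^sub>F F in finite_subsets_at_top UNIV. T * nrm2 {0..T} f - T * nrm2 {0..T} (\<lambda>t. f t - (\<Sum>l\<in>F. coef f l / T * e l t))
      = (\<Sum>l\<in>F. (cmod (coef f l))\<^sup>2)"
    using eventually_finite_subsets_at_top_weakI[of UNIV finite]
  proof (rule eventually_mono)
    fix F :: "int set" assume F: "finite F"
    have *: "nrm2 {0..T} (\<lambda>t. f t - (\<Sum>l\<in>F. coef f l / T * e l t)) = nrm2 {0..T} f - (\<Sum>l\<in>F. (cmod (coef f l))\<^sup>2) / T"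
      unfolding approximation_identity[OF f F] by simp
    show "T * nrm2 {0..T} f - T * nrm2 {0..T} (\<lambda>t. f t - (\<Sum>l\<in>F. coef f l / T * e l t)) = (\<Sum>l\<in>F. (cmod (coef f l))\<^sup>2)"
      unfolding * using T_pos by (simp add: right_diff_distrib)
  qed auto
  moreover have "((\<lambda>F. T * nrm2 {0..T} f - T * nrm2 {0..T} (\<lambda>t. f t - (\<Sum>l\<in>F. coef f l / T * e l t)))
      \<longlongrightarrow> T * nrm2 {0..T} f - T * 0) (finite_subsets_at_top UNIV)"
    by (intro tendsto_intros fourier_expansion[OF f])
  ultimately show ?thesis unfolding has_sum_def by (auto elim: Lim_transform_eventually[rotated])
qed

end

section \<open>Periodization\<close>

lemma periodic_int:
  fixes f :: "real \<Rightarrow> 'a"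
  assumes "\<And>t. f (t + K) = f t"
  shows "f (t + K * of_int j) = f t"
proof -
  have nat: "f (t + K * real n) = f t" for t n
  proof (induction n)
    case (Suc n)
    have "f (t + K * real (Suc n)) = f ((t + K * real n) + K)" by (simp add: algebra_simps)
    then show ?case using Suc assms by simp
  qed simp
  show ?thesis
  proof (cases "j \<ge> 0")
    case True
    then show ?thesis using nat[of t "nat j"] by simp
  next
    case False
    then show ?thesis using nat[of "t + K * of_int j" "nat (- j)"] by simp
  qed
qed

lemma summable_on_exp_abs_int:
  fixes c :: real assumes c: "c > 0"
  shows "(\<lambda>k::int. exp (- c * \<bar>of_int k\<bar>)) summable_on UNIV"
proof -
  have "(\<lambda>n. exp (- c) ^ n) summable_on (UNIV :: nat set)"
    by (subst summable_on_UNIV_nonneg_real_iff) (use c in \<open>auto intro: summable_geometric\<close>)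
  then have s: "(\<lambda>n::nat. exp (- c * real n)) summable_on UNIV"
    by (simp add: exp_of_nat_mult[symmetric] mult.commute)
  have "(\<lambda>k::int. exp (- c * \<bar>of_int k\<bar>)) summable_on (range int)"
    by (subst summable_on_reindex) (use s in \<open>auto simp: o_def\<close>)
  moreover have "(\<lambda>k::int. exp (- c * \<bar>of_int k\<bar>)) summable_on (range (\<lambda>n. - int n))"
    by (subst summable_on_reindex) (use s in \<open>auto simp: o_def inj_on_def\<close>)
  ultimately have "(\<lambda>k::int. exp (- c * \<bar>of_int k\<bar>)) summable_on (range int \<union> range (\<lambda>n. - int n))"
    by (rule summable_on_union)
  moreover have "range int \<union> range (\<lambda>n. - int n) = UNIV"
  proof -
    have "k \<in> range int \<union> range (\<lambda>n. - int n)" for k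
      by (cases k rule: int_cases2) auto
    then show ?thesis by blast
  qed
  ultimately show ?thesis by simp
qed

text \<open>For \<open>y\<close> in the basic period, \<open>\<bar>y - k * K\<bar>\<close> is at
  least \<open>\<bar>k\<bar> * K - K\<close>, which gives the summable majorant \<open>b\<close>
  independent of \<open>y\<close>; the factor \<open>exp (c * K)\<close> pays for the missing
  \<open>K\<close>. Reindexing by \<open>j\<close> extends this to all \<open>x\<close>.\<close>

lemma periodize_bound:
  assumes h: "exp_decay h" and K: "K > 0"
  shows "\<exists>D. D \<ge> 0 \<and> (\<forall>x. (\<lambda>k::int. h (x - of_int k * K)) summable_on UNIV \<and> \<bar>periodize K h x\<bar> \<le> D)"
proof -
  obtain B c where c: "c > 0" "\<And>x. \<bar>h x\<bar> \<le> B * exp (- c * \<bar>x\<bar>)" using h by (auto simp: exp_decay_def)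
  have B: "B \<ge> 0" using c(2)[of 0] by simp
  define b where "b k = B * exp (c * K) * exp (- (c * K) * \<bar>of_int k\<bar>)" for k :: int
  have b: "b summable_on UNIV" unfolding b_def
    by (intro summable_on_cmult_right summable_on_exp_abs_int) (use c K in simp)
  have "(\<lambda>k::int. h (x - of_int k * K)) summable_on UNIV \<and> \<bar>periodize K h x\<bar> \<le> infsum b UNIV" for x
  proof -
    define j where "j = \<lfloor>x / K\<rfloor>"
    define y where "y = x - of_int j * K"
    have y: "0 \<le> y" "y < K"
      using K floor_divide_lower[of K x] floor_divide_upper[of K x] by (auto simp: y_def j_def algebra_simps)
    have le: "\<bar>h (y - of_int k * K)\<bar> \<le> b k" for k
    proof -
      have "\<bar>of_int k\<bar> * K = \<bar>of_int k * K\<bar>" using K by (simp add: abs_mult)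
      then have "\<bar>of_int k\<bar> * K - K \<le> \<bar>y - of_int k * K\<bar>" using y by linarith
      then have "c * (\<bar>of_int k\<bar> * K - K) \<le> c * \<bar>y - of_int k * K\<bar>" using c(1) by (intro mult_left_mono) auto
      then have "exp (- c * \<bar>y - of_int k * K\<bar>) \<le> exp (c * K + - (c * K) * \<bar>of_int k\<bar>)" by (simp add: algebra_simps)
      then have "B * exp (- c * \<bar>y - of_int k * K\<bar>) \<le> b k"
        using B unfolding b_def exp_add mult.assoc by (intro mult_left_mono) auto
      with c(2) show ?thesis by (rule order_trans)
    qed
    have abs: "(\<lambda>k. norm (h (y - of_int k * K))) summable_on UNIV"
      by (rule summable_on_comparison_test[OF b]) (use le in auto)
    then have sy: "(\<lambda>k. h (y - of_int k * K)) summable_on UNIV" by (rule abs_summable_summable)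
    have bij: "bij_betw (\<lambda>k::int. k + j) UNIV UNIV" by (rule bij_betwI[where g = "\<lambda>k. k - j"]) auto
    have shift: "h (x - of_int (k + j) * K) = h (y - of_int k * K)" for k by (simp add: y_def algebra_simps)
    have sx: "(\<lambda>k. h (x - of_int k * K)) summable_on UNIV"
      using summable_on_reindex_bij_betw[OF bij, of "\<lambda>k. h (x - of_int k * K)"] sy unfolding shift by simp
    have "periodize K h x = (\<Sum>\<^sub>\<infinity>k. h (y - of_int k * K))"
      unfolding periodize_def
      using infsum_reindex_bij_betw[OF bij, of "\<lambda>k. h (x - of_int k * K)"] unfolding shift by simp
    also have "\<bar>\<dots>\<bar> \<le> (\<Sum>\<^sub>\<infinity>k. \<bar>h (y - of_int k * K)\<bar>)"
      using norm_infsum_bound[OF abs] by simp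
    also have "\<dots> \<le> infsum b UNIV"
      using abs b le by (intro infsum_mono) auto
    finally show ?thesis using sx by simp
  qed
  moreover have "infsum b UNIV \<ge> 0" using B by (intro infsum_nonneg) (simp add: b_def)
  ultimately show ?thesis by blast
qed

lemma periodize_has_sum:
  assumes "exp_decay h" "K > 0"
  shows "((\<lambda>k::int. h (x - of_int k * K)) has_sum periodize K h x) UNIV"
  using periodize_bound[OF assms] unfolding periodize_def by (auto intro: has_sum_infsum)

lemma periodize_periodic: "periodize K h (x + K) = periodize K h x"
proof -
  have bij: "bij_betw (\<lambda>k::int. k + 1) UNIV UNIV" by (rule bij_betwI[where g = "\<lambda>k. k - 1"]) auto
  have "h (x + K - of_int (k + 1) * K) = h (x - of_int k * K)" for k :: int by (simp add: algebra_simps)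
  then show ?thesis unfolding periodize_def
    using infsum_reindex_bij_betw[OF bij, of "\<lambda>k. h (x + K - of_int k * K)"] by simp
qed

lemma has_sum_finite_sum:
  fixes f :: "'a \<Rightarrow> 'b \<Rightarrow> real"
  assumes "finite F" "\<And>i. i \<in> F \<Longrightarrow> (f i has_sum S i) A"
  shows "((\<lambda>x. \<Sum>i\<in>F. f i x) has_sum (\<Sum>i\<in>F. S i)) A"
  using assms by (induction F rule: finite_induct) (auto intro: has_sum_add)

lemma has_sum_int_sequentially:
  fixes f :: "int \<Rightarrow> real"
  assumes "(f has_sum S) UNIV"
  shows "(\<lambda>n. \<Sum>k\<in>{- int n..int n}. f k) \<longlonglongrightarrow> S"
proof -
  have "filterlim (\<lambda>n. {- int n..int n}) (finite_subsets_at_top UNIV) sequentially"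
    unfolding filterlim_finite_subsets_at_top
  proof (intro allI impI)
    fix X :: "int set" assume X: "finite X \<and> X \<subseteq> UNIV"
    define b where "b = Max (insert 0 (abs ` X))"
    have b: "\<bar>k\<bar> \<le> b" if "k \<in> X" for k unfolding b_def by (rule Max_ge) (use X that in auto)
    show "\<forall>\<^sub>F n in sequentially. finite {- int n..int n} \<and> X \<subseteq> {- int n..int n} \<and> {- int n..int n} \<subseteq> UNIV"
      unfolding eventually_sequentially
    proof (intro exI[of _ "nat b"] allI impI conjI subsetI)
      fix n k assume "nat b \<le> n" "k \<in> X"
      then show "k \<in> {- int n..int n}" using b[of k] by auto
    qed auto
  qed
  with assms show ?thesis unfolding has_sum_def by (rule filterlim_compose)
qed

lemma periodize_measurable:
  assumes h: "exp_decay h" and K: "K > 0"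
  shows "periodize K h \<in> borel_measurable borel"
proof (rule borel_measurable_LIMSEQ_real)
  show "(\<lambda>n. \<Sum>k\<in>{- int n..int n}. h (x - of_int k * K)) \<longlonglongrightarrow> periodize K h x" for x
    by (rule has_sum_int_sequentially[OF periodize_has_sum[OF h K]])
  have [measurable]: "h \<in> borel_measurable borel" using h by (rule exp_decay_measurable)
  show "(\<lambda>x. \<Sum>k\<in>{- int n..int n}. h (x - of_int k * K)) \<in> borel_measurable borel" for n
    by measurable
qed

text \<open>Translating \<open>t + \<alpha> * i\<close> by multiples of
  \<open>K = \<alpha> * N\<close> runs through the lattice points with index congruent to
  \<open>i\<close> modulo \<open>N\<close>. Periodization therefore sorts the finite support into
  residue classes.\<close>

lemma periodize_finite_support:
  fixes \<gamma> :: "real \<Rightarrow> real"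
  assumes fin: "finite L" "\<And>l::int. \<gamma> (t + \<alpha> * of_int l) \<noteq> 0 \<Longrightarrow> l \<in> L" and K: "K = \<alpha> * real N" and N: "N > 0" and i: "i < N"
  shows "periodize K \<gamma> (t + \<alpha> * real i) = (\<Sum>l\<in>{l\<in>L. nat (l mod int N) = i}. \<gamma> (t + \<alpha> * of_int l))"
proof -
  let ?A = "{l\<in>L. nat (l mod int N) = i}"
  let ?j = "\<lambda>l. (int i - l) div int N"
  have j: "l = int i - ?j l * int N" if "l \<in> ?A" for l
  proof -
    have "l mod int N = int i" using that N by auto
    then have "int N dvd int i - l" by (metis mod_eq_dvd_iff mod_mod_trivial)
    then show ?thesis by simp
  qed
  have val: "\<gamma> (t + \<alpha> * real i - of_int n * K) = \<gamma> (t + \<alpha> * of_int (int i - n * int N))" for n :: int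
    by (simp add: K algebra_simps)
  have "((\<lambda>n::int. \<gamma> (t + \<alpha> * real i - of_int n * K)) has_sum (\<Sum>l\<in>?A. \<gamma> (t + \<alpha> * of_int l))) UNIV"
  proof (rule has_sum_finite_neutralI)
    show "finite (?j ` ?A)" using fin(1) by simp
    show "\<gamma> (t + \<alpha> * real i - of_int n * K) = 0" if "n \<in> UNIV - ?j ` ?A" for n
    proof (rule ccontr)
      assume "\<not> ?thesis"
      then have "int i - n * int N \<in> L" unfolding val by (rule fin(2))
      moreover have "nat ((int i - n * int N) mod int N) = i" using i by (simp add: mod_diff_eq flip: mod_diff_right_eq)
      ultimately have "int i - n * int N \<in> ?A" by simp
      then have "?j (int i - n * int N) \<in> ?j ` ?A" by (rule imageI)
      moreover have "?j (int i - n * int N) = n" using N by simp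
      ultimately show False using that by simp
    qed
    have "inj_on ?j ?A"
    proof (rule inj_onI)
      fix x y assume xy: "x \<in> ?A" "y \<in> ?A" "?j x = ?j y"
      show "x = y" using j[OF xy(1)] j[OF xy(2)] unfolding xy(3) by simp
    qed
    then have "(\<Sum>n\<in>?j ` ?A. \<gamma> (t + \<alpha> * real i - of_int n * K)) = (\<Sum>l\<in>?A. \<gamma> (t + \<alpha> * real i - of_int (?j l) * K))"
      by (simp add: sum.reindex)
    also have "\<dots> = (\<Sum>l\<in>?A. \<gamma> (t + \<alpha> * of_int l))"
      unfolding val by (intro sum.cong refl) (simp add: j[symmetric])
    finally show "(\<Sum>l\<in>?A. \<gamma> (t + \<alpha> * of_int l)) = (\<Sum>n\<in>?j ` ?A. \<gamma> (t + \<alpha> * real i - of_int n * K))" ..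
  qed simp
  then show ?thesis unfolding periodize_def by (rule infsumI)
qed

text \<open>The residue classes turn the sum over \<open>N\<close> points into a sum over the
  support of \<gamma> on the whole lattice, since the periodized \<open>g\<close> does not notice
  the class representative. Expanding that periodization, the translate by \<open>n * K\<close>
  replaces \<open>k\<close> by \<open>k + n * R\<close>; a nonzero term occurs just for
  \<open>k + n * R = 0\<close>, which is solvable if and only if \<open>R\<close> divides
  \<open>k\<close>. As \<open>L\<close> is finite, no infinite sums are interchanged.\<close>

theorem periodize_biorthogonal:
  fixes g \<gamma> :: "real \<Rightarrow> real"
  assumes g: "exp_decay g" and fin: "\<And>t. finite {i::int. \<gamma> (t + \<alpha> * of_int i) \<noteq> 0}"
    and bi: "\<And>t k. ((\<lambda>i::int. \<gamma> (t + \<alpha> * of_int i) * g (t + \<alpha> * of_int i - of_int k * \<kappa>)) has_sum (if k = 0 then \<beta> else 0)) UNIV"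
    and K: "K = \<alpha> * real N" "K = \<kappa> * real R" "N > 0" "R > 0" "K > 0"
  shows "(\<Sum>i<N. periodize K \<gamma> (t + \<alpha> * real i) * periodize K g (t + \<alpha> * real i - of_int k * \<kappa>))
    = (if int R dvd k then \<beta> else 0)"
proof -
  define L where "L = {i::int. \<gamma> (t + \<alpha> * of_int i) \<noteq> 0}"
  have L: "finite L" "\<And>l. \<gamma> (t + \<alpha> * of_int l) \<noteq> 0 \<Longrightarrow> l \<in> L" using fin[of t] by (auto simp: L_def)
  let ?\<Phi> = "periodize K g"
  have per: "?\<Phi> (t + \<alpha> * real i - of_int k * \<kappa>) = ?\<Phi> (t + \<alpha> * of_int l - of_int k * \<kappa>)"
    if "nat (l mod int N) = i" for l i
  proof -
    have "l = int i + int N * (l div int N)" using that K(3) by auto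
    then have "of_int l = real i + real N * of_int (l div int N)" by (metis of_int_add of_int_mult of_int_of_nat_eq)
    then have "t + \<alpha> * of_int l - of_int k * \<kappa> = (t + \<alpha> * real i - of_int k * \<kappa>) + K * of_int (l div int N)"
      by (simp add: K(1) algebra_simps)
    then show ?thesis by (simp only: periodic_int[of ?\<Phi> K, OF periodize_periodic])
  qed
  have "(\<Sum>i<N. periodize K \<gamma> (t + \<alpha> * real i) * ?\<Phi> (t + \<alpha> * real i - of_int k * \<kappa>))
      = (\<Sum>i<N. \<Sum>l\<in>{l\<in>L. nat (l mod int N) = i}. \<gamma> (t + \<alpha> * of_int l) * ?\<Phi> (t + \<alpha> * of_int l - of_int k * \<kappa>))"
  proof (intro sum.cong refl)
    fix i assume "i \<in> {..<N}"
    then have eq: "periodize K \<gamma> (t + \<alpha> * real i) = (\<Sum>l\<in>{l\<in>L. nat (l mod int N) = i}. \<gamma> (t + \<alpha> * of_int l))"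
      by (intro periodize_finite_support[OF L K(1,3)]) auto
    show "periodize K \<gamma> (t + \<alpha> * real i) * ?\<Phi> (t + \<alpha> * real i - of_int k * \<kappa>)
        = (\<Sum>l\<in>{l\<in>L. nat (l mod int N) = i}. \<gamma> (t + \<alpha> * of_int l) * ?\<Phi> (t + \<alpha> * of_int l - of_int k * \<kappa>))"
      unfolding eq sum_distrib_right
    proof (rule sum.cong[OF refl])
      fix l assume "l \<in> {l\<in>L. nat (l mod int N) = i}"
      then have "nat (l mod int N) = i" by simp
      from per[OF this] show "\<gamma> (t + \<alpha> * of_int l) * ?\<Phi> (t + \<alpha> * real i - of_int k * \<kappa>)
        = \<gamma> (t + \<alpha> * of_int l) * ?\<Phi> (t + \<alpha> * of_int l - of_int k * \<kappa>)" by simp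
    qed
  qed
  also have "\<dots> = (\<Sum>l\<in>L. \<gamma> (t + \<alpha> * of_int l) * ?\<Phi> (t + \<alpha> * of_int l - of_int k * \<kappa>))"
    by (rule sum.group) (use L K(3) in \<open>auto simp: nat_less_iff\<close>)
  also have "\<dots> = (if int R dvd k then \<beta> else 0)"
  proof (rule has_sum_unique)
    show "((\<lambda>n::int. \<Sum>l\<in>L. \<gamma> (t + \<alpha> * of_int l) * g (t + \<alpha> * of_int l - of_int k * \<kappa> - of_int n * K)) has_sum
        (\<Sum>l\<in>L. \<gamma> (t + \<alpha> * of_int l) * ?\<Phi> (t + \<alpha> * of_int l - of_int k * \<kappa>))) UNIV"
      by (intro has_sum_finite_sum L(1) has_sum_cmult_right periodize_has_sum g K(5))
    have inner: "(\<Sum>l\<in>L. \<gamma> (t + \<alpha> * of_int l) * g (t + \<alpha> * of_int l - of_int k * \<kappa> - of_int n * K)) = (if k + n * int R = 0 then \<beta> else 0)" for n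
    proof (rule has_sum_unique)
      show "((\<lambda>i::int. \<gamma> (t + \<alpha> * of_int i) * g (t + \<alpha> * of_int i - of_int (k + n * int R) * \<kappa>)) has_sum (if k + n * int R = 0 then \<beta> else 0)) UNIV"
        by (rule bi)
      have eq: "t + \<alpha> * of_int l - of_int k * \<kappa> - of_int n * K = t + \<alpha> * of_int l - of_int (k + n * int R) * \<kappa>" for l
        by (simp add: K(2) algebra_simps)
      show "((\<lambda>i::int. \<gamma> (t + \<alpha> * of_int i) * g (t + \<alpha> * of_int i - of_int (k + n * int R) * \<kappa>)) has_sum
          (\<Sum>l\<in>L. \<gamma> (t + \<alpha> * of_int l) * g (t + \<alpha> * of_int l - of_int k * \<kappa> - of_int n * K))) UNIV"
        unfolding eq by (rule has_sum_finite_neutralI[OF L(1)]) (use L(2) in auto)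
    qed
    show "((\<lambda>n::int. \<Sum>l\<in>L. \<gamma> (t + \<alpha> * of_int l) * g (t + \<alpha> * of_int l - of_int k * \<kappa> - of_int n * K)) has_sum
        (if int R dvd k then \<beta> else 0)) UNIV"
      unfolding inner
    proof (cases "int R dvd k")
      case True
      then obtain z where z: "k = int R * z" by auto
      have "k + n * int R = 0 \<longleftrightarrow> n = - z" for n
      proof -
        have "k + n * int R = int R * (z + n)" by (simp add: z algebra_simps)
        then show ?thesis using K(4) by auto
      qed
      then show "((\<lambda>n. if k + n * int R = 0 then \<beta> else 0) has_sum (if int R dvd k then \<beta> else 0)) UNIV"
        using True by (intro has_sum_finite_neutralI[of "{- z}"]) (auto simp: z)
    next
      case False
      have "k + n * int R \<noteq> 0" for n
      proof
        assume "k + n * int R = 0"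
        then have "k = int R * (- n)" by (simp add: algebra_simps)
        then show False using False by (metis dvd_triv_left)
      qed
      then show "((\<lambda>n. if k + n * int R = 0 then \<beta> else 0) has_sum (if int R dvd k then \<beta> else 0)) UNIV"
        using False by (simp add: has_sum_0)
    qed
  qed
  finally show ?thesis .
qed

section \<open>Gabor families on the torus\<close>

lemma set_integral_fold:
  fixes u :: "real \<Rightarrow> 'b::{banach, second_countable_topology}"
  assumes T: "T \<ge> 0" and u: "set_integrable lborel {0..real n * T} u"
  shows "(\<forall>s<n. set_integrable lborel {0..T} (\<lambda>t. u (t + real s * T))) \<and>
    (LINT t:{0..real n * T}|lborel. u t) = (\<Sum>s<n. LINT t:{0..T}|lborel. u (t + real s * T))"
  using u
proof (induction n)
  case 0
  have "(LINT t|lborel. indicator {0..0} t *\<^sub>R u t) = 0"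
  proof (rule integral_eq_zero_AE)
    show "AE t in lborel. indicator {0..0} t *\<^sub>R u t = 0"
      using AE_lborel_singleton[of 0] by eventually_elim (simp add: indicator_def)
  qed
  then show ?case by (simp add: set_lebesgue_integral_def)
next
  case (Suc n)
  let ?a = "real n * T"
  have a0: "0 \<le> ?a" using T by simp
  have "{0..A + T} = {0..A} \<union> {A<..A + T}" "{A..A + T} \<subseteq> {0..A + T}" if "A \<ge> 0" for A using that T by auto
  note * = this[OF a0]
  have suc: "real (Suc n) * T = ?a + T" by (simp add: algebra_simps)
  have eq: "{0..real (Suc n) * T} = {0..?a} \<union> {?a<..?a + T}" unfolding suc by (rule *(1))
  have sub: "set_integrable lborel A u" if "A \<subseteq> {0..real (Suc n) * T}" "A \<in> sets borel" for A
    by (rule set_integrable_subset[OF Suc.prems]) (use that in auto)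
  have 1: "set_integrable lborel {0..?a} u" by (rule sub) (unfold eq, auto)
  have 2: "set_integrable lborel {?a<..?a + T} u" by (rule sub) (unfold eq, auto)
  have 3: "set_integrable lborel {?a..?a + T} u" by (rule sub) (unfold suc, auto simp: *(2))
  have ind: "indicator {?a..?a + T} (?a + 1 * t) = (indicator {0..T} t :: real)" for t
    by (auto simp: indicator_def)
  have 4: "set_integrable lborel {0..T} (\<lambda>t. u (t + ?a))"
    using lborel_integrable_real_affine[OF 3[unfolded set_integrable_def], of 1 ?a]
    unfolding set_integrable_def ind by (simp add: add.commute)
  have 5: "(LINT t:{?a..?a + T}|lborel. u t) = (LINT t:{0..T}|lborel. u (t + ?a))"
    using lborel_integral_real_affine[of 1 "\<lambda>t. indicator {?a..?a + T} t *\<^sub>R u t" ?a]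
    unfolding set_lebesgue_integral_def ind by (simp add: add.commute)
  have "(LINT t:{0..real (Suc n) * T}|lborel. u t) = (LINT t:{0..?a}|lborel. u t) + (LINT t:{?a<..?a + T}|lborel. u t)"
    unfolding eq by (rule set_integral_Un[OF _ 1 2]) auto
  also have "(LINT t:{?a<..?a + T}|lborel. u t) = (LINT t:{?a..?a + T}|lborel. u t)"
  proof (rule set_integral_cong_set)
    show "set_borel_measurable lborel {?a<..?a + T} u" "set_borel_measurable lborel {?a..?a + T} u"
      using 2 3 unfolding set_integrable_def set_borel_measurable_def by auto
    show "AE x in lborel. (x \<in> {?a..?a + T}) = (x \<in> {?a<..?a + T})"
      using AE_lborel_singleton[of ?a] by eventually_elim auto
  qed
  finally show ?case using Suc.IH[OF 1] 4 5 by (auto simp: less_Suc_eq)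
qed

lemma L2_lincomb:
  fixes B :: real
  assumes F: "finite F" and S: "S \<in> sets borel" and f: "\<And>i. i \<in> F \<Longrightarrow> L2 S (f i)"
    and u: "\<And>i. u i \<in> borel_measurable borel" "\<And>i t. cmod (u i t) \<le> B"
  shows "L2 S (\<lambda>t. \<Sum>i\<in>F. u i t * f i t)"
    and "nrm2 S (\<lambda>t. \<Sum>i\<in>F. u i t * f i t) \<le> card F * B\<^sup>2 * (\<Sum>i\<in>F. nrm2 S (f i))"
proof -
  have int: "set_integrable lborel S (\<lambda>t. \<Sum>i\<in>F. (cmod (f i t))\<^sup>2)"
    and int_eq: "(LINT t:S|lborel. \<Sum>i\<in>F. (cmod (f i t))\<^sup>2) = (\<Sum>i\<in>F. nrm2 S (f i))"
    unfolding nrm2_def using f by (auto intro!: set_integral_sum simp: L2_iff)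
  have m: "(\<lambda>t. \<Sum>i\<in>F. u i t * f i t) \<in> borel_measurable borel"
    using f u by (intro borel_measurable_sum borel_measurable_times) (auto simp: L2_iff)
  have le: "(cmod (\<Sum>i\<in>F. u i t * f i t))\<^sup>2 \<le> card F * B\<^sup>2 * (\<Sum>i\<in>F. (cmod (f i t))\<^sup>2)" for t
  proof -
    have "(cmod (\<Sum>i\<in>F. u i t * f i t))\<^sup>2 \<le> (\<Sum>i\<in>F. cmod (u i t * f i t))\<^sup>2"
      by (intro power_mono norm_sum) auto
    also have "\<dots> \<le> card F * (\<Sum>i\<in>F. (cmod (u i t * f i t))\<^sup>2)" by (rule sum_square_le_card[OF F])
    also have "\<dots> \<le> card F * (\<Sum>i\<in>F. B\<^sup>2 * (cmod (f i t))\<^sup>2)"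
      unfolding norm_mult power_mult_distrib
      by (intro mult_left_mono sum_mono mult_right_mono power_mono u) auto
    finally show ?thesis by (simp add: sum_distrib_left mult.assoc)
  qed
  note * = L2_bound[OF m set_integrable_mult_right[OF int] S le]
  show "L2 S (\<lambda>t. \<Sum>i\<in>F. u i t * f i t)" by (rule *(1))
  show "nrm2 S (\<lambda>t. \<Sum>i\<in>F. u i t * f i t) \<le> card F * B\<^sup>2 * (\<Sum>i\<in>F. nrm2 S (f i))"
    using *(2) by (simp add: int_eq)
qed

lemma has_sum_finite_Times:
  fixes f :: "'a \<times> 'b \<Rightarrow> real"
  assumes "finite A" and "\<And>x. x \<in> A \<Longrightarrow> ((\<lambda>y. f (x, y)) has_sum S x) B"
  shows "(f has_sum (\<Sum>x\<in>A. S x)) (A \<times> B)"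
  using assms
proof (induction A rule: finite_induct)
  case (insert x A)
  have "(f has_sum S x) (Pair x ` B)"
    by (subst has_sum_reindex) (use insert in \<open>auto simp: o_def inj_on_def\<close>)
  then have "(f has_sum (S x + (\<Sum>x\<in>A. S x))) (Pair x ` B \<union> A \<times> B)"
    using insert by (intro has_sum_Un_disjoint) auto
  moreover have "Pair x ` B \<union> A \<times> B = insert x A \<times> B" by auto
  ultimately show ?case using insert by simp
qed simp

section \<open>Folding the torus onto one modulation period\<close>

locale torus =
  fixes K a M :: nat
  assumes pos: "a > 0" "K > 0" "M > 0" and dvd: "a dvd K" "M dvd K"
begin

sublocale fourier_series "real M" by unfold_locales (use pos in simp)

abbreviation (input) "N \<equiv> K div a"
abbreviation (input) "R \<equiv> K div M"
abbreviation (input) "S \<equiv> {0..real K}"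

lemma K_eq: "real K = real R * real M" "real K = real N * real a" and NR_pos: "N > 0" "R > 0"
proof -
  have "K = R * M" "K = N * a" using dvd by simp_all
  then show "real K = real R * real M" "real K = real N * real a" "N > 0" "R > 0"
    using pos by (auto simp flip: of_nat_mult intro: gr0I)
qed

lemma e_periodic: "e l (t + real s * real M) = e l t"
proof -
  have "e l (t + real s * real M) = e l t * cis (2 * pi * (of_int l * of_int (int s)))"
    using pos by (simp add: e_def cis_mult field_simps)
  also have "cis (2 * pi * (of_int l * of_int (int s))) = 1"
    by (intro cis_multiple_2pi Ints_mult Ints_of_int)
  finally show ?thesis by simp
qed

text \<open>\<open>B \<ge> 1\<close> keeps the constants built from \<open>B\<close> in the frame
  and Riesz bounds strictly positive.\<close>

definition window :: "(real \<Rightarrow> real) \<Rightarrow> real \<Rightarrow> bool" where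
  "window \<phi> B \<longleftrightarrow> \<phi> \<in> borel_measurable borel \<and> (\<forall>t. \<phi> (t + real K) = \<phi> t) \<and> (\<forall>t. \<bar>\<phi> t\<bar> \<le> B) \<and> B \<ge> 1"

abbreviation (input) gab :: "(real \<Rightarrow> real) \<Rightarrow> nat \<times> int \<Rightarrow> real \<Rightarrow> complex" where
  "gab \<phi> \<equiv> gaborT (real K) (real a) (1 / real M) (\<lambda>t. complex_of_real (\<phi> t))"

lemma gab_eq: "window \<phi> B \<Longrightarrow> gab \<phi> (k, l) t = complex_of_real (\<phi> (t - real k * real a)) * e l t"
proof -
  assume w: "window \<phi> B"
  have "rmod s (real K) = s + real K * of_int (- \<lfloor>s / real K\<rfloor>)" for s by (simp add: rmod_def)
  then have "\<phi> (rmod s (real K)) = \<phi> s" for s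
    using w by (simp only: periodic_int[of \<phi> "real K"] window_def)
  then show ?thesis by (simp add: gaborT_def e_def)
qed

lemma window_measurable: "window \<phi> B \<Longrightarrow> \<phi> \<in> borel_measurable borel"
  unfolding window_def by blast

lemma window_bound: "window \<phi> B \<Longrightarrow> cmod (complex_of_real (\<phi> t)) \<le> B"
  unfolding window_def by simp

lemma gab_L2: assumes w: "window \<phi> B" shows "L2 S (gab \<phi> kl)"
proof -
  obtain k l where kl: "kl = (k, l)" by (cases kl)
  have [measurable]: "\<phi> \<in> borel_measurable borel" using w by (rule window_measurable)
  have eq: "gab \<phi> (k, l) = (\<lambda>t. complex_of_real (\<phi> (t - real k * real a)) * e l t)"
    by (rule ext) (rule gab_eq[OF w])
  have m: "(\<lambda>t. complex_of_real (\<phi> (t - real k * real a)) * e l t) \<in> borel_measurable borel" by measurable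
  have "cmod (complex_of_real (\<phi> (t - real k * real a)) * e l t) \<le> B" for t
    using window_bound[OF w] by (simp add: norm_mult)
  from L2_bounded_Icc(1)[OF m this] show ?thesis unfolding kl eq .
qed

lemma nrm2_fold:
  assumes f: "L2 S f"
  shows "s < R \<Longrightarrow> L2 {0..real M} (\<lambda>t. f (t + real s * real M))"
    and "nrm2 S f = (\<Sum>s<R. nrm2 {0..real M} (\<lambda>t. f (t + real s * real M)))"
proof -
  have [measurable]: "f \<in> borel_measurable borel" using f by (simp add: L2_iff)
  have "set_integrable lborel {0..real R * real M} (\<lambda>t. (cmod (f t))\<^sup>2)" using f unfolding L2_iff K_eq(1) by blast
  from set_integral_fold[OF _ this]
  show "s < R \<Longrightarrow> L2 {0..real M} (\<lambda>t. f (t + real s * real M))"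
    and "nrm2 S f = (\<Sum>s<R. nrm2 {0..real M} (\<lambda>t. f (t + real s * real M)))"
    unfolding L2_iff nrm2_def K_eq(1) by auto
qed

text \<open>The inner products of \<open>f\<close> with \<open>M\<^bsub>l/M\<^esub> T\<^bsub>ka\<^esub> \<phi>\<close>, \<open>l\<close> an integer, are the Fourier coefficients on \<open>[0, M]\<close>
  of \<open>fold \<phi> f k\<close>.\<close>
definition fold :: "(real \<Rightarrow> real) \<Rightarrow> (real \<Rightarrow> complex) \<Rightarrow> nat \<Rightarrow> real \<Rightarrow> complex" where
  "fold \<phi> f k t = (\<Sum>s<R. complex_of_real (\<phi> (t + real s * real M - real k * real a)) * f (t + real s * real M))"

lemma fold_L2:
  assumes w: "window \<phi> B" and f: "L2 S f"
  shows "L2 {0..real M} (fold \<phi> f k)" and "nrm2 {0..real M} (fold \<phi> f k) \<le> real R * B\<^sup>2 * nrm2 S f"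
proof -
  have [measurable]: "\<phi> \<in> borel_measurable borel" using w by (rule window_measurable)
  note b = window_bound[OF w]
  note * = L2_lincomb[of "{..<R}" "{0..real M}" "\<lambda>s t. f (t + real s * real M)"
      "\<lambda>s t. complex_of_real (\<phi> (t + real s * real M - real k * real a))" B, OF _ _ _ _ b]
  show "L2 {0..real M} (fold \<phi> f k)"
    unfolding fold_def[abs_def] by (rule *(1)) (use nrm2_fold(1)[OF f] in auto)
  show "nrm2 {0..real M} (fold \<phi> f k) \<le> real R * B\<^sup>2 * nrm2 S f"
    unfolding fold_def[abs_def] nrm2_fold(2)[OF f]
    using *(2) nrm2_fold(1)[OF f] by simp
qed

text \<open>The modulations \<open>e l\<close> have period \<open>M\<close> and
  \<open>K = R * M\<close>, so the integral over the torus folds into one integral over a single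
  period.\<close>

lemma ip_gab:
  assumes w: "window \<phi> B" and f: "L2 S f"
  shows "ip S f (gab \<phi> (k, l)) = coef (fold \<phi> f k) l"
proof -
  let ?u = "\<lambda>t. f t * cnj (gab \<phi> (k, l) t)"
  have "set_integrable lborel {0..real R * real M} ?u"
    using ip_integrable[OF _ f gab_L2[OF w]] unfolding K_eq(1) by simp
  from set_integral_fold[OF _ this]
  have int: "\<And>s. s < R \<Longrightarrow> set_integrable lborel {0..real M} (\<lambda>t. ?u (t + real s * real M))"
    and eq: "ip S f (gab \<phi> (k, l)) = (\<Sum>s<R. LINT t:{0..real M}|lborel. ?u (t + real s * real M))"
    unfolding ip_def K_eq(1) by auto
  have "ip S f (gab \<phi> (k, l)) = (LINT t:{0..real M}|lborel. \<Sum>s<R. ?u (t + real s * real M))"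
    unfolding eq by (rule set_integral_sum(2)[symmetric]) (use int in auto)
  also have "\<dots> = coef (fold \<phi> f k) l"
    unfolding coef_def ip_def fold_def gab_eq[OF w] e_periodic complex_cnj_mult complex_cnj_complex_of_real sum_distrib_right
    by (rule arg_cong[where f = "set_lebesgue_integral lborel _"], rule ext, rule sum.cong[OF refl])
      (simp only: mult.commute mult.left_commute)
  finally show ?thesis .
qed

lemma gab_parseval:
  assumes w: "window \<phi> B" and f: "L2 S f"
  shows "((\<lambda>i. (cmod (ip S f (gab \<phi> i)))\<^sup>2) has_sum (\<Sum>k<N. real M * nrm2 {0..real M} (fold \<phi> f k))) (gaborT_index K a)"
  unfolding gaborT_index_def atLeast0LessThan
  by (rule has_sum_finite_Times) (use parseval[OF fold_L2(1)[OF w f]] in \<open>auto simp: ip_gab[OF w f]\<close>)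

text \<open>The pointwise duality condition of Ron-Shen type, adapted to the torus: a shift by
  \<open>R * M = K\<close> acts trivially, so \<open>k\<close> matters only modulo
  \<open>R\<close>.\<close>

definition dual_pair :: "(real \<Rightarrow> real) \<Rightarrow> (real \<Rightarrow> real) \<Rightarrow> bool" where
  "dual_pair \<phi> \<psi> \<longleftrightarrow> (\<forall>t k. (\<Sum>i<N. \<psi> (t + real a * real i) * \<phi> (t + real a * real i - of_int k * real M))
     = (if int R dvd k then 1 / real M else 0))"

lemma dual_pair_sym: assumes "dual_pair \<phi> \<psi>" shows "dual_pair \<psi> \<phi>"
  unfolding dual_pair_def
proof (intro allI)
  fix t k
  have "(\<Sum>i<N. \<phi> (t + real a * real i) * \<psi> (t + real a * real i - of_int k * real M))
    = (\<Sum>i<N. \<psi> ((t - of_int k * real M) + real a * real i) * \<phi> ((t - of_int k * real M) + real a * real i - of_int (- k) * real M))"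
    by (intro sum.cong refl) (simp add: algebra_simps)
  also have "\<dots> = (if int R dvd - k then 1 / real M else 0)" using assms unfolding dual_pair_def by blast
  finally show "(\<Sum>i<N. \<phi> (t + real a * real i) * \<psi> (t + real a * real i - of_int k * real M))
     = (if int R dvd k then 1 / real M else 0)" by simp
qed

lemma dvd_diff_index: "int n dvd int i - int j \<longleftrightarrow> i = j" if "i < n" "j < n"
proof
  assume "int n dvd int i - int j"
  show "i = j"
  proof (rule ccontr)
    assume "i \<noteq> j"
    then have "\<bar>int n\<bar> \<le> \<bar>int i - int j\<bar>" by (intro dvd_imp_le_int \<open>int n dvd int i - int j\<close>) simp
    then show False using that by linarith
  qed
qed simp

lemma dual_pair_reconstruct:
  assumes d: "dual_pair \<phi> \<psi>" and s: "s < R"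
  shows "f (t + real s * real M) = real M * (\<Sum>k<N. complex_of_real (\<psi> (t + real s * real M - real k * real a)) * fold \<phi> f k t)"
proof -
  define u where "u = t + real s * real M"
  have inner: "(\<Sum>k<N. \<psi> (u - real k * real a) * \<phi> (t + real s' * real M - real k * real a)) = (if s' = s then 1 / real M else 0)"
    if s': "s' < R" for s'
  proof -
    \<comment> \<open>Translates are subtracted here but added in \<open>dual_pair\<close>. Starting
      from the last translate and reversing the order of summation matches the two.\<close>
    define v where "v = u - real (N - 1) * real a"
    have "(\<Sum>k<N. \<psi> (u - real k * real a) * \<phi> (t + real s' * real M - real k * real a))
        = (\<Sum>i<N. \<psi> (v + real a * real i) * \<phi> (v + real a * real i - of_int (int s - int s') * real M))"
      by (subst sum.nat_diff_reindex[symmetric])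
        (intro sum.cong refl arg_cong2[where f = "(*)"] arg_cong[where f = \<psi>] arg_cong[where f = \<phi>];
          use NR_pos in \<open>simp add: v_def u_def of_nat_diff algebra_simps\<close>)
    also have "\<dots> = (if int R dvd int s - int s' then 1 / real M else 0)" using d unfolding dual_pair_def by blast
    finally show ?thesis using dvd_diff_index[OF s s'] by auto
  qed
  have "(\<Sum>k<N. complex_of_real (\<psi> (u - real k * real a)) * fold \<phi> f k t)
      = (\<Sum>k<N. \<Sum>s'<R. complex_of_real (\<psi> (u - real k * real a) * \<phi> (t + real s' * real M - real k * real a)) * f (t + real s' * real M))"
    by (simp add: fold_def sum_distrib_left mult.assoc)
  also have "\<dots> = (\<Sum>s'<R. complex_of_real (\<Sum>k<N. \<psi> (u - real k * real a) * \<phi> (t + real s' * real M - real k * real a)) * f (t + real s' * real M))"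
    by (subst sum.swap) (simp add: sum_distrib_right)
  also have "\<dots> = (\<Sum>s'<R. if s' = s then complex_of_real (1 / real M) * f (t + real s' * real M) else 0)"
    by (intro sum.cong refl) (subst inner, auto)
  also have "\<dots> = f u / real M" using s by (simp add: u_def)
  finally show ?thesis using pos by (simp add: u_def)
qed

text \<open>By Parseval the frame sum is \<open>T f\<close>, a multiple of the squared norms of the
  folds. Boundedness of \<phi> controls the folds by \<open>f\<close>;
  \<open>dual_pair_reconstruct\<close> with bounded \<psi> controls \<open>f\<close> by the folds.
  This yields \<open>C2\<close> and \<open>C1\<close>.\<close>

lemma gab_frame:
  assumes w: "window \<phi> B" and w': "window \<psi> B'" and d: "dual_pair \<phi> \<psi>"
  shows "is_frame S (gaborT_index K a) (gab \<phi>)"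
proof -
  define T where "T f = (\<Sum>k<N. real M * nrm2 {0..real M} (fold \<phi> f k))" for f
  define C1 where "C1 = real R * (real N * (real M * B')\<^sup>2) / real M"
  define C2 where "C2 = real N * (real M * (real R * B\<^sup>2))"
  have [measurable]: "\<psi> \<in> borel_measurable borel" using w' by (rule window_measurable)
  have B1: "B \<ge> 1" "B' \<ge> 1" using w w' unfolding window_def by blast+
  have C: "C1 > 0" "C2 > 0" using NR_pos pos B1 by (auto simp: C1_def C2_def)
  have upper: "T f \<le> C2 * nrm2 S f" if f: "L2 S f" for f
  proof -
    have "T f \<le> (\<Sum>k<N. real M * (real R * B\<^sup>2 * nrm2 S f))"
      unfolding T_def by (intro sum_mono mult_left_mono fold_L2(2)[OF w f]) auto
    then show ?thesis by (simp add: C2_def mult.assoc)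
  qed
  have lower: "nrm2 S f \<le> C1 * T f" if f: "L2 S f" for f
  proof -
    have "nrm2 {0..real M} (\<lambda>t. f (t + real s * real M)) \<le> real N * (real M * B')\<^sup>2 * (\<Sum>k<N. nrm2 {0..real M} (fold \<phi> f k))"
      if s: "s < R" for s
    proof -
      have b: "cmod (of_real (real M * \<psi> (t + real s * real M - real k * real a))) \<le> real M * B'" for k t
        using window_bound[OF w'] by (simp add: norm_mult mult_left_mono)
      have "(\<lambda>t. f (t + real s * real M)) = (\<lambda>t. \<Sum>k<N. of_real (real M * \<psi> (t + real s * real M - real k * real a)) * fold \<phi> f k t)"
        unfolding dual_pair_reconstruct[OF d s] by (simp add: sum_distrib_left mult.assoc)
      then show ?thesis
        using L2_lincomb(2)[of "{..<N}" "{0..real M}" "fold \<phi> f" "\<lambda>k t. of_real (real M * \<psi> (t + real s * real M - real k * real a))" "real M * B'", OF _ _ fold_L2(1)[OF w f] _ b]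
        by simp
    qed
    then have "nrm2 S f \<le> (\<Sum>s<R. real N * (real M * B')\<^sup>2 * (\<Sum>k<N. nrm2 {0..real M} (fold \<phi> f k)))"
      unfolding nrm2_fold(2)[OF f] by (intro sum_mono) auto
    also have "\<dots> = C1 * T f" using pos by (simp add: C1_def T_def sum_distrib_left[symmetric])
    finally show ?thesis .
  qed
  show ?thesis unfolding is_frame_def
  proof (rule conjI, intro ballI gab_L2[OF w], rule exI[of _ "1 / C1"], rule exI[of _ C2], intro conjI allI impI)
    fix f assume f: "L2 S f"
    have hs: "((\<lambda>i. (cmod (ip S f (gab \<phi> i)))\<^sup>2) has_sum T f) (gaborT_index K a)"
      unfolding T_def by (rule gab_parseval[OF w f])
    then show "(\<lambda>i. (cmod (ip S f (gab \<phi> i)))\<^sup>2) summable_on gaborT_index K a" by (rule has_sum_imp_summable)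
    have eq: "(\<Sum>\<^sub>\<infinity>i\<in>gaborT_index K a. (cmod (ip S f (gab \<phi> i)))\<^sup>2) = T f" using hs by (rule infsumI)
    show "1 / C1 * nrm2 S f \<le> (\<Sum>\<^sub>\<infinity>i\<in>gaborT_index K a. (cmod (ip S f (gab \<phi> i)))\<^sup>2)"
      unfolding eq using lower[OF f] C by (simp add: field_simps)
    show "(\<Sum>\<^sub>\<infinity>i\<in>gaborT_index K a. (cmod (ip S f (gab \<phi> i)))\<^sup>2) \<le> C2 * nrm2 S f"
      unfolding eq by (rule upper[OF f])
  qed (use C in auto)
qed

section \<open>Convergence of the dual expansion\<close>

definition slice :: "(nat \<times> int) set \<Rightarrow> nat \<Rightarrow> int set" where
  "slice X k = {l. (k, l) \<in> X}"

lemma finite_slice: "finite X \<Longrightarrow> finite (slice X k)"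
  unfolding slice_def by (rule finite_subset[of _ "snd ` X"]) force+

lemma sum_slice:
  assumes "finite X" "X \<subseteq> gaborT_index K a"
  shows "(\<Sum>i\<in>X. h i) = (\<Sum>k<N. \<Sum>l\<in>slice X k. h (k, l))"
proof -
  have "X = Sigma {..<N} (slice X)" using assms(2) by (auto simp: slice_def gaborT_index_def)
  then have "(\<Sum>i\<in>X. h i) = (\<Sum>i\<in>Sigma {..<N} (slice X). h i)" by simp
  also have "\<dots> = (\<Sum>k<N. \<Sum>l\<in>slice X k. h (k, l))"
    by (subst sum.Sigma) (use finite_slice[OF assms(1)] in auto)
  finally show ?thesis .
qed

lemma filterlim_slice:
  assumes k: "k < N"
  shows "filterlim (\<lambda>X. slice X k) (finite_subsets_at_top UNIV) (finite_subsets_at_top (gaborT_index K a))"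
  unfolding filterlim_finite_subsets_at_top eventually_finite_subsets_at_top
proof (intro allI impI)
  fix Y :: "int set" assume "finite Y \<and> Y \<subseteq> UNIV"
  then show "\<exists>X. finite X \<and> X \<subseteq> gaborT_index K a \<and> (\<forall>Z. finite Z \<and> X \<subseteq> Z \<and> Z \<subseteq> gaborT_index K a \<longrightarrow>
      finite (slice Z k) \<and> Y \<subseteq> slice Z k \<and> slice Z k \<subseteq> UNIV)"
    using k finite_slice by (intro exI[of _ "{k} \<times> Y"]) (auto simp: gaborT_index_def slice_def[abs_def])
qed

text \<open>The reconstruction formula is linear in the folds, and a partial sum over
  \<open>X\<close> replaces each fold by a partial Fourier sum over the slice of \<open>X\<close>.
  The error is thus controlled by the finitely many remainders \<open>rest X k\<close>, which tend
  to 0 because each slice exhausts the integers as \<open>X\<close> grows.\<close>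

theorem gab_dual:
  assumes w: "window \<phi> B" and w': "window \<psi> B'" and d: "dual_pair \<phi> \<psi>"
  shows "is_dual S (gaborT_index K a) (gab \<phi>) (gab \<psi>)"
  unfolding is_dual_def
proof (intro conjI allI impI)
  show "is_frame S (gaborT_index K a) (gab \<psi>)" by (rule gab_frame[OF w' w dual_pair_sym[OF d]])
  fix f assume f: "L2 S f"
  define D where "D = real R * (real N * (real M * B')\<^sup>2)"
  let ?F = "fold \<phi> f"
  define rest where "rest X k t = ?F k t - (\<Sum>l\<in>slice X k. coef (?F k) l / real M * e l t)" for X k t
  have [measurable]: "\<psi> \<in> borel_measurable borel" using w' by (rule window_measurable)
  have FL: "L2 {0..real M} (?F k)" for k by (rule fold_L2(1)[OF w f])
  have restL: "L2 {0..real M} (rest X k)" if "finite X" for X k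
    unfolding rest_def[abs_def] using finite_slice[OF that] by (intro L2_diff FL L2_sum L2_cmult L2_e) auto
  have bound: "nrm2 S (\<lambda>t. f t - (\<Sum>i\<in>X. ip S f (gab \<phi> i) * gab \<psi> i t)) \<le> D * (\<Sum>k<N. nrm2 {0..real M} (rest X k))"
    if X: "finite X" "X \<subseteq> gaborT_index K a" for X
  proof -
    define h where "h t = f t - (\<Sum>i\<in>X. ip S f (gab \<phi> i) * gab \<psi> i t)" for t
    have hL: "L2 S h" unfolding h_def[abs_def] by (intro L2_diff f L2_sum X L2_cmult gab_L2[OF w']) auto
    have h_eq: "h (t + real s * real M) = (\<Sum>k<N. complex_of_real (real M * \<psi> (t + real s * real M - real k * real a)) * rest X k t)"
      if s: "s < R" for s t
    proof -
      let ?\<psi> = "\<lambda>k. complex_of_real (\<psi> (t + real s * real M - real k * real a))"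
      have "(\<Sum>i\<in>X. ip S f (gab \<phi> i) * gab \<psi> i (t + real s * real M))
          = (\<Sum>k<N. \<Sum>l\<in>slice X k. coef (?F k) l * (?\<psi> k * e l t))"
        unfolding sum_slice[OF X] ip_gab[OF w f] gab_eq[OF w'] e_periodic ..
      also have "\<dots> = (\<Sum>k<N. real M * (?\<psi> k * (\<Sum>l\<in>slice X k. coef (?F k) l / real M * e l t)))"
        using pos by (simp add: sum_distrib_left mult.left_commute)
      finally have sum_eq: "(\<Sum>i\<in>X. ip S f (gab \<phi> i) * gab \<psi> i (t + real s * real M))
          = (\<Sum>k<N. real M * (?\<psi> k * (\<Sum>l\<in>slice X k. coef (?F k) l / real M * e l t)))" .
      have f_eq: "f (t + real s * real M) = (\<Sum>k<N. real M * (?\<psi> k * ?F k t))"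
        by (simp only: dual_pair_reconstruct[OF d s, of f t] sum_distrib_left)
      have "h (t + real s * real M) = (\<Sum>k<N. real M * (?\<psi> k * ?F k t)) - (\<Sum>k<N. real M * (?\<psi> k * (\<Sum>l\<in>slice X k. coef (?F k) l / real M * e l t)))"
        unfolding h_def sum_eq f_eq ..
      also have "\<dots> = (\<Sum>k<N. complex_of_real (real M * \<psi> (t + real s * real M - real k * real a)) * rest X k t)"
        unfolding sum_subtractf[symmetric] rest_def by (intro sum.cong refl) (simp add: right_diff_distrib mult.assoc)
      finally show ?thesis .
    qed
    have "nrm2 {0..real M} (\<lambda>t. h (t + real s * real M)) \<le> real N * (real M * B')\<^sup>2 * (\<Sum>k<N. nrm2 {0..real M} (rest X k))"
      if s: "s < R" for s
    proof -
      have b: "cmod (complex_of_real (real M * \<psi> (t + real s * real M - real k * real a))) \<le> real M * B'" for k t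
        using window_bound[OF w'] by (simp add: norm_mult mult_left_mono)
      show ?thesis unfolding h_eq[OF s]
        using L2_lincomb(2)[of "{..<N}" "{0..real M}" "rest X" "\<lambda>k t. complex_of_real (real M * \<psi> (t + real s * real M - real k * real a))" "real M * B'", OF _ _ restL[OF X(1)] _ b]
        by simp
    qed
    then have "nrm2 S h \<le> (\<Sum>s<R. real N * (real M * B')\<^sup>2 * (\<Sum>k<N. nrm2 {0..real M} (rest X k)))"
      unfolding nrm2_fold(2)[OF hL] by (intro sum_mono) auto
    also have "\<dots> = D * (\<Sum>k<N. nrm2 {0..real M} (rest X k))" by (simp add: D_def)
    finally show ?thesis unfolding h_def .
  qed
  have "((\<lambda>X. nrm2 {0..real M} (rest X k)) \<longlongrightarrow> 0) (finite_subsets_at_top (gaborT_index K a))" if "k < N" for k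
    using filterlim_compose[OF fourier_expansion[OF FL] filterlim_slice[OF that]] unfolding rest_def .
  then have lim: "((\<lambda>X. D * (\<Sum>k<N. nrm2 {0..real M} (rest X k))) \<longlongrightarrow> D * (\<Sum>k<N. 0)) (finite_subsets_at_top (gaborT_index K a))"
    by (intro tendsto_mult tendsto_const tendsto_sum) auto
  show "((\<lambda>X. nrm2 S (\<lambda>t. f t - (\<Sum>i\<in>X. ip S f (gab \<phi> i) * gab \<psi> i t))) \<longlongrightarrow> 0) (finite_subsets_at_top (gaborT_index K a))"
  proof (rule tendsto_sandwich[OF _ _ tendsto_const])
    show "\<forall>\<^sub>F X in finite_subsets_at_top (gaborT_index K a). 0 \<le> nrm2 S (\<lambda>t. f t - (\<Sum>i\<in>X. ip S f (gab \<phi> i) * gab \<psi> i t))"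
      by (simp add: nrm2_nonneg)
    show "\<forall>\<^sub>F X in finite_subsets_at_top (gaborT_index K a). nrm2 S (\<lambda>t. f t - (\<Sum>i\<in>X. ip S f (gab \<phi> i) * gab \<psi> i t))
        \<le> D * (\<Sum>k<N. nrm2 {0..real M} (rest X k))"
      using bound by (intro eventually_finite_subsets_at_top_weakI)
    show "((\<lambda>X. D * (\<Sum>k<N. nrm2 {0..real M} (rest X k))) \<longlongrightarrow> 0) (finite_subsets_at_top (gaborT_index K a))"
      using lim by simp
  qed
qed

text \<open>The roles of the two lattice constants are exchanged here: the assumption is the
  duality relation for \<open>(M, 1/a)\<close>.\<close>
theorem gab_riesz:
  assumes w: "window \<phi> B" and w': "window \<psi> B'"
    and d: "\<And>t k. (\<Sum>i<R. \<psi> (t + real M * real i) * \<phi> (t + real M * real i - of_int k * real a)) = (if int N dvd k then 1 / real a else 0)"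
  shows "is_riesz_seq S (gaborT_index K a) (gab \<phi>)"
proof -
  define C1 where "C1 = real N * (real R * (real a * B')\<^sup>2) / real M"
  define C2 where "C2 = real R * (real N * B\<^sup>2 * real M)"
  have B1: "B \<ge> 1" "B' \<ge> 1" using w w' unfolding window_def by blast+
  have C: "C1 > 0" "C2 > 0" using NR_pos pos B1 by (auto simp: C1_def C2_def)
  have [measurable]: "\<psi> \<in> borel_measurable borel" "\<phi> \<in> borel_measurable borel"
    using w w' by (auto intro: window_measurable)
  have bounds: "1 / C1 * (\<Sum>i\<in>X. (cmod (c i))\<^sup>2) \<le> nrm2 S (\<lambda>t. \<Sum>i\<in>X. c i * gab \<phi> i t) \<and>
      nrm2 S (\<lambda>t. \<Sum>i\<in>X. c i * gab \<phi> i t) \<le> C2 * (\<Sum>i\<in>X. (cmod (c i))\<^sup>2)"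
    if X: "finite X" "X \<subseteq> gaborT_index K a" for X c
  proof -
    \<comment> \<open>Terms with the same translate are collected into one trigonometric polynomial,
      whose norm is that of its coefficients by orthogonality.\<close>
    define m where "m k t = (\<Sum>l\<in>slice X k. c (k, l) * e l t)" for k t
    define h where "h t = (\<Sum>i\<in>X. c i * gab \<phi> i t)" for t
    have mL: "L2 {0..real M} (m k)" for k
      unfolding m_def[abs_def] using finite_slice[OF X(1)] by (intro L2_sum L2_cmult L2_e) auto
    have hL: "L2 S h" unfolding h_def[abs_def] by (intro L2_sum X L2_cmult gab_L2[OF w]) auto
    have nm: "(\<Sum>k<N. nrm2 {0..real M} (m k)) = real M * (\<Sum>i\<in>X. (cmod (c i))\<^sup>2)"
      unfolding m_def[abs_def] nrm2_trig_sum[OF finite_slice[OF X(1)]] sum_slice[OF X] by (simp add: sum_distrib_left)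
    have h_eq: "h (t + real s * real M) = (\<Sum>k<N. complex_of_real (\<phi> (t + real s * real M - real k * real a)) * m k t)" for s t
      unfolding h_def sum_slice[OF X] gab_eq[OF w] e_periodic m_def by (simp add: sum_distrib_left mult.left_commute)
    \<comment> \<open>By the biorthogonality \<open>d\<close>, the matrix of \<psi> is a left
      inverse of the matrix of \<phi> in \<open>h_eq\<close>, up to the factor \<open>a\<close>. So
      the polynomials are recovered pointwise from \<open>h\<close>, and the lower Riesz bound
      follows from the boundedness of \<psi>.\<close>
    have m_eq: "m j t = (\<Sum>s<R. complex_of_real (real a * \<psi> (t + real s * real M - real j * real a)) * h (t + real s * real M))"
      if j: "j < N" for j t
    proof -
      have inner: "(\<Sum>s<R. \<psi> (t + real s * real M - real j * real a) * \<phi> (t + real s * real M - real k * real a)) = (if k = j then 1 / real a else 0)"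
        if k: "k < N" for k
      proof -
        have "(\<Sum>s<R. \<psi> (t + real s * real M - real j * real a) * \<phi> (t + real s * real M - real k * real a))
          = (\<Sum>s<R. \<psi> ((t - real j * real a) + real M * real s) * \<phi> ((t - real j * real a) + real M * real s - of_int (int k - int j) * real a))"
          by (intro sum.cong refl) (simp add: algebra_simps)
        also have "\<dots> = (if int N dvd int k - int j then 1 / real a else 0)" by (rule d)
        finally show ?thesis using dvd_diff_index[OF k j] by simp
      qed
      have "(\<Sum>s<R. complex_of_real (real a * \<psi> (t + real s * real M - real j * real a)) * h (t + real s * real M))
        = (\<Sum>s<R. \<Sum>k<N. complex_of_real (real a * (\<psi> (t + real s * real M - real j * real a) * \<phi> (t + real s * real M - real k * real a))) * m k t)"
        unfolding h_eq by (simp add: sum_distrib_left mult.assoc)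
      also have "\<dots> = (\<Sum>k<N. complex_of_real (real a * (\<Sum>s<R. \<psi> (t + real s * real M - real j * real a) * \<phi> (t + real s * real M - real k * real a))) * m k t)"
        by (subst sum.swap) (simp add: sum_distrib_left sum_distrib_right)
      also have "\<dots> = (\<Sum>k<N. if k = j then complex_of_real (real a * (1 / real a)) * m k t else 0)"
        by (intro sum.cong refl) (subst inner, auto)
      also have "\<dots> = m j t" using j pos by simp
      finally show ?thesis by simp
    qed
    have lower: "nrm2 {0..real M} (m k) \<le> real R * (real a * B')\<^sup>2 * nrm2 S h" if k: "k < N" for k
    proof -
      have b: "cmod (complex_of_real (real a * \<psi> (t + real s * real M - real k * real a))) \<le> real a * B'" for s t
        using window_bound[OF w'] by (simp add: norm_mult mult_left_mono)
      have eq: "m k = (\<lambda>t. \<Sum>s<R. complex_of_real (real a * \<psi> (t + real s * real M - real k * real a)) * h (t + real s * real M))"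
        by (rule ext) (rule m_eq[OF k])
      show ?thesis unfolding eq nrm2_fold(2)[OF hL]
        using L2_lincomb(2)[of "{..<R}" "{0..real M}" "\<lambda>s t. h (t + real s * real M)" "\<lambda>s t. complex_of_real (real a * \<psi> (t + real s * real M - real k * real a))" "real a * B'", OF _ _ _ _ b]
          nrm2_fold(1)[OF hL] by simp
    qed
    have upper: "nrm2 {0..real M} (\<lambda>t. h (t + real s * real M)) \<le> real N * B\<^sup>2 * (real M * (\<Sum>i\<in>X. (cmod (c i))\<^sup>2))" for s
      unfolding h_eq nm[symmetric]
      using L2_lincomb(2)[of "{..<N}" "{0..real M}" m "\<lambda>k t. complex_of_real (\<phi> (t + real s * real M - real k * real a))" B, OF _ _ mL _ window_bound[OF w]]
      by simp
    have "real M * (\<Sum>i\<in>X. (cmod (c i))\<^sup>2) \<le> (\<Sum>k<N. real R * (real a * B')\<^sup>2 * nrm2 S h)"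
      unfolding nm[symmetric] by (intro sum_mono lower) auto
    also have "\<dots> = real M * (C1 * nrm2 S h)" using pos by (simp add: C1_def)
    finally have 1: "(\<Sum>i\<in>X. (cmod (c i))\<^sup>2) \<le> C1 * nrm2 S h" using pos by simp
    have "nrm2 S h \<le> (\<Sum>s<R. real N * B\<^sup>2 * (real M * (\<Sum>i\<in>X. (cmod (c i))\<^sup>2)))"
      unfolding nrm2_fold(2)[OF hL] by (intro sum_mono upper)
    also have "\<dots> = C2 * (\<Sum>i\<in>X. (cmod (c i))\<^sup>2)" by (simp add: C2_def)
    finally have 2: "nrm2 S h \<le> C2 * (\<Sum>i\<in>X. (cmod (c i))\<^sup>2)" .
    have "1 / C1 * (\<Sum>i\<in>X. (cmod (c i))\<^sup>2) \<le> nrm2 S h" using 1 C by (simp add: field_simps)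
    with 2 show ?thesis unfolding h_def by blast
  qed
  show ?thesis unfolding is_riesz_seq_def
  proof (rule conjI, intro ballI gab_L2[OF w], rule exI[of _ "1 / C1"], rule exI[of _ C2], intro conjI allI impI)
    show "1 / C1 > 0" "C2 > 0" using C by auto
  qed (use bounds in blast)+
qed

lemma periodize_window:
  assumes "exp_decay h"
  shows "\<exists>B. window (periodize (real K) h) B"
proof -
  have K0: "real K > 0" using pos by simp
  obtain D where "\<And>x. \<bar>periodize (real K) h x\<bar> \<le> D" using periodize_bound[OF assms K0] by blast
  then have "window (periodize (real K) h) (max 1 D)"
    unfolding window_def using periodize_measurable[OF assms K0] periodize_periodic[of "real K" h]
    by (simp add: le_max_iff_disj)
  then show ?thesis by blast
qed

end

theorem theorem6:
  fixes g :: "real \<Rightarrow> real" and m :: nat and C :: real and \<delta> :: "nat \<Rightarrow> real"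
    and a K M :: nat
  assumes tp: "tp_finite_type g m C \<delta>"
    and cont: "continuous_on UNIV g"
    and m2: "m \<ge> 2"
    and pos: "a > 0" "K > 0" "M > 0"
    and aK: "a dvd K" and MK: "M dvd K"
  shows "(real a / real M < 1 \<longrightarrow>
            is_frame {0..real K} (gaborT_index K a)
              (gaborT (real K) (real a) (1 / real M)
                 (\<lambda>t. complex_of_real (periodize (real K) g t))) \<and>
            (\<forall>L::nat. is_dual {0..real K} (gaborT_index K a)
              (gaborT (real K) (real a) (1 / real M)
                 (\<lambda>t. complex_of_real (periodize (real K) g t)))
              (gaborT (real K) (real a) (1 / real M)
                 (\<lambda>t. complex_of_real (periodize (real K)
                    (alg_gamma g (tp_p m \<delta>) (tp_q m \<delta>) (real a) (1 / real M) L) t)))))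
       \<and> (real a / real M > 1 \<longrightarrow>
            is_riesz_seq {0..real K} (gaborT_index K a)
              (gaborT (real K) (real a) (1 / real M)
                 (\<lambda>t. complex_of_real (periodize (real K) g t))))"
proof -
  interpret torus K a M by unfold_locales (use assms in auto)
  let ?\<Phi> = "periodize (real K) g"
  let ?\<gamma> = "alg_gamma g (tp_p m \<delta>) (tp_q m \<delta>)"
  have K0: "real K > 0" using pos by simp
  have below: "\<exists>B B'. window ?\<Phi> B \<and> window (periodize (real K) (?\<gamma> (real a) (1 / real M) L)) B' \<and>
      dual_pair ?\<Phi> (periodize (real K) (?\<gamma> (real a) (1 / real M) L))" if "real a / real M < 1" for L
  proof -
    interpret tp_window g m C \<delta> "real a" "1 / real M" L
      by unfold_locales (use assms that in auto)
    have "dual_pair ?\<Phi> (periodize (real K) (?\<gamma> (real a) (1 / real M) L))"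
      unfolding dual_pair_def
    proof (intro allI, rule periodize_biorthogonal[OF g_decay gamma_finite_support])
      show "((\<lambda>i::int. ?\<gamma> (real a) (1 / real M) L (t + real a * of_int i) * g (t + real a * of_int i - of_int k * real M))
          has_sum (if k = 0 then 1 / real M else 0)) UNIV" for t k
        using gamma_biorthogonal[of t k] by simp
    qed (use K_eq NR_pos K0 in \<open>simp_all only: mult.commute\<close>)
    then show ?thesis using periodize_window[OF g_decay] periodize_window[OF gamma_decay] by blast
  qed
  have above: "is_riesz_seq {0..real K} (gaborT_index K a) (gab ?\<Phi>)" if "real a / real M > 1"
  proof -
    have "real M * (1 / real a) < 1" using that pos by (simp add: field_simps)
    \<comment> \<open>The adjoint lattice satisfies the density condition of the algorithm, which
      therefore supplies the coefficient functionals; the auxiliary window is built with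
      \<open>L = 0\<close>.\<close>
    then interpret tp_window g m C \<delta> "real M" "1 / real a" 0
      by unfold_locales (use assms in auto)
    obtain B B' where w: "window ?\<Phi> B" "window (periodize (real K) (?\<gamma> (real M) (1 / real a) 0)) B'"
      using periodize_window[OF g_decay] periodize_window[OF gamma_decay] by blast
    show ?thesis
    proof (rule gab_riesz[OF w], rule periodize_biorthogonal[OF g_decay gamma_finite_support])
      show "((\<lambda>i::int. ?\<gamma> (real M) (1 / real a) 0 (t + real M * of_int i) * g (t + real M * of_int i - of_int k * real a))
          has_sum (if k = 0 then 1 / real a else 0)) UNIV" for t k
        using gamma_biorthogonal[of t k] by simp
    qed (use K_eq NR_pos K0 in \<open>simp_all only: mult.commute\<close>)
  qed
  show ?thesis using below gab_frame gab_dual above by blast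
qed

end
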